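(* Let $\Omega$ be a bounded Lipschitz domain in $\mathbb{R}^d$, $d\ge2$, and $T>0$. Suppose $\nabla u\in L^2(0,T;\dot W^{1,p}(\Omega))$ and $\partial_tu\in L^2(0,T;L^p(\Omega))$, where $\frac{2d}{d+2}\le p<2$, $p>1$. Then for any $\delta>0$ with $\delta^2\le T$ and any $s\in[0,T-\delta^2]$, $$\|\nabla u\|_{L^2(\Omega\times(s,s+\delta^2))}\le C\delta^{1+\frac d2-\frac dp}\{\|\nabla u\|_{L^2(0,T;\dot W^{1,p}(\Omega))}+\|\partial_tu\|_{L^2(0,T;L^p(\Omega))}\},$$ where $C$ depends only on $d,p$ and the Lipschitz character of $\Omega$.
   Context: For $1\le p<d$, $p^*:=\frac{dp}{d-p}$, $\dot W^{1,p}(\Omega):=\{v\in L^{p^*}(\Omega):\|\nabla v\|_{L^p(\Omega)}<\infty\}$ with norm $\|v\|_{\dot W^{1,p}(\Omega)}=\|v\|_{L^{p^*}(\Omega)}+\|\nabla v\|_{L^p(\Omega)}$. $\nabla$ is the gradient in $x$.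
   Formalization: The constant C is allowed to depend also on a positive lower bound T_0 for T (uniform for all T ≥ T_0), for every p in the range; with C independent of T the claim fails as T→0 for p>2d/(d+2), e.g. u=x_1, s=0, δ²=T. *)

theory Defs
  imports "HOL-Analysis.Analysis"
begin

text \<open>
  Coordinates in the neighbourhood of a boundary point are given by a unit vector \<open>\<nu>\<close> (the direction
  of the last coordinate axis) and the hyperplane orthogonal to it; \<open>x - (x \<bullet> \<nu>) *\<^sub>R \<nu>\<close> plays the role
  of \<open>x'\<close> and \<open>x \<bullet> \<nu>\<close> that of \<open>x\<^sub>d\<close>.

  The triple \<open>(r0, M, N)\<close> is the Lipschitz character: the boundary is covered by \<open>N\<close> balls of radius
  \<open>r0\<close>, and in the concentric balls of radius \<open>2 * r0\<close> the domain is the part above an \<open>M\<close>-Lipschitz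
  graph. The doubling makes the triple control the local geometry at every boundary point; without
  it the overlap of the charts would depend on the domain. By compactness every bounded Lipschitz
  domain has such a triple.
\<close>

definition bounded_lipschitz_domain :: "real \<Rightarrow> real \<Rightarrow> nat \<Rightarrow> 'a::euclidean_space set \<Rightarrow> bool" where
  "bounded_lipschitz_domain r0 M N \<Omega> \<longleftrightarrow>
     open \<Omega> \<and> connected \<Omega> \<and> \<Omega> \<noteq> {} \<and> bounded \<Omega> \<and> r0 > 0 \<and>
     (\<exists>Z. finite Z \<and> card Z \<le> N \<and> Z \<subseteq> frontier \<Omega> \<and> frontier \<Omega> \<subseteq> (\<Union>z\<in>Z. ball z r0) \<and>
       (\<forall>z\<in>Z. \<exists>\<nu> \<psi>. norm \<nu> = 1 \<and> M-lipschitz_on {y. y \<bullet> \<nu> = 0} \<psi> \<and>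
          \<Omega> \<inter> ball z (2 * r0) = {x \<in> ball z (2 * r0). \<psi> (x - (x \<bullet> \<nu>) *\<^sub>R \<nu>) < x \<bullet> \<nu>}))"

primrec C_k :: "nat \<Rightarrow> ('a::euclidean_space \<Rightarrow> real) \<Rightarrow> bool" where
  "C_k 0 f \<longleftrightarrow> continuous_on UNIV f"
| "C_k (Suc k) f \<longleftrightarrow> (\<forall>x. f differentiable (at x)) \<and>
     (\<forall>e\<in>Basis. C_k k (\<lambda>x. frechet_derivative f (at x) e))"

definition test_functions :: "'a::euclidean_space set \<Rightarrow> ('a \<Rightarrow> real) set" where
  "test_functions U = {\<phi>. (\<forall>k. C_k k \<phi>) \<and> (\<exists>K. compact K \<and> K \<subseteq> U \<and> (\<forall>x. x \<notin> K \<longrightarrow> \<phi> x = 0))}"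

text \<open>
  Functions are defined everywhere, take arbitrary values outside the set under consideration, and
  are Borel; as every Lebesgue measurable function agrees almost everywhere with a Borel one, the
  spaces of classes of functions are the usual ones.
\<close>

definition locally_integrable ::
    "'a::euclidean_space set \<Rightarrow> ('a \<Rightarrow> 'b::euclidean_space) \<Rightarrow> bool" where
  "locally_integrable U f \<longleftrightarrow> set_borel_measurable lborel U f \<and>
     (\<forall>K. compact K \<and> K \<subseteq> U \<longrightarrow> set_integrable lborel K f)"

definition weak_deriv ::
    "'a::euclidean_space set \<Rightarrow> 'a \<Rightarrow> ('a \<Rightarrow> 'b::euclidean_space) \<Rightarrow> ('a \<Rightarrow> 'b) \<Rightarrow> bool" where
  "weak_deriv U e f g \<longleftrightarrow> locally_integrable U f \<and> locally_integrable U g \<and>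
     (\<forall>\<phi>\<in>test_functions U.
        (LINT x:U|lborel. frechet_derivative \<phi> (at x) e *\<^sub>R f x) = - (LINT x:U|lborel. \<phi> x *\<^sub>R g x))"

definition Lp :: "real \<Rightarrow> 'a::euclidean_space set \<Rightarrow> ('a \<Rightarrow> 'b::euclidean_space) set" where
  "Lp p U = {f. set_borel_measurable lborel U f \<and> set_integrable lborel U (\<lambda>x. norm (f x) powr p)}"

definition Lp_norm :: "real \<Rightarrow> 'a::euclidean_space set \<Rightarrow> ('a \<Rightarrow> 'b::euclidean_space) \<Rightarrow> real" where
  "Lp_norm p U f = (LINT x:U|lborel. norm (f x) powr p) powr (1 / p)"

text \<open>
  The weak gradient of a (vector-valued) function is the family of its weak partial derivatives,
  indexed by the standard basis; it is unique up to null sets.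
\<close>

definition is_weak_gradient ::
    "'a::euclidean_space set \<Rightarrow> ('a \<Rightarrow> 'b::euclidean_space) \<Rightarrow> ('a \<Rightarrow> 'a \<Rightarrow> 'b) \<Rightarrow> bool" where
  "is_weak_gradient U v V \<longleftrightarrow> (\<forall>i\<in>Basis. weak_deriv U i v (V i))"

definition gradient_size :: "('a::euclidean_space \<Rightarrow> 'a \<Rightarrow> 'b::euclidean_space) \<Rightarrow> 'a \<Rightarrow> real" where
  "gradient_size V x = sqrt (\<Sum>i\<in>Basis. (norm (V i x))\<^sup>2)"

definition weak_gradient ::
    "'a::euclidean_space set \<Rightarrow> ('a \<Rightarrow> 'b::euclidean_space) \<Rightarrow> 'a \<Rightarrow> 'a \<Rightarrow> 'b" where
  "weak_gradient U v = (SOME V. is_weak_gradient U v V)"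

definition sobolev_exponent :: "'a::euclidean_space itself \<Rightarrow> real \<Rightarrow> real" where
  "sobolev_exponent _ p = real DIM('a) * p / (real DIM('a) - p)"

definition hom_sobolev ::
    "real \<Rightarrow> 'a::euclidean_space set \<Rightarrow> ('a \<Rightarrow> 'b::euclidean_space) set" where
  "hom_sobolev p U = {v \<in> Lp (sobolev_exponent TYPE('a) p) U.
     \<exists>V. is_weak_gradient U v V \<and> gradient_size V \<in> Lp p U}"

definition hom_sobolev_norm ::
    "real \<Rightarrow> 'a::euclidean_space set \<Rightarrow> ('a \<Rightarrow> 'b::euclidean_space) \<Rightarrow> real" where
  "hom_sobolev_norm p U v =
     Lp_norm (sobolev_exponent TYPE('a) p) U v + Lp_norm p U (gradient_size (weak_gradient U v))"

text \<open>
  \<open>L\<^sup>2(0,T;X)\<close> for a space \<open>X\<close> of functions on \<open>\<Omega>\<close> with norm \<open>nrm\<close>, as functions of \<open>(x, t)\<close>. For the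
  separable spaces \<open>X = L\<^sup>p\<close> and \<open>X = hom_sobolev\<close>, strong measurability of \<open>t \<mapsto> v(\<cdot>, t)\<close> amounts to
  joint measurability of a representative. The time integral is taken over the completed measure
  because the norm of a slice is meaningful for almost every time only.
\<close>

definition L2_time ::
    "real \<Rightarrow> 'a::euclidean_space set \<Rightarrow> ('a \<Rightarrow> 'b::euclidean_space) set \<Rightarrow>
     (('a \<Rightarrow> 'b) \<Rightarrow> real) \<Rightarrow> ('a \<times> real \<Rightarrow> 'b) set" where
  "L2_time T \<Omega> X nrm = {v. set_borel_measurable lborel (\<Omega> \<times> {0<..<T}) v \<and>
     (AE t in lborel. t \<in> {0<..<T} \<longrightarrow> (\<lambda>x. v (x, t)) \<in> X) \<and>
     set_integrable lebesgue {0<..<T} (\<lambda>t. (nrm (\<lambda>x. v (x, t)))\<^sup>2)}"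

definition L2_time_norm ::
    "real \<Rightarrow> (('a::euclidean_space \<Rightarrow> 'b::euclidean_space) \<Rightarrow> real) \<Rightarrow> ('a \<times> real \<Rightarrow> 'b) \<Rightarrow> real" where
  "L2_time_norm T nrm v = sqrt (LINT t:{0<..<T}|lebesgue. (nrm (\<lambda>x. v (x, t)))\<^sup>2)"

definition is_spatial_gradient ::
    "('a::euclidean_space \<times> real) set \<Rightarrow> ('a \<times> real \<Rightarrow> real) \<Rightarrow> ('a \<times> real \<Rightarrow> 'a) \<Rightarrow> bool" where
  "is_spatial_gradient Q u G \<longleftrightarrow> (\<forall>i\<in>Basis. weak_deriv Q (i, 0) u (\<lambda>z. G z \<bullet> i))"

definition is_time_derivative ::
    "('a::euclidean_space \<times> real) set \<Rightarrow> ('a \<times> real \<Rightarrow> real) \<Rightarrow> ('a \<times> real \<Rightarrow> real) \<Rightarrow> bool" where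
  "is_time_derivative Q u D \<longleftrightarrow> weak_deriv Q (0, 1) u D"

end

theory Submission
  imports Defs
begin

text \<open>
  Write \<open>f = \<partial>\<^sub>i u\<close>, \<open>q = p\<^sup>*\<close> and \<open>\<alpha> = 1 + d/2 - d/p \<in> [0, 1)\<close>. The core is the estimate
  \<open>\<parallel>f(t + h) - f(t)\<parallel> \<lesssim> h\<^bsup>\<alpha>/2\<^esup>\<close> in \<open>L\<^sup>2(\<Omega> \<times> (0, T - h))\<close>. The increment is bounded in \<open>L\<^sup>2(L\<^sup>q)\<close> by hypothesis, so it
  suffices to bound it by \<open>h\<^bsup>1/2\<^esup>\<close> in \<open>L\<^sup>2(L\<^sup>p)\<close> and to interpolate. For this, compare \<open>f\<close> with its spatial
  averages at scale \<open>\<rho> = h\<^bsup>1/2\<^esup>\<close> over balls displaced into \<open>\<Omega>\<close> along the cones given by the Lipschitz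
  charts: the gradient of \<open>f\<close> controls \<open>f\<close> minus its average by \<open>\<rho>\<close>, and as \<open>\<partial>\<^sub>t f = \<partial>\<^sub>i \<partial>\<^sub>t u\<close> weakly, the
  average moves in time \<open>h\<close> by at most \<open>h \<rho>\<^sup>-\<^sup>1\<close> times \<open>\<partial>\<^sub>t u\<close>.

  Comparing a time interval of length \<open>\<delta>\<^sup>2\<close> with its translates inside one that is a fixed factor
  longer gives a recursion whose solution decays like \<open>\<delta>\<^bsup>2\<alpha>\<^esup>\<close> because \<open>\<alpha> < 1\<close>. It starts from the bound
  on \<open>\<Omega> \<times> (0, T)\<close>, which follows from \<open>q \<ge> 2\<close> since the Lipschitz character bounds the volume of \<open>\<Omega>\<close>.
\<close>

text \<open>The time derivative of \<open>f\<close> is only a distribution,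
  \<open>\<partial>\<^sub>i \<partial>\<^sub>t u\<close>, so it has to be tested against a compactly
  supported kernel, and moving \<open>\<partial>\<^sub>i\<close> onto a kernel of width \<rho> costs
  1/\<rho>; the errors \<rho> and h/\<rho> agree exactly when \<rho>^2 = h. The kernels must be
  supported inside \<Omega>, and displacing the balls along interior cones achieves this up to the
  boundary without extending any function. The exponent \<alpha> is the interpolation parameter in
  1/2 = \<alpha>/p + (1 - \<alpha>)/q: as 1/q = 1/p - 1/d, it equals 1 + d/2 - d/p; the lower bound
  on p says \<alpha> \<ge> 0, equivalently q \<ge> 2, and p < 2 says \<alpha> < 1. The increments
  therefore have fractional order \<alpha>/2 < 1/2 in time, too little for boundedness in time; what
  survives is a Morrey-type bound on short intervals, which the recursion extracts. Estimates are
  kept in nonnegative extended integrals, so that no integrability has to be known before the bound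
  that yields it.\<close>

subsection \<open>Smooth functions\<close>

lemma C_k_Suc_imp: "C_k (Suc k) f \<Longrightarrow> C_k k f"
proof (induction k arbitrary: f)
  case 0
  then show ?case
    by (auto simp: continuous_on_eq_continuous_at intro: differentiable_imp_continuous_within)
next
  case (Suc k)
  show ?case
    unfolding C_k.simps(2)[of k]
    using Suc.prems Suc.IH unfolding C_k.simps(2)[of "Suc k"] by blast
qed

lemma C_k_continuous: "C_k k f \<Longrightarrow> continuous_on UNIV f"
  by (induction k arbitrary: f) (use C_k_Suc_imp in auto)

lemma C_k_SucI:
  assumes "\<And>x. (f has_derivative f' x) (at x)" and "\<And>e. e \<in> Basis \<Longrightarrow> C_k k (\<lambda>x. f' x e)"
  shows "C_k (Suc k) f"
proof -
  have "frechet_derivative f (at x) = f' x" for x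
    using frechet_derivative_at[OF assms(1)] by simp
  then show ?thesis
    using assms by (auto simp: differentiable_def)
qed

lemma C_k_SucD:
  assumes "C_k (Suc k) f"
  shows "(f has_derivative frechet_derivative f (at x)) (at x)"
    and "e \<in> Basis \<Longrightarrow> C_k k (\<lambda>x. frechet_derivative f (at x) e)"
  using assms by (auto simp: frechet_derivative_works)

lemma C_k_const: "C_k k (\<lambda>x. c)"
proof (induction k arbitrary: c)
  case (Suc k)
  show ?case
    by (rule C_k_SucI[where f' = "\<lambda>_ _. 0"]) (use Suc in auto)
qed simp

lemma C_k_add: "C_k k f \<Longrightarrow> C_k k g \<Longrightarrow> C_k k (\<lambda>x. f x + g x)"
proof (induction k arbitrary: f g)
  case (Suc k)
  show ?case
    by (rule C_k_SucI[OF has_derivative_add[OF C_k_SucD(1) C_k_SucD(1)]])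
      (use Suc C_k_SucD(2) in blast)+
qed (auto intro: continuous_intros)

lemma C_k_mult: "C_k k f \<Longrightarrow> C_k k g \<Longrightarrow> C_k k (\<lambda>x. f x * g x)"
proof (induction k arbitrary: f g)
  case (Suc k)
  note sub = C_k_Suc_imp[OF Suc.prems(1)] C_k_Suc_imp[OF Suc.prems(2)]
  show ?case
  proof (rule C_k_SucI[OF has_derivative_mult[OF C_k_SucD(1) C_k_SucD(1)]])
    fix e :: 'a assume "e \<in> Basis"
    then show "C_k k (\<lambda>x. f x * frechet_derivative g (at x) e + frechet_derivative f (at x) e * g x)"
      using C_k_SucD(2) Suc.IH Suc.prems sub by (intro C_k_add) blast+
  qed (use Suc.prems in auto)
qed (auto intro: continuous_intros)

lemma C_k_sum: "finite A \<Longrightarrow> (\<And>a. a \<in> A \<Longrightarrow> C_k k (f a)) \<Longrightarrow> C_k k (\<lambda>x. \<Sum>a\<in>A. f a x)"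
  by (induction A rule: finite_induct) (auto simp: C_k_const intro!: C_k_add)

lemma C_k_prod: "finite A \<Longrightarrow> (\<And>a. a \<in> A \<Longrightarrow> C_k k (f a)) \<Longrightarrow> C_k k (\<lambda>x. \<Prod>a\<in>A. f a x)"
  by (induction A rule: finite_induct) (auto simp: C_k_const intro!: C_k_mult)

lemma linear_eq_sum_Basis:
  fixes f :: "'a::euclidean_space \<Rightarrow> 'b::real_vector"
  assumes "linear f" shows "f v = (\<Sum>i\<in>Basis. (v \<bullet> i) *\<^sub>R f i)"
  using linear_sum[OF assms, of "\<lambda>i. (v \<bullet> i) *\<^sub>R i" Basis] linear_scale[OF assms]
  by (simp add: euclidean_representation)

text \<open>\<open>C_k\<close> records derivatives in basis directions only, while the chain rule
  produces the direction \<open>A e\<close>; expanding it in the basis gives a linear combination to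
  which the induction hypothesis applies.\<close>

lemma C_k_affine:
  fixes A :: "'a::euclidean_space \<Rightarrow> 'b::euclidean_space"
  assumes A: "bounded_linear A"
  shows "C_k k f \<Longrightarrow> C_k k (\<lambda>x. f (A x + v))"
proof (induction k arbitrary: f)
  case 0
  have "continuous_on UNIV A"
    using A by (simp add: linear_continuous_on)
  then show ?case
    using 0 by (auto intro!: continuous_intros continuous_on_compose2[of UNIV f])
next
  case (Suc k)
  show ?case
  proof (rule C_k_SucI)
    fix x
    have "((\<lambda>x. A x + v) has_derivative A) (at x)"
      using bounded_linear_imp_has_derivative[OF A] by (auto intro!: derivative_eq_intros)
    from has_derivative_compose[OF this C_k_SucD(1)[OF Suc.prems]]
    show "((\<lambda>x. f (A x + v)) has_derivative (\<lambda>e. frechet_derivative f (at (A x + v)) (A e))) (at x)" .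
  next
    fix e :: 'a
    have "linear (frechet_derivative f (at y))" for y
      using C_k_SucD(1)[OF Suc.prems] has_derivative_linear by blast
    then have "frechet_derivative f (at y) (A e)
        = (\<Sum>j\<in>Basis. (A e \<bullet> j) * frechet_derivative f (at y) j)" for y
      using linear_eq_sum_Basis[of "frechet_derivative f (at y)" "A e"] by simp
    then show "C_k k (\<lambda>x. frechet_derivative f (at (A x + v)) (A e))"
      using Suc.IH[OF C_k_SucD(2)[OF Suc.prems]] by (auto intro!: C_k_sum C_k_mult C_k_const)
  qed
qed

text \<open>The chain rule yields again a composite, of the derivative of \<open>F\<close> with
  \<open>g\<close>, times a derivative of \<open>g\<close>; hence the induction varies
  \<open>F\<close> and uses \<open>g\<close> also at the lower order.\<close>

lemma C_k_compose:
  fixes F :: "real \<Rightarrow> real" and g :: "'a::euclidean_space \<Rightarrow> real"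
  shows "C_k k F \<Longrightarrow> C_k k g \<Longrightarrow> C_k k (\<lambda>x. F (g x))"
proof (induction k arbitrary: F g)
  case 0
  then show ?case
    by (auto intro!: continuous_on_compose2[of UNIV F])
next
  case (Suc k)
  let ?F' = "\<lambda>t. frechet_derivative F (at t) 1"
  show ?case
  proof (rule C_k_SucI)
    fix x
    have "linear (frechet_derivative F (at t))" for t
      using C_k_SucD(1)[OF Suc.prems(1)] has_derivative_linear by blast
    then have eq: "?F' t * s = frechet_derivative F (at t) s" for t s
      using linear_eq_sum_Basis[of "frechet_derivative F (at t)" s] by (simp only: Basis_real_def) simp
    show "((\<lambda>x. F (g x)) has_derivative (\<lambda>e. ?F' (g x) * frechet_derivative g (at x) e)) (at x)"
      unfolding eq
      by (rule has_derivative_compose[OF C_k_SucD(1)[OF Suc.prems(2)] C_k_SucD(1)[OF Suc.prems(1)]])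
  next
    fix e :: 'a assume "e \<in> Basis"
    then show "C_k k (\<lambda>x. ?F' (g x) * frechet_derivative g (at x) e)"
      using Suc.IH[OF C_k_SucD(2)[OF Suc.prems(1)] C_k_Suc_imp[OF Suc.prems(2)]]
        C_k_SucD(2)[OF Suc.prems(2)] by (auto intro!: C_k_mult)
  qed
qed

section \<open>Flat exponentials and smooth bumps on boxes\<close>

lemma C_k_exp: "C_k k (\<lambda>t::real. c * exp (r * t))"
proof (induction k arbitrary: c)
  case (Suc k)
  show ?case
  proof (rule C_k_SucI)
    show "((\<lambda>t::real. c * exp (r * t)) has_derivative (\<lambda>e. (c * r) * exp (r * t) * e)) (at t)" for t
      by (auto intro!: derivative_eq_intros)
    show "C_k k (\<lambda>t::real. (c * r) * exp (r * t) * e)" for e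
      using Suc.IH[of "c * r"] by (auto intro!: C_k_mult C_k_const)
  qed
qed (auto intro!: continuous_intros)

text \<open>This is t^(-n) exp(-1/t), extended by zero. For n = 0 it is the classical flat function;
  the other powers are kept because differentiation stays inside their linear span, which makes
  smoothness a single induction.\<close>

definition flat_exp :: "nat \<Rightarrow> real \<Rightarrow> real" where
  "flat_exp n t = (if t > 0 then (1 / t) ^ n * exp (- (1 / t)) else 0)"

text \<open>Only the limit from the right has content: in the variable r = 1/t it says that r^n /
  exp r tends to 0 at infinity.\<close>

lemma tendsto_flat_exp_0: "(flat_exp n \<longlongrightarrow> 0) (at 0)"
proof -
  have "((\<lambda>t::real. (1 / t) ^ n * exp (- (1 / t))) \<longlongrightarrow> 0) (at_right 0)"
    using filterlim_compose[OF tendsto_power_div_exp_0[of n] filterlim_inverse_at_top_right]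
    by (simp add: exp_minus field_simps)
  moreover have "\<forall>\<^sub>F t in at_right 0. (1 / t) ^ n * exp (- (1 / t)) = flat_exp n (t::real)"
    by (auto simp: eventually_at_right_field flat_exp_def intro!: exI[of _ 1])
  ultimately have R: "(flat_exp n \<longlongrightarrow> 0) (at_right 0)"
    using Lim_transform_eventually by blast
  have "\<forall>\<^sub>F t in at_left 0. 0 = flat_exp n (t::real)"
    by (auto simp: eventually_at_left_field flat_exp_def intro!: exI[of _ "-1"])
  then have L: "(flat_exp n \<longlongrightarrow> 0) (at_left 0)"
    using Lim_transform_eventually[OF tendsto_const] by blast
  from L R show ?thesis
    by (simp add: filterlim_at_split)
qed

lemma flat_exp_has_derivative:
  "(flat_exp n has_real_derivative (flat_exp (n + 2) t - n * flat_exp (n + 1) t)) (at t)"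
proof -
  consider "t > 0" | "t < 0" | "t = 0"
    by linarith
  then show ?thesis
  proof cases
    case 1
    have w: "((\<lambda>t::real. 1 / t) has_real_derivative - ((1 / t)\<^sup>2)) (at t)"
      using DERIV_inverse[of t UNIV] 1 by (simp add: inverse_eq_divide power2_eq_square)
    have v: "((\<lambda>w::real. w ^ n * exp (- w)) has_real_derivative
        (n * r ^ (n - 1) * exp (- r) - r ^ n * exp (- r))) (at r)" for r :: real
      by (auto intro!: derivative_eq_intros simp: algebra_simps)
    have e: "(n * r ^ (n - 1) * exp (- r) - r ^ n * exp (- r)) * - (r\<^sup>2)
        = r ^ (n + 2) * exp (- r) - n * (r ^ (n + 1) * exp (- r))" for r :: real
      by (cases n) (simp_all add: power2_eq_square algebra_simps)
    have "((\<lambda>t::real. (1 / t) ^ n * exp (- (1 / t))) has_real_derivative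
        (flat_exp (n + 2) t - n * flat_exp (n + 1) t)) (at t)"
      using DERIV_chain2[OF v w] 1 unfolding e by (simp add: flat_exp_def)
    moreover have "\<forall>\<^sub>F s in nhds t. flat_exp n s = (1 / s) ^ n * exp (- (1 / s))"
      using eventually_nhds_in_open[of "{0<..}" t] 1
      by (auto simp: flat_exp_def elim!: eventually_mono)
    ultimately show ?thesis
      by (subst DERIV_cong_ev[OF refl _ refl])
  next
    case 2
    have "\<forall>\<^sub>F s in nhds t. flat_exp n s = 0"
      using eventually_nhds_in_open[of "{..<0}" t] 2
      by (auto simp: flat_exp_def elim!: eventually_mono)
    then show ?thesis
      using DERIV_cong_ev[OF refl _ refl, of "flat_exp n" "\<lambda>_. 0" t 0] 2
      by (simp add: flat_exp_def)
  next
    case 3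
    \<comment> \<open>Dividing by h raises the power by one, also for h \<le> 0 where both sides
      vanish. The difference quotient at 0 is thus a member of the family, and its limit is
      known.\<close>
    have "flat_exp n h / h = flat_exp (n + 1) h" for h
      by (simp add: flat_exp_def)
    then have "((\<lambda>h. (flat_exp n (0 + h) - flat_exp n 0) / h) \<longlongrightarrow> 0) (at 0)"
      using tendsto_flat_exp_0[of "n + 1"] by (simp add: flat_exp_def[of _ 0])
    then show ?thesis
      using 3 by (simp add: DERIV_def flat_exp_def[of _ 0])
  qed
qed

lemma C_k_flat_exp: "C_k k (flat_exp n)"
proof (induction k arbitrary: n)
  case 0
  show ?case
    using DERIV_isCont[OF flat_exp_has_derivative] by (simp add: continuous_on_eq_continuous_at)
next
  case (Suc k)
  show ?case
  proof (rule C_k_SucI)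
    show "(flat_exp n has_derivative (\<lambda>e. (flat_exp (n + 2) t + (- n) * flat_exp (n + 1) t) * e)) (at t)" for t
      using flat_exp_has_derivative[of n t] unfolding has_field_derivative_def by simp
    show "C_k k (\<lambda>t. (flat_exp (n + 2) t + (- n) * flat_exp (n + 1) t) * e)" for e
      by (intro C_k_mult C_k_add C_k_const Suc.IH)
  qed
qed

text \<open>Each factor is flat at one face of the box, so the product is smooth on the whole space
  and needs no cutting off.\<close>

definition box_bump :: "'a::euclidean_space \<Rightarrow> 'a \<Rightarrow> 'a \<Rightarrow> real" where
  "box_bump a b x = (\<Prod>i\<in>Basis. flat_exp 0 (x \<bullet> i - a \<bullet> i) * flat_exp 0 (b \<bullet> i - x \<bullet> i))"

lemma C_k_box_bump: "C_k k (box_bump a b)"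
proof -
  have "C_k k (\<lambda>x::'a. flat_exp 0 (x \<bullet> i + - (a \<bullet> i)))" for i
    by (rule C_k_affine[OF bounded_linear_inner_left C_k_flat_exp])
  moreover have "C_k k (\<lambda>x::'a. flat_exp 0 (x \<bullet> (- i) + b \<bullet> i))" for i
    by (rule C_k_affine[OF bounded_linear_inner_left C_k_flat_exp])
  ultimately have "C_k k (\<lambda>x::'a. \<Prod>i\<in>Basis.
      flat_exp 0 (x \<bullet> i + - (a \<bullet> i)) * flat_exp 0 (x \<bullet> (- i) + b \<bullet> i))"
    by (intro C_k_prod C_k_mult) auto
  then show ?thesis
    by (simp add: box_bump_def[abs_def] algebra_simps)
qed

lemma box_bump_nonneg: "box_bump a b x \<ge> 0"
  by (auto simp: box_bump_def flat_exp_def intro!: prod_nonneg)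

lemma box_bump_pos_iff: "box_bump a b x > 0 \<longleftrightarrow> x \<in> box a b"
proof
  assume "x \<in> box a b"
  then show "box_bump a b x > 0"
    by (auto simp: box_bump_def flat_exp_def mem_box intro!: prod_pos)
next
  assume "box_bump a b x > 0"
  then have nz: "flat_exp 0 (x \<bullet> i - a \<bullet> i) * flat_exp 0 (b \<bullet> i - x \<bullet> i) \<noteq> 0" if "i \<in> Basis" for i
    using that prod_zero_iff[OF finite_Basis] unfolding box_bump_def
    by (metis (no_types, lifting) less_irrefl)
  show "x \<in> box a b"
    unfolding mem_box
  proof
    fix i :: 'a assume "i \<in> Basis"
    from nz[OF this] show "a \<bullet> i < x \<bullet> i \<and> x \<bullet> i < b \<bullet> i"
      by (auto simp: flat_exp_def split: if_splits)
  qed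
qed

lemma test_function_smooth: "\<phi> \<in> test_functions U \<Longrightarrow> C_k k \<phi>"
  by (simp add: test_functions_def)

text \<open>For c \<ge> 0 the outer exponential turns the bump into a family with values in [0, 1)
  that increases to the indicator of the open box as c tends to infinity. Its compact support is the
  closed box, hence the hypothesis on \<open>cbox\<close>.\<close>

lemma test_function_box:
  assumes "cbox a b \<subseteq> U"
  shows "(\<lambda>x. 1 - exp (- (c * box_bump a b x))) \<in> test_functions U"
proof -
  have "C_k k (\<lambda>x. 1 + (-1) * exp (- c * box_bump a b x))" for k
    by (intro C_k_add C_k_const C_k_compose[OF C_k_exp C_k_box_bump])
  moreover have "box_bump a b x = 0" if "x \<notin> cbox a b" for x
    using that box_bump_pos_iff[of a b x] box_bump_nonneg[of a b x] box_subset_cbox[of a b] by force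
  ultimately show ?thesis
    using assms by (auto simp: test_functions_def intro!: exI[of _ "cbox a b"])
qed

subsection \<open>The fundamental lemma of the calculus of variations\<close>

lemma box_Int_box:
  fixes a b c d :: "'a::euclidean_space"
  shows "box a b \<inter> box c d = box (\<Sum>i\<in>Basis. max (a \<bullet> i) (c \<bullet> i) *\<^sub>R i) (\<Sum>i\<in>Basis. min (b \<bullet> i) (d \<bullet> i) *\<^sub>R i)"
  by (rule set_eqI) (auto simp: mem_box)

text \<open>Open boxes form an intersection-stable generator of the Borel sets, so vanishing
  integrals pass from boxes to all Borel sets by Dynkin's argument.\<close>

lemma AE_eq_0_if_box_integrals_eq_0:
  fixes f :: "'a::euclidean_space \<Rightarrow> 'b::euclidean_space"
  assumes f: "integrable lborel f" and box0: "\<And>a b. (LINT x:box a b|lborel. f x) = 0"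
  shows "AE x in lborel. f x = 0"
proof -
  have int: "set_integrable lborel A f" if "A \<in> sets borel" for A
    using f that integrable_mult_indicator[of A lborel f] by (simp add: set_integrable_def)
  \<comment> \<open>Closure under complements needs the integral over the whole space to vanish;
    this is obtained by exhausting the space with boxes.\<close>
  have "(\<lambda>n::nat. LINT x|lborel. indicator (box (- real n *\<^sub>R One) (real n *\<^sub>R One)) x *\<^sub>R f x)
      \<longlonglongrightarrow> (LINT x|lborel. f x)"
  proof (rule integral_dominated_convergence[where w = "\<lambda>x. norm (f x)"])
    have "\<exists>n0. \<forall>n\<ge>n0. x \<in> box (- real n *\<^sub>R One) (real n *\<^sub>R One)" for x :: 'a
    proof -
      obtain k :: nat where k: "norm x < k"
        using reals_Archimedean2 by blast
      have "x \<in> box (- real n *\<^sub>R One) (real n *\<^sub>R One)" if "n \<ge> k" for n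
      proof -
        have "\<bar>x \<bullet> i\<bar> < n" if "i \<in> Basis" for i
          using Basis_le_norm[OF that, of x] k \<open>n \<ge> k\<close> by linarith
        then show ?thesis
          by (fastforce simp: mem_box abs_less_iff)
      qed
      then show ?thesis
        by blast
    qed
    then have "\<forall>\<^sub>F n in sequentially.
        indicator (box (- real n *\<^sub>R One) (real n *\<^sub>R One)) x *\<^sub>R f x = f x" for x
      unfolding eventually_sequentially by (metis indicator_simps(1) scaleR_one)
    then show "AE x in lborel. (\<lambda>n. indicator (box (- real n *\<^sub>R One) (real n *\<^sub>R One)) x *\<^sub>R f x) \<longlonglongrightarrow> f x"
      by (intro AE_I2) (rule tendsto_eventually)
  qed (use f in \<open>auto simp: indicator_def\<close>)
  then have total: "(LINT x|lborel. f x) = 0"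
    using box0 LIMSEQ_unique[OF _ tendsto_const] by (simp add: set_lebesgue_integral_def)
  let ?E = "range (\<lambda>(a, b). box a b :: 'a set)"
  have stable: "Int_stable ?E"
  proof (rule Int_stableI)
    fix A B :: "'a set" assume "A \<in> ?E" "B \<in> ?E"
    then obtain a b c d where "A = box a b" "B = box c d"
      by auto
    then have "A \<inter> B = box (\<Sum>i\<in>Basis. max (a \<bullet> i) (c \<bullet> i) *\<^sub>R i) (\<Sum>i\<in>Basis. min (b \<bullet> i) (d \<bullet> i) *\<^sub>R i)"
      by (simp only: box_Int_box)
    then show "A \<inter> B \<in> ?E"
      by auto
  qed
  have "(LINT x:A|lborel. f x) = 0" if "A \<in> sets borel" for A
  proof -
    have "A \<in> sigma_sets UNIV ?E"
      using that by (simp add: borel_eq_box)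
    then show ?thesis
    proof (induction rule: sigma_sets_induct_disjoint[OF stable, of UNIV, simplified, consumes 1, case_names basic empty compl union])
      case (basic A)
      then show ?case
        using box0 by auto
    next
      case empty
      then show ?case
        by (simp add: set_lebesgue_integral_def)
    next
      case (compl A)
      then have A: "A \<in> sets borel"
        by (simp add: borel_eq_box)
      have "(LINT x|lborel. f x) = (LINT x:A \<union> (UNIV - A)|lborel. f x)"
        by (simp add: set_lebesgue_integral_def)
      also have "\<dots> = (LINT x:A|lborel. f x) + (LINT x:UNIV - A|lborel. f x)"
        by (rule set_integral_Un) (use int A in auto)
      finally show ?case
        using total compl by simp
    next
      case (union A)
      then have A: "\<And>i. A i \<in> sets borel"
        by (auto simp: borel_eq_box)
      have "(LINT x:(\<Union>i. A i)|lborel. f x) = (\<Sum>i. (LINT x:A i|lborel. f x))"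
        by (rule lebesgue_integral_countable_add)
          (use A union int in \<open>auto simp: disjoint_family_on_def\<close>)
      then show ?case
        using union by simp
    qed
  qed
  then show ?thesis
    using sigma_finite_measure.density_zero[OF sigma_finite_lborel f] by simp
qed

lemma locally_integrable_cbox:
  assumes "locally_integrable U w" "cbox a b \<subseteq> U"
  shows "set_integrable lborel (cbox a b) w" and "set_integrable lborel (box a b) w"
proof -
  show *: "set_integrable lborel (cbox a b) w"
    using assms compact_cbox unfolding locally_integrable_def by simp
  show "set_integrable lborel (box a b) w"
    by (rule set_integrable_subset[OF * _ box_subset_cbox]) simp
qed

text \<open>The test functions \<open>1 - exp (- (n * box_bump a b x))\<close> tend to the indicator
  of the open box and are bounded by 1, so dominated convergence carries the hypothesis over to the
  indicator.\<close>

lemma box_integral_eq_0_if_test_integrals_eq_0: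
  fixes w :: "'a::euclidean_space \<Rightarrow> 'b::euclidean_space"
  assumes w: "locally_integrable U w" and ab: "cbox a b \<subseteq> U"
    and test0: "\<And>\<phi>. \<phi> \<in> test_functions U \<Longrightarrow> (LINT x:U|lborel. \<phi> x *\<^sub>R w x) = 0"
  shows "(LINT x:box a b|lborel. w x) = 0"
proof -
  let ?g = "box_bump a b"
  have cont: "continuous_on UNIV ?g"
    using C_k_continuous[OF C_k_box_bump] .
  have g0: "?g x = 0" if "x \<notin> box a b" for x
    using that box_bump_pos_iff[of a b x] box_bump_nonneg[of a b x] by simp
  let ?\<phi> = "\<lambda>n::nat. \<lambda>x. 1 - exp (- (real n * ?g x))"
  have wm: "integrable lborel (\<lambda>x. indicator (box a b) x *\<^sub>R w x)"
    using locally_integrable_cbox(2)[OF w ab] by (simp add: set_integrable_def)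
  have eq: "indicator U x *\<^sub>R (?\<phi> n x *\<^sub>R w x) = ?\<phi> n x *\<^sub>R (indicator (box a b) x *\<^sub>R w x)" for n x
    using g0 ab box_subset_cbox[of a b] by (auto simp: indicator_def)
  have "(\<lambda>n. LINT x|lborel. ?\<phi> n x *\<^sub>R (indicator (box a b) x *\<^sub>R w x))
      \<longlonglongrightarrow> (LINT x|lborel. indicator (box a b) x *\<^sub>R w x)"
  proof (rule integral_dominated_convergence[where w = "\<lambda>x. norm (indicator (box a b) x *\<^sub>R w x)"])
    show "AE x in lborel. (\<lambda>n. ?\<phi> n x *\<^sub>R (indicator (box a b) x *\<^sub>R w x))
        \<longlonglongrightarrow> indicator (box a b) x *\<^sub>R w x"
    proof (rule AE_I2)
      fix x
      show "(\<lambda>n. ?\<phi> n x *\<^sub>R (indicator (box a b) x *\<^sub>R w x)) \<longlonglongrightarrow> indicator (box a b) x *\<^sub>R w x"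
      proof (cases "x \<in> box a b")
        case True
        then have "?g x > 0"
          using box_bump_pos_iff by blast
        then have "(\<lambda>n::nat. exp (- (real n * ?g x))) \<longlonglongrightarrow> 0"
          by (intro filterlim_compose[OF exp_at_bot] filterlim_uminus_at_top[THEN iffD1] filterlim_at_top_mult_tendsto_pos[OF tendsto_const] filterlim_real_sequentially)
        then have "(\<lambda>n. ?\<phi> n x *\<^sub>R w x) \<longlonglongrightarrow> (1 - 0) *\<^sub>R w x"
          by (intro tendsto_intros)
        then show ?thesis
          using True by simp
      qed simp
    qed
    show "AE x in lborel. norm (?\<phi> n x *\<^sub>R (indicator (box a b) x *\<^sub>R w x))
        \<le> norm (indicator (box a b) x *\<^sub>R w x)" for n
      using box_bump_nonneg[of a b] unfolding norm_scaleR
      by (intro AE_I2 mult_left_le_one_le) (auto simp: abs_le_iff intro!: add_increasing2)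
    show "(\<lambda>x. ?\<phi> n x *\<^sub>R (indicator (box a b) x *\<^sub>R w x)) \<in> borel_measurable lborel" for n
    proof -
      have [measurable]: "?\<phi> n \<in> borel_measurable borel"
        using cont by (intro borel_measurable_continuous_onI continuous_intros)
      show ?thesis
        by (rule borel_measurable_scaleR[OF _ borel_measurable_integrable[OF wm]]) measurable
    qed
  qed (use wm in \<open>simp_all del: norm_scaleR scaleR_scaleR\<close>)
  moreover have "(LINT x|lborel. ?\<phi> n x *\<^sub>R (indicator (box a b) x *\<^sub>R w x)) = 0" for n
    using test0[OF test_function_box[OF ab, of n]] unfolding set_lebesgue_integral_def eq .
  ultimately show ?thesis
    using LIMSEQ_unique[OF _ tendsto_const] by (simp add: set_lebesgue_integral_def)
qed

lemma AE_lborel_not_mem_frontier_box: "AE x in lborel. x \<in> cbox a b \<longrightarrow> x \<in> box a (b::'a::euclidean_space)"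
proof -
  have "cbox a b - box a b \<in> null_sets lborel"
    using negligible_frontier_interval[of a b] by (simp add: negligible_iff_null_sets null_sets_completion_iff)
  then have "AE x in lborel. x \<notin> cbox a b - box a b"
    by (rule AE_not_in)
  then show ?thesis
    by auto
qed

text \<open>\<open>U\<close> is a countable union of closed boxes. On each of them \<open>w\<close>
  is integrable, and its integral over any open subbox vanishes, because the intersection of two
  boxes is a box whose closed version still lies in \<open>U\<close>. The faces left out by the open
  boxes are null sets.\<close>

lemma fundamental_lemma:
  fixes w :: "'a::euclidean_space \<Rightarrow> 'b::euclidean_space"
  assumes "open U" and w: "locally_integrable U w"
    and test0: "\<And>\<phi>. \<phi> \<in> test_functions U \<Longrightarrow> (LINT x:U|lborel. \<phi> x *\<^sub>R w x) = 0"
  shows "AE x in lborel. x \<in> U \<longrightarrow> w x = 0"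
proof -
  obtain \<D> where \<D>: "countable \<D>" "\<D> \<subseteq> Pow U" "\<And>X. X \<in> \<D> \<Longrightarrow> \<exists>a b. X = cbox a b" "\<Union>\<D> = U"
    using open_countable_Union_open_cbox[OF \<open>open U\<close>] by metis
  have "AE x in lborel. x \<in> X \<longrightarrow> w x = 0" if X: "X \<in> \<D>" for X
  proof -
    obtain a b where ab: "X = cbox a b"
      using \<D>(3)[OF X] by blast
    then have sub: "cbox a b \<subseteq> U"
      using \<D>(2) X by blast
    have "AE x in lborel. indicator (box a b) x *\<^sub>R w x = 0"
    proof (rule AE_eq_0_if_box_integrals_eq_0)
      show "integrable lborel (\<lambda>x. indicator (box a b) x *\<^sub>R w x)"
        using locally_integrable_cbox(2)[OF w sub] by (simp add: set_integrable_def)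
      fix c d
      let ?e = "\<Sum>i\<in>Basis. max (a \<bullet> i) (c \<bullet> i) *\<^sub>R i" and ?f = "\<Sum>i\<in>Basis. min (b \<bullet> i) (d \<bullet> i) *\<^sub>R i"
      have "cbox ?e ?f = cbox a b \<inter> cbox c d" "box ?e ?f = box a b \<inter> box c d"
        by (auto simp only: box_Int_box Int_interval)
      then have ef: "cbox ?e ?f \<subseteq> U" "\<And>x. indicat_real (box ?e ?f) x = indicator (box c d) x * indicator (box a b) x"
        using sub by (auto simp: indicator_def)
      show "(LINT x:box c d|lborel. indicator (box a b) x *\<^sub>R w x) = 0"
        using box_integral_eq_0_if_test_integrals_eq_0[OF w ef(1) test0]
        by (simp add: set_lebesgue_integral_def ef(2))
    qed
    with AE_lborel_not_mem_frontier_box[of a b] show ?thesis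
      unfolding ab by eventually_elim (auto simp: indicator_def)
  qed
  then have "AE x in lborel. \<forall>X\<in>\<D>. x \<in> X \<longrightarrow> w x = 0"
    unfolding AE_ball_countable[OF \<D>(1)] by blast
  then show ?thesis
    using \<D>(4) by (auto elim!: eventually_mono)
qed

section \<open>Pairing with test functions and uniqueness of weak derivatives\<close>

lemma continuous_compact_support_bounded:
  fixes f :: "'a::euclidean_space \<Rightarrow> real"
  assumes "continuous_on UNIV f" "compact K" "\<And>x. x \<notin> K \<Longrightarrow> f x = 0"
  shows "\<exists>B. \<forall>x. \<bar>f x\<bar> \<le> B"
proof -
  have "bounded (f ` K)"
    using assms(1,2) by (meson compact_continuous_image compact_imp_bounded continuous_on_subset subset_UNIV)
  then obtain B where "\<And>x. x \<in> K \<Longrightarrow> \<bar>f x\<bar> \<le> B"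
    by (auto simp: bounded_iff)
  then have "\<bar>f x\<bar> \<le> max B 0" for x
    using assms(3)[of x] by (cases "x \<in> K") (auto simp: le_max_iff_disj)
  then show ?thesis
    by blast
qed

text \<open>The factor \<phi> is bounded and vanishes off \<open>K\<close>, so only the integrable
  restriction of \<open>w\<close> to \<open>K\<close> matters, and \<open>U\<close> can be replaced
  by the whole space. This frees the later computations with translated test functions from their
  domains.\<close>

lemma set_integral_bounded_on_compact:
  fixes w :: "'a::euclidean_space \<Rightarrow> 'b::euclidean_space" and \<phi> :: "'a \<Rightarrow> real"
  assumes w: "locally_integrable U w" and K: "compact K" "K \<subseteq> U" and \<phi>: "continuous_on UNIV \<phi>"
    and zero: "\<And>x. x \<notin> K \<Longrightarrow> \<phi> x = 0"
  shows "set_integrable lborel U (\<lambda>x. \<phi> x *\<^sub>R w x)" and "integrable lborel (\<lambda>x. \<phi> x *\<^sub>R w x)"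
    and "(LINT x:U|lborel. \<phi> x *\<^sub>R w x) = (LINT x|lborel. \<phi> x *\<^sub>R w x)"
proof -
  have eq: "indicator U x *\<^sub>R (\<phi> x *\<^sub>R w x) = \<phi> x *\<^sub>R w x"
    "\<phi> x *\<^sub>R w x = \<phi> x *\<^sub>R (indicator K x *\<^sub>R w x)" for x
    using zero K by (auto simp: indicator_def)
  have wK: "integrable lborel (\<lambda>x. indicator K x *\<^sub>R w x)"
    using w K unfolding locally_integrable_def set_integrable_def by blast
  obtain B where B: "\<And>x. \<bar>\<phi> x\<bar> \<le> B"
    using continuous_compact_support_bounded[OF \<phi> K(1) zero] by auto
  have [measurable]: "\<phi> \<in> borel_measurable borel"
    using \<phi> by (rule borel_measurable_continuous_onI)
  have "integrable lborel (\<lambda>x. \<phi> x *\<^sub>R (indicator K x *\<^sub>R w x))"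
  proof (rule Bochner_Integration.integrable_bound)
    show "integrable lborel (\<lambda>x. B *\<^sub>R (indicator K x *\<^sub>R w x))"
      using wK by (rule integrable_scaleR_right)
    have "norm (\<phi> x *\<^sub>R (indicator K x *\<^sub>R w x)) \<le> norm (B *\<^sub>R (indicator K x *\<^sub>R w x))" for x
      using B[of x] by (cases "x \<in> K") (auto intro!: mult_right_mono)
    then show "AE x in lborel. norm (\<phi> x *\<^sub>R (indicator K x *\<^sub>R w x)) \<le> norm (B *\<^sub>R (indicator K x *\<^sub>R w x))"
      by simp
    show "(\<lambda>x. \<phi> x *\<^sub>R (indicator K x *\<^sub>R w x)) \<in> borel_measurable lborel"
      by (rule borel_measurable_scaleR[OF _ borel_measurable_integrable[OF wK]]) measurable
  qed
  then show i: "integrable lborel (\<lambda>x. \<phi> x *\<^sub>R w x)"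
    unfolding eq(2)[symmetric] .
  show "set_integrable lborel U (\<lambda>x. \<phi> x *\<^sub>R w x)"
    using i unfolding set_integrable_def eq(1) .
  show "(LINT x:U|lborel. \<phi> x *\<^sub>R w x) = (LINT x|lborel. \<phi> x *\<^sub>R w x)"
    unfolding set_lebesgue_integral_def eq(1) ..
qed

text \<open>The derivative vanishes off \<open>K\<close> because \<phi> is zero on the open
  complement of \<open>K\<close>; it is continuous in every direction, not just along basis vectors,
  by linearity.\<close>

lemma test_functionE:
  assumes "\<phi> \<in> test_functions U"
  obtains K where "compact K" "K \<subseteq> U" "\<And>x. x \<notin> K \<Longrightarrow> \<phi> x = 0" "continuous_on UNIV \<phi>"
    "\<And>x. (\<phi> has_derivative frechet_derivative \<phi> (at x)) (at x)"
    "\<And>x e. x \<notin> K \<Longrightarrow> frechet_derivative \<phi> (at x) e = 0"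
    "\<And>e. continuous_on UNIV (\<lambda>x. frechet_derivative \<phi> (at x) e)"
proof -
  obtain K where K: "compact K" "K \<subseteq> U" "\<And>x. x \<notin> K \<Longrightarrow> \<phi> x = 0"
    using assms by (auto simp: test_functions_def)
  have der: "(\<phi> has_derivative frechet_derivative \<phi> (at x)) (at x)" for x
    using C_k_SucD(1)[OF test_function_smooth[OF assms]] .
  have "frechet_derivative \<phi> (at x) = (\<lambda>_. 0)" if "x \<notin> K" for x
  proof -
    have "((\<lambda>_. 0) has_derivative (\<lambda>_. 0)) (at x)"
      by simp
    then have "(\<phi> has_derivative (\<lambda>_. 0)) (at x)"
      by (rule has_derivative_transform_within_open[of _ _ _ _ "- K"])
        (use K that compact_imp_closed in \<open>auto simp: open_Compl\<close>)
    then show ?thesis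
      using has_derivative_unique[OF der] by blast
  qed
  moreover have "continuous_on UNIV (\<lambda>x. frechet_derivative \<phi> (at x) e)" for e
  proof -
    have "frechet_derivative \<phi> (at x) e = (\<Sum>i\<in>Basis. (e \<bullet> i) * frechet_derivative \<phi> (at x) i)" for x
      using linear_eq_sum_Basis[OF has_derivative_linear[OF der], of x e] by simp
    moreover have "continuous_on UNIV (\<lambda>x. frechet_derivative \<phi> (at x) i)" if "i \<in> Basis" for i
      using C_k_continuous[OF C_k_SucD(2)[OF test_function_smooth[OF assms] that]] .
    ultimately show ?thesis
      by (simp add: continuous_intros)
  qed
  ultimately show ?thesis
    using that[OF K C_k_continuous[OF test_function_smooth[OF assms]] der] by simp
qed

lemma locally_integrable_diff:
  assumes "locally_integrable U f" "locally_integrable U g"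
  shows "locally_integrable U (\<lambda>x. f x - g x)"
  using assms by (auto simp: locally_integrable_def set_borel_measurable_def scaleR_diff_right
      intro!: set_integral_diff(1))

lemma weak_deriv_unique:
  assumes "open U" and g1: "weak_deriv U e f g1" and g2: "weak_deriv U e f g2"
  shows "AE x in lborel. x \<in> U \<longrightarrow> g1 x = g2 x"
proof -
  have li: "locally_integrable U g1" "locally_integrable U g2"
    using g1 g2 by (auto simp: weak_deriv_def)
  have "AE x in lborel. x \<in> U \<longrightarrow> g1 x - g2 x = 0"
  proof (rule fundamental_lemma[OF \<open>open U\<close> locally_integrable_diff[OF li]])
    fix \<phi> assume \<phi>: "\<phi> \<in> test_functions U"
    obtain K where K: "compact K" "K \<subseteq> U" "\<And>x. x \<notin> K \<Longrightarrow> \<phi> x = 0" "continuous_on UNIV \<phi>"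
      using test_functionE[OF \<phi>] by metis
    have "(LINT x:U|lborel. \<phi> x *\<^sub>R (g1 x - g2 x))
        = (LINT x:U|lborel. \<phi> x *\<^sub>R g1 x) - (LINT x:U|lborel. \<phi> x *\<^sub>R g2 x)"
      using set_integral_diff(2)[OF set_integral_bounded_on_compact(1)[OF li(1) K(1,2,4,3)]
          set_integral_bounded_on_compact(1)[OF li(2) K(1,2,4,3)]]
      by (simp add: scaleR_diff_right)
    also have "\<dots> = 0"
      using g1 g2 \<phi> unfolding weak_deriv_def by (metis (no_types, lifting) diff_self minus_equation_iff)
    finally show "(LINT x:U|lborel. \<phi> x *\<^sub>R (g1 x - g2 x)) = 0" .
  qed
  then show ?thesis
    by simp
qed

subsection \<open>Difference quotients\<close>

lemma nn_integral_lborel_shift: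
  fixes F :: "'a::euclidean_space \<Rightarrow> ennreal"
  assumes "F \<in> borel_measurable borel"
  shows "(\<integral>\<^sup>+x. F (x + v) \<partial>lborel) = (\<integral>\<^sup>+x. F x \<partial>lborel)"
proof -
  have "(\<integral>\<^sup>+x. F x \<partial>lborel) = (\<integral>\<^sup>+x. F x \<partial>distr lborel borel ((+) v))"
    by (simp add: lborel_distr_plus)
  also have "\<dots> = (\<integral>\<^sup>+x. F (v + x) \<partial>lborel)"
    using assms by (subst nn_integral_distr) auto
  finally show ?thesis
    by (simp add: add.commute)
qed

lemma integral_lborel_shift:
  fixes F :: "'a::euclidean_space \<Rightarrow> 'b::euclidean_space"
  assumes "F \<in> borel_measurable borel"
  shows "(LINT x|lborel. F (x + v)) = (LINT x|lborel. F x)"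
proof -
  have "(LINT x|lborel. F x) = (LINT x|distr lborel borel ((+) v). F x)"
    by (simp add: lborel_distr_plus)
  also have "\<dots> = (LINT x|lborel. F (v + x))"
    using assms by (subst integral_distr) auto
  finally show ?thesis
    by (simp add: add.commute)
qed

lemma AE_lborel_shift:
  assumes "AE x in lborel. P (x :: 'a::euclidean_space)"
  shows "AE x in lborel. P (x + v)"
proof -
  have "AE x in distr lborel borel ((+) v). P x"
    using assms by (simp only: lborel_distr_plus)
  then have "AE x in lborel. P (v + x)"
    by (rule AE_distrD[rotated]) simp
  then show ?thesis
    by (simp add: add.commute)
qed

lemma integrable_lborel_shift:
  fixes F :: "'a::euclidean_space \<Rightarrow> 'b::euclidean_space"
  assumes "integrable lborel F"
  shows "integrable lborel (\<lambda>x. F (x + v))"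
proof -
  have "integrable (distr lborel borel ((+) v)) F"
    using assms by (simp add: lborel_distr_plus)
  then have "integrable lborel (\<lambda>x. F (v + x))"
    by (rule integrable_distr[rotated]) simp
  then show ?thesis
    by (simp add: add.commute)
qed

lemma test_function_shift:
  assumes \<phi>: "\<phi> \<in> test_functions U" and "\<And>x. x \<in> U \<Longrightarrow> x + v \<in> W"
  shows "(\<lambda>z. \<phi> (z - v)) \<in> test_functions W"
    and "frechet_derivative (\<lambda>z. \<phi> (z - v)) (at z) = frechet_derivative \<phi> (at (z - v))"
proof -
  have smooth: "C_k k (\<lambda>z. \<phi> (z - v))" for k
    using C_k_affine[OF bounded_linear_ident test_function_smooth[OF \<phi>], of k "- v"] by simp
  obtain K where K: "compact K" "K \<subseteq> U" "\<And>x. x \<notin> K \<Longrightarrow> \<phi> x = 0"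
    using test_functionE[OF \<phi>] by metis
  have "compact ((\<lambda>x. x + v) ` K)"
    using K(1) by (intro compact_continuous_image continuous_intros)
  moreover have "(\<lambda>x. x + v) ` K \<subseteq> W"
    using K(2) assms(2) by auto
  moreover have "\<phi> (z - v) = 0" if "z \<notin> (\<lambda>x. x + v) ` K" for z
    using that K(3)[of "z - v"] by (metis diff_add_cancel image_eqI)
  ultimately show "(\<lambda>z. \<phi> (z - v)) \<in> test_functions W"
    using smooth unfolding test_functions_def by blast
  have "((\<lambda>z. z - v) has_derivative (\<lambda>e. e)) (at z)"
    by (auto intro!: derivative_eq_intros)
  from has_derivative_compose[OF this C_k_SucD(1)[OF test_function_smooth[OF \<phi>]]]
  show "frechet_derivative (\<lambda>z. \<phi> (z - v)) (at z) = frechet_derivative \<phi> (at (z - v))"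
    using frechet_derivative_at by metis
qed

lemma weak_deriv_test:
  fixes f g :: "'a::euclidean_space \<Rightarrow> real"
  assumes wd: "weak_deriv W e f g" and \<phi>: "\<phi> \<in> test_functions W"
  shows "(LINT x|lborel. frechet_derivative \<phi> (at x) e * f x) = - (LINT x|lborel. \<phi> x * g x)"
proof -
  obtain K where K: "compact K" "K \<subseteq> W" "\<And>x. x \<notin> K \<Longrightarrow> \<phi> x = 0" "continuous_on UNIV \<phi>"
    "\<And>x e. x \<notin> K \<Longrightarrow> frechet_derivative \<phi> (at x) e = 0"
    "\<And>e. continuous_on UNIV (\<lambda>x. frechet_derivative \<phi> (at x) e)"
    using test_functionE[OF \<phi>] by metis
  have li: "locally_integrable W f" "locally_integrable W g"
    and eq: "(LINT x:W|lborel. frechet_derivative \<phi> (at x) e *\<^sub>R f x) = - (LINT x:W|lborel. \<phi> x *\<^sub>R g x)"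
    using wd \<phi> by (auto simp: weak_deriv_def)
  show ?thesis
    using eq set_integral_bounded_on_compact(3)[OF li(1) K(1,2) K(6) K(5)]
      set_integral_bounded_on_compact(3)[OF li(2) K(1,2) K(4) K(3)] by simp
qed

text \<open>Supplies Fubini's theorem on both sides of the substitution
  \<open>z = x + s *\<^sub>R h\<close>. The points that occur form the compact set \<open>?K\<close>
  swept out by \<open>K\<close> along the segments; it lies in \<open>W\<close>, so only the
  integral of |q| over \<open>?K\<close> enters.\<close>

lemma integrable_segment_kernel:
  fixes q \<phi> :: "'a::euclidean_space \<Rightarrow> real"
  assumes q: "locally_integrable W q" and [measurable]: "q \<in> borel_measurable borel" "\<phi> \<in> borel_measurable borel"
    and \<phi>: "\<And>x. \<bar>\<phi> x\<bar> \<le> B" "\<And>x. x \<notin> K \<Longrightarrow> \<phi> x = 0"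
    and K: "compact K" and seg: "\<And>x s. x \<in> K \<Longrightarrow> s \<in> {0..1} \<Longrightarrow> x + s *\<^sub>R h \<in> W"
  shows "integrable (lborel \<Otimes>\<^sub>M lborel) (\<lambda>(s::real, z). indicator {0..1} s * (\<phi> (z - s *\<^sub>R h) * q z))"
    and "integrable (lborel \<Otimes>\<^sub>M lborel) (\<lambda>(s::real, x). indicator {0..1} s * (\<phi> x * q (x + s *\<^sub>R h)))"
proof -
  let ?K = "(\<lambda>(x, s). x + s *\<^sub>R h) ` (K \<times> {0..1::real})"
  have "compact ?K"
    using K by (intro compact_continuous_image) (auto simp: split_def intro!: continuous_intros compact_Times)
  then have "set_integrable lborel ?K q" and [measurable]: "?K \<in> sets borel"
    using q seg unfolding locally_integrable_def by (auto simp: borel_compact)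
  then have "integrable lborel (\<lambda>z. indicator ?K z *\<^sub>R q z)"
    by (simp add: set_integrable_def)
  then have fin: "(\<integral>\<^sup>+z. ennreal (norm (indicator ?K z *\<^sub>R q z)) \<partial>lborel) < \<infinity>"
    by (simp add: integrable_iff_bounded)
  have B: "B \<ge> 0"
    using \<phi>(1) by (meson abs_ge_zero order_trans)
  define C where "C = ennreal B * (\<integral>\<^sup>+z. ennreal (norm (indicator ?K z *\<^sub>R q z)) \<partial>lborel)"
  have C: "C < \<infinity>"
    using fin by (simp add: C_def ennreal_mult_less_top)
  have inner: "(\<integral>\<^sup>+z. ennreal (norm (indicator {0..1} s * (\<phi> (z - s *\<^sub>R h) * q z))) \<partial>lborel) \<le> C * indicator {0..1} s"
    for s :: real
  proof -
    have "(\<integral>\<^sup>+z. ennreal (norm (indicator {0..1} s * (\<phi> (z - s *\<^sub>R h) * q z))) \<partial>lborel)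
        \<le> (\<integral>\<^sup>+z. (ennreal B * indicator {0..1} s) * ennreal (norm (indicator ?K z *\<^sub>R q z)) \<partial>lborel)"
    proof (rule nn_integral_mono)
      fix z
      have "\<bar>\<phi> (z - s *\<^sub>R h)\<bar> * \<bar>q z\<bar> \<le> B * \<bar>q z\<bar>"
        by (rule mult_right_mono[OF \<phi>(1)]) simp
      moreover have "z \<in> ?K" if "\<phi> (z - s *\<^sub>R h) \<noteq> 0" "s \<in> {0..1}"
        using that \<phi>(2)[of "z - s *\<^sub>R h"] by (auto intro!: image_eqI[of _ _ "(z - s *\<^sub>R h, s)"])
      ultimately show "ennreal (norm (indicator {0..1} s * (\<phi> (z - s *\<^sub>R h) * q z)))
          \<le> (ennreal B * indicator {0..1} s) * ennreal (norm (indicator ?K z *\<^sub>R q z))"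
        using B by (cases "s \<in> {0..1}"; cases "z \<in> ?K")
          (auto simp: abs_mult ennreal_mult[symmetric] intro!: ennreal_leI)
    qed
    also have "\<dots> = (ennreal B * indicator {0..1} s) * (\<integral>\<^sup>+z. ennreal (norm (indicator ?K z *\<^sub>R q z)) \<partial>lborel)"
      by (rule nn_integral_cmult) measurable
    finally show ?thesis
      by (simp add: C_def mult_ac)
  qed
  have total: "(\<integral>\<^sup>+s. C * indicator {0..1} (s::real) \<partial>lborel) < \<infinity>"
    using C by (simp add: nn_integral_cmult ennreal_mult_less_top)
  show "integrable (lborel \<Otimes>\<^sub>M lborel) (\<lambda>(s::real, z). indicator {0..1} s * (\<phi> (z - s *\<^sub>R h) * q z))"
  proof (rule integrableI_bounded)
    have "(\<integral>\<^sup>+x. ennreal (norm (case x of (s::real, z) \<Rightarrow> indicator {0..1} s * (\<phi> (z - s *\<^sub>R h) * q z))) \<partial>(lborel \<Otimes>\<^sub>M lborel))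
       = (\<integral>\<^sup>+s. \<integral>\<^sup>+z. ennreal (norm (indicator {0..1} s * (\<phi> (z - s *\<^sub>R h) * q z))) \<partial>lborel \<partial>lborel)"
      by (subst lborel.nn_integral_fst[symmetric]) auto
    also have "\<dots> \<le> (\<integral>\<^sup>+s. C * indicator {0..1} (s::real) \<partial>lborel)"
      by (rule nn_integral_mono) (rule inner)
    finally show "(\<integral>\<^sup>+x. ennreal (norm (case x of (s::real, z) \<Rightarrow> indicator {0..1} s * (\<phi> (z - s *\<^sub>R h) * q z))) \<partial>(lborel \<Otimes>\<^sub>M lborel)) < \<infinity>"
      using total by (rule le_less_trans)
  qed measurable
  have inner': "(\<integral>\<^sup>+x. ennreal (norm (indicator {0..1} s * (\<phi> x * q (x + s *\<^sub>R h)))) \<partial>lborel) \<le> C * indicator {0..1} s"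
    for s :: real
    using inner[of s] by (subst (asm) nn_integral_lborel_shift[of _ "s *\<^sub>R h", symmetric]) auto
  show "integrable (lborel \<Otimes>\<^sub>M lborel) (\<lambda>(s::real, x). indicator {0..1} s * (\<phi> x * q (x + s *\<^sub>R h)))"
  proof (rule integrableI_bounded)
    have "(\<integral>\<^sup>+x. ennreal (norm (case x of (s::real, x) \<Rightarrow> indicator {0..1} s * (\<phi> x * q (x + s *\<^sub>R h)))) \<partial>(lborel \<Otimes>\<^sub>M lborel))
       = (\<integral>\<^sup>+s. \<integral>\<^sup>+x. ennreal (norm (indicator {0..1} s * (\<phi> x * q (x + s *\<^sub>R h)))) \<partial>lborel \<partial>lborel)"
      by (subst lborel.nn_integral_fst[symmetric]) auto
    also have "\<dots> \<le> (\<integral>\<^sup>+s. C * indicator {0..1} (s::real) \<partial>lborel)"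
      by (rule nn_integral_mono) (rule inner')
    finally show "(\<integral>\<^sup>+x. ennreal (norm (case x of (s::real, x) \<Rightarrow> indicator {0..1} s * (\<phi> x * q (x + s *\<^sub>R h)))) \<partial>(lborel \<Otimes>\<^sub>M lborel)) < \<infinity>"
      using total by (rule le_less_trans)
  qed measurable
qed

text \<open>The fundamental theorem of calculus on the side of the test function; duality transfers
  it to weakly differentiable functions.\<close>

lemma test_function_increment:
  assumes "\<phi> \<in> test_functions U"
  shows "\<phi> z - \<phi> (z - h) = (LINT s|lborel. indicator {0..1} s * frechet_derivative \<phi> (at (z - s *\<^sub>R h)) h)"
proof -
  obtain K where der: "\<And>x. (\<phi> has_derivative frechet_derivative \<phi> (at x)) (at x)"
    and cont: "\<And>e. continuous_on UNIV (\<lambda>x. frechet_derivative \<phi> (at x) e)"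
    using test_functionE[OF assms] by metis
  have "((\<lambda>s. - \<phi> (z - s *\<^sub>R h)) has_vector_derivative frechet_derivative \<phi> (at (z - s *\<^sub>R h)) h) (at s within {0..1})"
    for s
  proof -
    have lin: "linear (frechet_derivative \<phi> (at x))" for x
      using der has_derivative_linear by blast
    have "((\<lambda>s. z - s *\<^sub>R h) has_derivative (\<lambda>t. - (t *\<^sub>R h))) (at s within {0..1})"
      by (auto intro!: derivative_eq_intros)
    from has_derivative_minus[OF has_derivative_compose[OF this der]]
    show ?thesis
      by (simp add: has_vector_derivative_def linear_neg[OF lin] linear_scale[OF lin])
  qed
  moreover have "continuous_on {0..1} (\<lambda>s. frechet_derivative \<phi> (at (z - s *\<^sub>R h)) h)"
    by (rule continuous_on_compose2[OF cont]) (auto intro!: continuous_intros)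
  ultimately have "(LINT s|lborel. indicator {0..1} s *\<^sub>R frechet_derivative \<phi> (at (z - s *\<^sub>R h)) h)
      = - \<phi> (z - 1 *\<^sub>R h) - - \<phi> (z - 0 *\<^sub>R h)"
    by (intro integral_FTC_Icc) auto
  then show ?thesis
    by simp
qed

lemma locally_integrable_shift:
  fixes f :: "'a::euclidean_space \<Rightarrow> real"
  assumes f: "locally_integrable W f" and [measurable]: "f \<in> borel_measurable borel" and [measurable]: "U \<in> sets borel"
    and U: "\<And>x. x \<in> U \<Longrightarrow> x + v \<in> W"
  shows "locally_integrable U (\<lambda>x. f (x + v))"
  unfolding locally_integrable_def set_borel_measurable_def
proof (intro conjI allI impI)
  fix K assume K: "compact K \<and> K \<subseteq> U"
  then have "compact ((\<lambda>x. x + v) ` K)" "(\<lambda>x. x + v) ` K \<subseteq> W"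
    using U by (auto intro!: compact_continuous_image continuous_intros)
  then have "integrable lborel (\<lambda>x. indicator ((\<lambda>x. x + v) ` K) x *\<^sub>R f x)"
    using f by (simp add: locally_integrable_def set_integrable_def)
  from integrable_lborel_shift[OF this, of v]
  have "integrable lborel (\<lambda>x. indicator ((\<lambda>x. x + v) ` K) (x + v) *\<^sub>R f (x + v))" .
  moreover have "indicat_real ((\<lambda>x. x + v) ` K) (x + v) = indicator K x" for x
    by (auto simp: indicator_def)
  ultimately show "set_integrable lborel K (\<lambda>x. f (x + v))"
    by (simp add: set_integrable_def)
qed measurable

text \<open>By duality: paired with a test function \<phi>, the segment integral of \<open>g\<close>
  moves onto the translates \<open>\<phi> (z - s *\<^sub>R h)\<close>, which are test functions on
  \<open>W\<close> by the segment hypothesis. The weak derivative is used for each \<open>s\<close>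
  separately, and integration over \<open>s\<close> then produces
  \<open>\<phi> z - \<phi> (z - h)\<close>.\<close>

lemma shift_identity:
  fixes f g :: "'a::euclidean_space \<Rightarrow> real"
  assumes "open U" and wd: "weak_deriv W h f g"
    and [measurable]: "f \<in> borel_measurable borel" "g \<in> borel_measurable borel"
    and seg: "\<And>x s. x \<in> U \<Longrightarrow> s \<in> {0..1} \<Longrightarrow> x + s *\<^sub>R h \<in> W"
  shows "AE x in lborel. x \<in> U \<longrightarrow> f (x + h) - f x = (LINT s:{0..1}|lborel. g (x + s *\<^sub>R h))"
proof -
  have [measurable]: "U \<in> sets borel"
    using \<open>open U\<close> by simp
  have li: "locally_integrable W f" "locally_integrable W g"
    using wd by (auto simp: weak_deriv_def)
  define J where "J x = (LINT s|lborel. indicator {0..1} s * g (x + s *\<^sub>R h))" for x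
  have [measurable]: "J \<in> borel_measurable borel"
    unfolding J_def by measurable
  have li1: "locally_integrable U (\<lambda>x. f (x + h))"
    using seg[of _ 1] by (intro locally_integrable_shift[OF li(1)]) auto
  have li0: "locally_integrable U f"
    using locally_integrable_shift[OF li(1), of U 0] seg[of _ 0] by auto
  have liJ: "locally_integrable U J"
    unfolding locally_integrable_def set_borel_measurable_def
  proof (intro conjI allI impI)
    fix K assume K: "compact K \<and> K \<subseteq> U"
    then have [measurable]: "K \<in> sets borel"
      by (simp add: borel_compact)
    have "integrable (lborel \<Otimes>\<^sub>M lborel) (\<lambda>(s::real, x). indicator {0..1} s * (indicator K x * g (x + s *\<^sub>R h)))"
      by (rule integrable_segment_kernel(2)[OF li(2), where B = 1]) (use K seg in \<open>auto simp: indicator_def\<close>)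
    from lborel_pair.integrable_snd[OF this]
    have "integrable lborel (\<lambda>x. LINT s|lborel. indicator {0..1} (s::real) * (indicator K x * g (x + s *\<^sub>R h)))" .
    moreover have "(LINT s|lborel. indicator {0..1} s * (indicator K x * g (x + s *\<^sub>R h))) = indicator K x *\<^sub>R J x" for x
      by (simp add: J_def indicator_def)
    ultimately show "set_integrable lborel K J"
      by (simp add: set_integrable_def)
  qed measurable
  have "AE x in lborel. x \<in> U \<longrightarrow> (f (x + h) - f x) - J x = 0"
  proof (rule fundamental_lemma[OF \<open>open U\<close> locally_integrable_diff[OF locally_integrable_diff[OF li1 li0] liJ]])
    fix \<phi> assume \<phi>: "\<phi> \<in> test_functions U"
    obtain K where K: "compact K" "K \<subseteq> U" "\<And>x. x \<notin> K \<Longrightarrow> \<phi> x = 0" "continuous_on UNIV \<phi>"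
      "\<And>x e. x \<notin> K \<Longrightarrow> frechet_derivative \<phi> (at x) e = 0"
      "\<And>e. continuous_on UNIV (\<lambda>x. frechet_derivative \<phi> (at x) e)"
      using test_functionE[OF \<phi>] by metis
    define \<phi>' where "\<phi>' x = frechet_derivative \<phi> (at x) h" for x
    have \<phi>': "continuous_on UNIV \<phi>'" "\<And>x. x \<notin> K \<Longrightarrow> \<phi>' x = 0"
      using K unfolding \<phi>'_def by auto
    have [measurable]: "\<phi> \<in> borel_measurable borel" "\<phi>' \<in> borel_measurable borel"
      using K \<phi>' by (auto intro: borel_measurable_continuous_onI)
    obtain B where B: "\<And>x. \<bar>\<phi> x\<bar> \<le> B"
      using continuous_compact_support_bounded[OF K(4) K(1) K(3)] by auto
    obtain B' where B': "\<And>x. \<bar>\<phi>' x\<bar> \<le> B'"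
      using continuous_compact_support_bounded[OF \<phi>'(1) K(1) \<phi>'(2)] by auto
    have segK: "\<And>x s. x \<in> K \<Longrightarrow> s \<in> {0..1} \<Longrightarrow> x + s *\<^sub>R h \<in> W"
      using K(2) seg by auto
    note ker\<phi> = integrable_segment_kernel[OF li(2) _ _ B K(3) K(1) segK, simplified]
    note ker\<phi>' = integrable_segment_kernel[OF li(1) _ _ B' \<phi>'(2) K(1) segK, simplified]
    have weak: "(LINT z|lborel. \<phi>' (z - s *\<^sub>R h) * f z) = - (LINT z|lborel. \<phi> (z - s *\<^sub>R h) * g z)" if "s \<in> {0..1}" for s
      using weak_deriv_test[OF wd test_function_shift(1)[OF \<phi>, of "s *\<^sub>R h" W]]
        test_function_shift(2)[OF \<phi>, of "s *\<^sub>R h" W] seg that by (simp add: \<phi>'_def)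
    have shift\<phi>: "(LINT x|lborel. \<phi> x * g (x + s *\<^sub>R h)) = (LINT z|lborel. \<phi> (z - s *\<^sub>R h) * g z)" for s
      using integral_lborel_shift[of "\<lambda>z. \<phi> (z - s *\<^sub>R h) * g z" "s *\<^sub>R h"] by simp
    have "(LINT x|lborel. \<phi> x * J x)
        = (LINT x|lborel. LINT s|lborel. indicator {0..1} s * (\<phi> x * g (x + s *\<^sub>R h)))"
      unfolding J_def by (subst integral_mult_right_zero[symmetric]) (simp add: mult_ac)
    also have "\<dots> = (LINT s|lborel. LINT x|lborel. indicator {0..1} s * (\<phi> x * g (x + s *\<^sub>R h)))"
      by (rule lborel_pair.Fubini_integral) (rule ker\<phi>(2); measurable)
    also have "\<dots> = (LINT s|lborel. indicator {0..1} s * (LINT x|lborel. \<phi> x * g (x + s *\<^sub>R h)))"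
      by simp
    also have "\<dots> = (LINT s|lborel. indicator {0..1} s * (LINT z|lborel. \<phi> (z - s *\<^sub>R h) * g z))"
      by (simp only: shift\<phi>)
    also have "\<dots> = (LINT s|lborel. - (LINT z|lborel. indicator {0..1} s * (\<phi>' (z - s *\<^sub>R h) * f z)))"
      by (rule Bochner_Integration.integral_cong[OF refl]) (auto simp: weak indicator_def)
    also have "\<dots> = - (LINT s|lborel. LINT z|lborel. indicator {0..1} s * (\<phi>' (z - s *\<^sub>R h) * f z))"
      by simp
    also have "\<dots> = - (LINT z|lborel. LINT s|lborel. indicator {0..1} s * (\<phi>' (z - s *\<^sub>R h) * f z))"
      by (subst lborel_pair.Fubini_integral[symmetric]) (rule ker\<phi>'(1) refl; measurable)+
    also have "\<dots> = - (LINT z|lborel. (\<phi> z - \<phi> (z - h)) * f z)"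
      unfolding test_function_increment[OF \<phi>] \<phi>'_def
      by (subst integral_mult_left_zero[symmetric]) (simp add: mult_ac)
    also have "\<dots> = (LINT z|lborel. \<phi> (z - h) * f z) - (LINT z|lborel. \<phi> z * f z)"
    proof -
      have "(\<lambda>z. \<phi> (z - h)) \<in> test_functions W" "\<phi> \<in> test_functions W"
        using test_function_shift(1)[OF \<phi>, of h W] test_function_shift(1)[OF \<phi>, of 0 W] seg[of _ 1] seg[of _ 0]
        by auto
      moreover have "integrable lborel (\<lambda>z. \<psi> z * f z)" if \<psi>: "\<psi> \<in> test_functions W" for \<psi>
      proof -
        obtain K where "compact K" "K \<subseteq> W" "continuous_on UNIV \<psi>" "\<And>x. x \<notin> K \<Longrightarrow> \<psi> x = 0"
          using test_functionE[OF \<psi>] by metis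
        from set_integral_bounded_on_compact(2)[OF li(1) this] show ?thesis
          by simp
      qed
      ultimately have "integrable lborel (\<lambda>z. \<phi> (z - h) * f z)" "integrable lborel (\<lambda>z. \<phi> z * f z)"
        by blast+
      then show ?thesis
        by (simp add: left_diff_distrib)
    qed
    also have "(LINT z|lborel. \<phi> (z - h) * f z) = (LINT z|lborel. \<phi> z * f (z + h))"
      using integral_lborel_shift[of "\<lambda>z. \<phi> (z - h) * f z" h] by simp
    finally have "(LINT x|lborel. \<phi> x * J x) = (LINT z|lborel. \<phi> z * f (z + h)) - (LINT z|lborel. \<phi> z * f z)" .
    moreover have "(LINT x:U|lborel. \<phi> x *\<^sub>R (f (x + h) - f x - J x))
        = ((LINT x:U|lborel. \<phi> x *\<^sub>R f (x + h)) - (LINT x:U|lborel. \<phi> x *\<^sub>R f x)) - (LINT x:U|lborel. \<phi> x *\<^sub>R J x)"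
      using set_integral_bounded_on_compact(1)[OF li1 K(1,2,4,3)] set_integral_bounded_on_compact(1)[OF li0 K(1,2,4,3)]
        set_integral_bounded_on_compact(1)[OF liJ K(1,2,4,3)]
      by (simp add: scaleR_diff_right right_diff_distrib)
    ultimately show "(LINT x:U|lborel. \<phi> x *\<^sub>R (f (x + h) - f x - J x)) = 0"
      using set_integral_bounded_on_compact(3)[OF li1 K(1,2,4,3)] set_integral_bounded_on_compact(3)[OF li0 K(1,2,4,3)]
        set_integral_bounded_on_compact(3)[OF liJ K(1,2,4,3)] by simp
  qed
  then show ?thesis
    by (simp add: J_def set_lebesgue_integral_def)
qed

abbreviation nn_integral_on :: "'a::euclidean_space set \<Rightarrow> ('a \<Rightarrow> real) \<Rightarrow> ennreal" where
  "nn_integral_on A g \<equiv> \<integral>\<^sup>+x. indicator A x * ennreal (g x) \<partial>lborel"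

text \<open>Jensen's inequality up to a factor, from \<open>F \<le> S + S powr (1 - p) * F powr p\<close>.\<close>

lemma weighted_mean_le:
  fixes w :: "'x \<Rightarrow> ennreal" and F :: "'x \<Rightarrow> real" and S p :: real
  assumes [measurable]: "w \<in> borel_measurable M" "F \<in> borel_measurable M"
    and mass: "(\<integral>\<^sup>+x. w x \<partial>M) \<le> 1" and "p \<ge> 1" and F: "\<And>x. F x \<ge> 0" and "S \<ge> 0"
    and le: "(\<integral>\<^sup>+x. w x * ennreal (F x powr p) \<partial>M) \<le> ennreal (S powr p)"
  shows "(\<integral>\<^sup>+x. w x * ennreal (F x) \<partial>M) \<le> ennreal (2 * S)"
proof (cases "S = 0")
  case True
  then have "AE x in M. w x * ennreal (F x powr p) = 0"
    using le nn_integral_0_iff_AE[of "\<lambda>x. w x * ennreal (F x powr p)" M] by simp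
  then have "AE x in M. w x * ennreal (F x) = 0"
  proof eventually_elim
    case (elim x)
    then show ?case
      using F[of x] by (cases "F x = 0") (auto simp: ennreal_eq_0_iff)
  qed
  then have "(\<integral>\<^sup>+x. w x * ennreal (F x) \<partial>M) = 0"
    by (subst nn_integral_0_iff_AE) auto
  then show ?thesis
    by simp
next
  case False
  then have S: "S > 0"
    using \<open>S \<ge> 0\<close> by simp
  have pw: "F x \<le> S + S powr (1 - p) * F x powr p" for x
  proof (cases "F x \<le> S")
    case True
    then show ?thesis
      by (simp add: add_increasing2)
  next
    case False
    then have "F x = F x powr (1 - p) * F x powr p"
      using S by (simp add: powr_add[symmetric])
    also have "\<dots> \<le> S powr (1 - p) * F x powr p"
      using False S \<open>p \<ge> 1\<close> by (intro mult_right_mono powr_mono2') auto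
    finally show ?thesis
      using S by simp
  qed
  have "(\<integral>\<^sup>+x. w x * ennreal (F x) \<partial>M)
      \<le> (\<integral>\<^sup>+x. ennreal S * w x + ennreal (S powr (1 - p)) * (w x * ennreal (F x powr p)) \<partial>M)"
  proof (rule nn_integral_mono)
    fix x
    have "ennreal (F x) \<le> ennreal S + ennreal (S powr (1 - p)) * ennreal (F x powr p)"
      using pw[of x] S by (simp add: ennreal_mult[symmetric] ennreal_plus[symmetric] ennreal_leI del: ennreal_plus)
    from mult_left_mono[OF this, of "w x"]
    show "w x * ennreal (F x) \<le> ennreal S * w x + ennreal (S powr (1 - p)) * (w x * ennreal (F x powr p))"
      by (simp add: distrib_left mult_ac)
  qed
  also have "\<dots> = ennreal S * (\<integral>\<^sup>+x. w x \<partial>M) + ennreal (S powr (1 - p)) * (\<integral>\<^sup>+x. w x * ennreal (F x powr p) \<partial>M)"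
    by (simp add: nn_integral_add nn_integral_cmult)
  also have "\<dots> \<le> ennreal S * 1 + ennreal (S powr (1 - p)) * ennreal (S powr p)"
    using mass le by (intro add_mono mult_left_mono) auto
  also have "\<dots> = ennreal (2 * S)"
    using S by (simp add: ennreal_mult[symmetric] powr_add[symmetric] ennreal_plus[symmetric] del: ennreal_plus)
  finally show ?thesis .
qed

text \<open>The form in which the mean inequality is applied: \<open>c\<close> is known only through
  a bound by a mean, and the mean of powers may be infinite. \<open>S\<close> is the p-th root of
  the latter; the factor 2 of the previous lemma turns into \<open>2 powr p\<close>.\<close>

lemma power_mean_le:
  fixes w :: "'x \<Rightarrow> ennreal" and F :: "'x \<Rightarrow> real" and c p :: real
  assumes [measurable]: "w \<in> borel_measurable M" "F \<in> borel_measurable M"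
    and mass: "(\<integral>\<^sup>+x. w x \<partial>M) \<le> 1" and "p \<ge> 1" and F: "\<And>x. F x \<ge> 0" and "c \<ge> 0"
    and c: "ennreal c \<le> (\<integral>\<^sup>+x. w x * ennreal (F x) \<partial>M)"
  shows "ennreal (c powr p) \<le> ennreal (2 powr p) * (\<integral>\<^sup>+x. w x * ennreal (F x powr p) \<partial>M)"
proof (cases "(\<integral>\<^sup>+x. w x * ennreal (F x powr p) \<partial>M)")
  case top
  then show ?thesis
    by (simp add: ennreal_mult_top)
next
  case (real r)
  define S where "S = r powr (1 / p)"
  have S: "S \<ge> 0" "S powr p = r"
    using real \<open>p \<ge> 1\<close> by (auto simp: S_def powr_powr)
  have "ennreal c \<le> ennreal (2 * S)"
    using c weighted_mean_le[OF assms(1,2) mass \<open>p \<ge> 1\<close> F S(1)] real S(2) order_trans by simp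
  then have "c powr p \<le> (2 * S) powr p"
    using \<open>c \<ge> 0\<close> \<open>p \<ge> 1\<close> S by (intro powr_mono2) auto
  also have "\<dots> = 2 powr p * r"
    using S by (simp add: powr_mult)
  finally show ?thesis
    using real by (simp add: ennreal_mult[symmetric] ennreal_leI)
qed

section \<open>Increments along segments and the weak gradient\<close>

lemma norm_inner_sum_le_gradient_size:
  fixes V :: "'a::euclidean_space \<Rightarrow> 'a \<Rightarrow> real"
  shows "\<bar>\<Sum>i\<in>Basis. (h \<bullet> i) * V i x\<bar> \<le> norm h * gradient_size V x"
proof -
  have "\<bar>\<Sum>i\<in>Basis. (h \<bullet> i) * V i x\<bar> \<le> (\<Sum>i\<in>Basis. \<bar>h \<bullet> i\<bar> * \<bar>V i x\<bar>)"
    unfolding abs_mult[symmetric] by (rule sum_abs)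
  also have "\<dots> \<le> L2_set (\<lambda>i. h \<bullet> i) Basis * L2_set (\<lambda>i. V i x) Basis"
    by (rule L2_set_mult_ineq)
  also have "L2_set (\<lambda>i. h \<bullet> i) Basis = norm h"
    unfolding L2_set_def norm_eq_sqrt_inner by (simp add: euclidean_inner[of h h] power2_eq_square)
  finally show ?thesis
    by (simp add: gradient_size_def L2_set_def)
qed

lemma gradient_size_nonneg: "gradient_size V x \<ge> 0"
  by (simp add: gradient_size_def sum_nonneg)

lemma borel_measurable_gradient_size [measurable (raw)]:
  fixes V :: "'a::euclidean_space \<Rightarrow> 'a \<Rightarrow> 'b::euclidean_space"
  assumes "\<And>i. i \<in> Basis \<Longrightarrow> V i \<in> borel_measurable borel"
  shows "gradient_size V \<in> borel_measurable borel"
  unfolding gradient_size_def[abs_def] using assms by measurable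

lemma locally_integrable_sum:
  fixes f :: "'i \<Rightarrow> 'a::euclidean_space \<Rightarrow> real"
  assumes "\<And>i. i \<in> I \<Longrightarrow> locally_integrable U (f i)"
  shows "locally_integrable U (\<lambda>x. \<Sum>i\<in>I. c i * f i x)"
proof -
  have "(\<lambda>x. indicator U x * (\<Sum>i\<in>I. c i * f i x)) \<in> borel_measurable lborel"
  proof -
    have "(\<lambda>x. \<Sum>i\<in>I. c i * (indicator U x * f i x)) \<in> borel_measurable lborel"
      using assms by (intro borel_measurable_sum borel_measurable_times[OF borel_measurable_const])
        (auto simp: locally_integrable_def set_borel_measurable_def)
    then show ?thesis
      by (simp add: sum_distrib_left mult_ac)
  qed
  moreover have "set_integrable lborel K (\<lambda>x. \<Sum>i\<in>I. c i * f i x)" if "compact K" "K \<subseteq> U" for K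
  proof -
    have "integrable lborel (\<lambda>x. \<Sum>i\<in>I. c i * (indicator K x * f i x))"
      using assms that by (intro Bochner_Integration.integrable_sum integrable_mult_right)
        (auto simp: locally_integrable_def set_integrable_def)
    then show ?thesis
      by (simp add: set_integrable_def sum_distrib_left mult_ac)
  qed
  ultimately show ?thesis
    by (simp add: locally_integrable_def set_borel_measurable_def)
qed

text \<open>Increments occur along arbitrary vectors, whereas a weak gradient lists basis directions
  only; both sides of the defining identity are linear in the direction.\<close>

lemma weak_deriv_direction:
  fixes f :: "'a::euclidean_space \<Rightarrow> real"
  assumes V: "is_weak_gradient U f V"
  shows "weak_deriv U h f (\<lambda>x. \<Sum>i\<in>Basis. (h \<bullet> i) * V i x)"
  unfolding weak_deriv_def
proof (intro conjI ballI)
  have wd: "weak_deriv U i f (V i)" if "i \<in> Basis" for i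
    using V that by (simp add: is_weak_gradient_def)
  show f: "locally_integrable U f"
    using wd nonempty_Basis unfolding weak_deriv_def by blast
  have liV: "locally_integrable U (V i)" if "i \<in> Basis" for i
    using wd[OF that] by (simp add: weak_deriv_def)
  then show "locally_integrable U (\<lambda>x. \<Sum>i\<in>Basis. (h \<bullet> i) * V i x)"
    by (rule locally_integrable_sum)
  fix \<phi> assume \<phi>: "\<phi> \<in> test_functions U"
  obtain K where K: "compact K" "K \<subseteq> U" "\<And>x. x \<notin> K \<Longrightarrow> \<phi> x = 0" "continuous_on UNIV \<phi>"
    "\<And>x e. x \<notin> K \<Longrightarrow> frechet_derivative \<phi> (at x) e = 0"
    "\<And>e. continuous_on UNIV (\<lambda>x. frechet_derivative \<phi> (at x) e)"
    "\<And>x. (\<phi> has_derivative frechet_derivative \<phi> (at x)) (at x)"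
    using test_functionE[OF \<phi>] by metis
  have D: "frechet_derivative \<phi> (at x) h = (\<Sum>i\<in>Basis. (h \<bullet> i) * frechet_derivative \<phi> (at x) i)" for x
    using linear_eq_sum_Basis[OF has_derivative_linear[OF K(7)], of x h] by simp
  note int\<phi> = set_integral_bounded_on_compact(1)[OF f K(1,2) K(6) K(5), unfolded set_integrable_def]
  note intV = set_integral_bounded_on_compact(1)[OF liV K(1,2,4,3), unfolded set_integrable_def]
  have "(LINT x:U|lborel. frechet_derivative \<phi> (at x) h *\<^sub>R f x)
      = (LINT x|lborel. (\<Sum>i\<in>Basis. (h \<bullet> i) *\<^sub>R (indicator U x *\<^sub>R (frechet_derivative \<phi> (at x) i *\<^sub>R f x))))"
    unfolding set_lebesgue_integral_def D by (simp add: sum_distrib_left sum_distrib_right mult_ac)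
  also have "\<dots> = (\<Sum>i\<in>Basis. (h \<bullet> i) *\<^sub>R (LINT x:U|lborel. frechet_derivative \<phi> (at x) i *\<^sub>R f x))"
    unfolding set_lebesgue_integral_def
    by (subst Bochner_Integration.integral_sum) (use int\<phi> in auto)
  also have "\<dots> = (\<Sum>i\<in>Basis. (h \<bullet> i) *\<^sub>R - (LINT x:U|lborel. \<phi> x *\<^sub>R V i x))"
    using wd \<phi> by (intro sum.cong refl) (simp add: weak_deriv_def)
  also have "\<dots> = - (LINT x|lborel. (\<Sum>i\<in>Basis. (h \<bullet> i) *\<^sub>R (indicator U x *\<^sub>R (\<phi> x *\<^sub>R V i x))))"
    unfolding set_lebesgue_integral_def
    by (subst Bochner_Integration.integral_sum) (use intV in \<open>auto simp: sum_negf\<close>)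
  also have "(\<lambda>x. \<Sum>i\<in>Basis. (h \<bullet> i) *\<^sub>R (indicator U x *\<^sub>R (\<phi> x *\<^sub>R V i x)))
      = (\<lambda>x. indicator U x *\<^sub>R (\<phi> x *\<^sub>R (\<Sum>i\<in>Basis. (h \<bullet> i) * V i x)))"
    by (simp add: sum_distrib_left mult_ac)
  finally show "(LINT x:U|lborel. frechet_derivative \<phi> (at x) h *\<^sub>R f x)
      = - (LINT x:U|lborel. \<phi> x *\<^sub>R (\<Sum>i\<in>Basis. (h \<bullet> i) * V i x))"
    unfolding set_lebesgue_integral_def .
qed

text \<open>Holds without integrability, since the Bochner integral of a non-integrable function is
  0 by convention; this keeps the estimates below free of side conditions.\<close>

lemma norm_integral_le_nn_integral:
  fixes F :: "'x \<Rightarrow> 'b::{banach, second_countable_topology}"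
  shows "ennreal (norm (LINT x|M. F x)) \<le> (\<integral>\<^sup>+x. ennreal (norm (F x)) \<partial>M)"
proof (cases "integrable M F")
  case True
  then show ?thesis
    by (rule integral_norm_bound_ennreal)
qed (simp add: not_integrable_integral_eq)

lemma difference_le_segment_integral:
  fixes f :: "'a::euclidean_space \<Rightarrow> real"
  assumes "open U" and V: "is_weak_gradient W f V"
    and [measurable]: "f \<in> borel_measurable borel" "\<And>i. i \<in> Basis \<Longrightarrow> V i \<in> borel_measurable borel"
    and seg: "\<And>x s. x \<in> U \<Longrightarrow> s \<in> {0..1} \<Longrightarrow> x + s *\<^sub>R h \<in> W"
  shows "AE x in lborel. x \<in> U \<longrightarrow> ennreal \<bar>f (x + h) - f x\<bar>
    \<le> (nn_integral_on {0..1} (\<lambda>s. norm h * gradient_size V (x + s *\<^sub>R h)))"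
proof -
  let ?g = "\<lambda>x. \<Sum>i\<in>Basis. (h \<bullet> i) * V i x"
  have "AE x in lborel. x \<in> U \<longrightarrow> f (x + h) - f x = (LINT s:{0..1}|lborel. ?g (x + s *\<^sub>R h))"
    by (rule shift_identity[OF \<open>open U\<close> weak_deriv_direction[OF V]]) (use seg in \<open>auto intro!: borel_measurable_sum\<close>)
  then show ?thesis
  proof eventually_elim
    case (elim x)
    show ?case
    proof
      assume "x \<in> U"
      with elim have "ennreal \<bar>f (x + h) - f x\<bar> = ennreal (norm (LINT s|lborel. indicator {0..1} s *\<^sub>R ?g (x + s *\<^sub>R h)))"
        by (simp add: set_lebesgue_integral_def)
      also have "\<dots> \<le> (\<integral>\<^sup>+s. ennreal (norm (indicator {0..1} s *\<^sub>R ?g (x + s *\<^sub>R h))) \<partial>lborel)"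
        by (rule norm_integral_le_nn_integral)
      also have "\<dots> \<le> (nn_integral_on {0..1} (\<lambda>s. norm h * gradient_size V (x + s *\<^sub>R h)))"
        using norm_inner_sum_le_gradient_size[of h V]
        by (intro nn_integral_mono) (auto simp: indicator_def intro!: ennreal_leI)
      finally show "ennreal \<bar>f (x + h) - f x\<bar>
        \<le> (nn_integral_on {0..1} (\<lambda>s. norm h * gradient_size V (x + s *\<^sub>R h)))" .
    qed
  qed
qed

text \<open>The mean over the segment is raised to the power \<open>p\<close>, and Tonelli's theorem
  exchanges \<open>x\<close> and \<open>s\<close>. For fixed \<open>s\<close> the translate of
  \<open>U\<close> by \<open>s *\<^sub>R h\<close> stays in \<open>W\<close>, so translation
  invariance bounds each inner integral by the one over \<open>W\<close>. The factor 2 is the loss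
  in the mean inequality.\<close>

lemma difference_quotient_Lp:
  fixes f :: "'a::euclidean_space \<Rightarrow> real"
  assumes "open U" and "W \<in> sets borel" and V: "is_weak_gradient W f V"
    and [measurable]: "f \<in> borel_measurable borel" and Vm: "\<And>i. i \<in> Basis \<Longrightarrow> V i \<in> borel_measurable borel"
    and seg: "\<And>x s. x \<in> U \<Longrightarrow> s \<in> {0..1} \<Longrightarrow> x + s *\<^sub>R h \<in> W" and "p \<ge> 1"
  shows "(nn_integral_on U (\<lambda>x. \<bar>f (x + h) - f x\<bar> powr p))
    \<le> ennreal ((2 * norm h) powr p) * (nn_integral_on W (\<lambda>x. gradient_size V x powr p))"
    (is "_ \<le> _ * ?I")
proof -
  have [measurable]: "U \<in> sets borel" "W \<in> sets borel" "gradient_size V \<in> borel_measurable borel"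
    using \<open>open U\<close> assms(2) Vm by (auto intro: borel_measurable_gradient_size)
  have "AE x in lborel. indicator U x * ennreal (\<bar>f (x + h) - f x\<bar> powr p)
    \<le> indicator U x * (ennreal (2 powr p) * (nn_integral_on {0..1} (\<lambda>s. (norm h * gradient_size V (x + s *\<^sub>R h)) powr p)))"
    using difference_le_segment_integral[OF \<open>open U\<close> V _ Vm seg, simplified]
  proof eventually_elim
    case (elim x)
    show ?case
    proof (cases "x \<in> U")
      case True
      have "ennreal (\<bar>f (x + h) - f x\<bar> powr p)
        \<le> ennreal (2 powr p) * (nn_integral_on {0..1} (\<lambda>s. (norm h * gradient_size V (x + s *\<^sub>R h)) powr p))"
        by (rule power_mean_le) (use True elim gradient_size_nonneg[of V] \<open>p \<ge> 1\<close> in auto)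
      then show ?thesis
        by (simp add: mult_left_mono)
    qed simp
  qed
  then have "(nn_integral_on U (\<lambda>x. \<bar>f (x + h) - f x\<bar> powr p))
    \<le> (\<integral>\<^sup>+x. indicator U x * (ennreal (2 powr p) * (nn_integral_on {0..1} (\<lambda>s. (norm h * gradient_size V (x + s *\<^sub>R h)) powr p))) \<partial>lborel)"
    by (rule nn_integral_mono_AE)
  also have "\<dots> = ennreal (2 powr p) * (\<integral>\<^sup>+x. \<integral>\<^sup>+s. indicator U x * (indicator {0..1} s * ennreal ((norm h * gradient_size V (x + s *\<^sub>R h)) powr p)) \<partial>lborel \<partial>lborel)"
    by (simp add: nn_integral_cmult mult.left_commute[of _ "ennreal (2 powr p)"])
  also have "(\<integral>\<^sup>+x. \<integral>\<^sup>+s. indicator U x * (indicator {0..1} s * ennreal ((norm h * gradient_size V (x + s *\<^sub>R h)) powr p)) \<partial>lborel \<partial>lborel)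
    = (\<integral>\<^sup>+s. \<integral>\<^sup>+x. indicator U x * (indicator {0..1} s * ennreal ((norm h * gradient_size V (x + s *\<^sub>R h)) powr p)) \<partial>lborel \<partial>lborel)"
    by (rule lborel_pair.Fubini') measurable
  also have "\<dots> \<le> (\<integral>\<^sup>+s. indicator {0..1} (s::real) * (ennreal (norm h powr p) * ?I) \<partial>lborel)"
  proof (rule nn_integral_mono)
    fix s :: real
    have "(\<integral>\<^sup>+x. indicator U x * (indicator {0..1} s * ennreal ((norm h * gradient_size V (x + s *\<^sub>R h)) powr p)) \<partial>lborel)
      \<le> (\<integral>\<^sup>+x. (indicator {0..1} s * ennreal (norm h powr p)) * (indicator W (x + s *\<^sub>R h) * ennreal (gradient_size V (x + s *\<^sub>R h) powr p)) \<partial>lborel)"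
      using seg gradient_size_nonneg[of V]
      by (intro nn_integral_mono) (auto simp: indicator_def powr_mult ennreal_mult)
    also have "\<dots> = (indicator {0..1} s * ennreal (norm h powr p)) * (\<integral>\<^sup>+x. indicator W (x + s *\<^sub>R h) * ennreal (gradient_size V (x + s *\<^sub>R h) powr p) \<partial>lborel)"
      by (rule nn_integral_cmult) measurable
    also have "(\<integral>\<^sup>+x. indicator W (x + s *\<^sub>R h) * ennreal (gradient_size V (x + s *\<^sub>R h) powr p) \<partial>lborel) = ?I"
      by (rule nn_integral_lborel_shift[of "\<lambda>x. indicator W x * ennreal (gradient_size V x powr p)"]) measurable
    finally show "(\<integral>\<^sup>+x. indicator U x * (indicator {0..1} s * ennreal ((norm h * gradient_size V (x + s *\<^sub>R h)) powr p)) \<partial>lborel)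
      \<le> indicator {0..1} s * (ennreal (norm h powr p) * ?I)"
      by (simp add: mult_ac)
  qed
  also have "\<dots> = ennreal (norm h powr p) * ?I"
    by (simp add: nn_integral_multc)
  finally show ?thesis
    by (simp add: powr_mult ennreal_mult mult.assoc mult_left_mono)
qed

subsection \<open>Averages over displaced balls\<close>

lemma lborel_eq_density_affine:
  fixes v :: "'a::euclidean_space" and \<rho> :: real
  assumes "\<rho> > 0"
  shows "lborel = density (distr lborel borel (\<lambda>y. v + \<rho> *\<^sub>R y)) (\<lambda>_. ennreal (\<rho> ^ DIM('a)))"
  using lborel_affine[of \<rho> v] assms by simp

lemma integral_lborel_affine:
  fixes F :: "'a::euclidean_space \<Rightarrow> real" and \<rho> :: real
  assumes "\<rho> > 0" and [measurable]: "F \<in> borel_measurable borel"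
  shows "(LINT z|lborel. F z) = \<rho> ^ DIM('a) * (LINT y|lborel. F (v + \<rho> *\<^sub>R y))"
    and "integrable lborel F \<longleftrightarrow> integrable lborel (\<lambda>y. F (v + \<rho> *\<^sub>R y))"
proof -
  have "(LINT z|lborel. F z) = (LINT z|density (distr lborel borel (\<lambda>y. v + \<rho> *\<^sub>R y)) (\<lambda>_. ennreal (\<rho> ^ DIM('a))). F z)"
    using lborel_eq_density_affine[OF assms(1), of v] by simp
  also have "\<dots> = \<rho> ^ DIM('a) * (LINT y|lborel. F (v + \<rho> *\<^sub>R y))"
    using assms(1) by (subst integral_density) (auto simp: integral_distr)
  finally show "(LINT z|lborel. F z) = \<rho> ^ DIM('a) * (LINT y|lborel. F (v + \<rho> *\<^sub>R y))" .
  have "integrable lborel F \<longleftrightarrow> integrable (density (distr lborel borel (\<lambda>y. v + \<rho> *\<^sub>R y)) (\<lambda>_. ennreal (\<rho> ^ DIM('a)))) F"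
    using lborel_eq_density_affine[OF assms(1), of v] by simp
  also have "\<dots> \<longleftrightarrow> integrable lborel (\<lambda>y. F (v + \<rho> *\<^sub>R y))"
    using assms(1) by (subst integrable_density) (auto simp: integrable_distr_eq)
  finally show "integrable lborel F \<longleftrightarrow> integrable lborel (\<lambda>y. F (v + \<rho> *\<^sub>R y))" .
qed

text \<open>The smooth kernel \<open>b\<close> performs the averaging. It may change sign under
  differentiation, so a probability density \<open>w\<close> on the unit ball is carried along that
  dominates \<open>b\<close> and its partial derivatives up to the factor \<open>B\<close>;
  \<open>w\<close> is the weight to which the mean inequality is applied, in space as well as in
  time.\<close>

locale mollifier =
  fixes b :: "'a::euclidean_space \<Rightarrow> real" and w :: "'a \<Rightarrow> real" and B :: real
  assumes b_test: "b \<in> test_functions (ball 0 1)" and b_integral: "(LINT y|lborel. b y) = 1"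
    and w_measurable [measurable]: "w \<in> borel_measurable borel" and w_nonneg: "w y \<ge> 0"
    and w_support: "norm y > 1 \<Longrightarrow> w y = 0" and w_mass: "(\<integral>\<^sup>+y. ennreal (w y) \<partial>lborel) = 1"
    and B_pos: "B > 0" and b_le: "\<bar>b y\<bar> \<le> B * w y"
    and b_derivative_le: "i \<in> Basis \<Longrightarrow> \<bar>frechet_derivative b (at y) i\<bar> \<le> B * w y"

text \<open>A nonnegative function with integral 0 vanishes almost everywhere, but a nonempty open
  box is not a null set.\<close>

lemma box_bump_integral_pos:
  assumes "box a b \<noteq> {}"
  shows "(LINT x|lborel. box_bump a b x) > 0" and "integrable lborel (box_bump a b)"
proof -
  have cont: "continuous_on UNIV (box_bump a b)"
    using C_k_continuous[OF C_k_box_bump] .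
  have zero: "box_bump a b x = 0" if "x \<notin> cbox a b" for x
    using that box_bump_pos_iff[of a b x] box_bump_nonneg[of a b x] box_subset_cbox[of a b] by force
  have "locally_integrable UNIV (\<lambda>_::'a. 1::real)"
    by (auto simp: locally_integrable_def set_borel_measurable_def set_integrable_def
        intro!: integrable_real_indicator emeasure_compact_finite borel_compact)
  from set_integral_bounded_on_compact(2)[OF this compact_cbox[of a b] _ cont zero]
  show int: "integrable lborel (box_bump a b)"
    by simp
  have "(LINT x|lborel. box_bump a b x) \<noteq> 0"
  proof
    assume "(LINT x|lborel. box_bump a b x) = 0"
    then have "AE x in lborel. box_bump a b x = 0"
      using integral_nonneg_eq_0_iff_AE[OF int] box_bump_nonneg by auto
    then have "AE x in lborel. x \<notin> box a b"
      by eventually_elim (metis box_bump_pos_iff less_irrefl)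
    then have "box a b \<in> null_sets lborel"
      by (subst AE_iff_null_sets) auto
    then have "negligible (box a b)"
      by (simp add: negligible_iff_null_sets null_sets_completion_iff)
    then show False
      using open_not_negligible[OF open_box assms] by simp
  qed
  then show "(LINT x|lborel. box_bump a b x) > 0"
    using integral_nonneg_AE[of "box_bump a b" lborel] box_bump_nonneg[of a b] by (simp add: less_le)
qed

lemma mollifier_exists: "\<exists>(b::'a::euclidean_space \<Rightarrow> real) w B. mollifier b w B"
proof -
  \<comment> \<open>On the cube of half-width r the l1 norm is at most d r = 1/2, which puts the
    closed cube into the open unit ball.\<close>
  define r where "r = 1 / (2 * real DIM('a))"
  have r: "r > 0"
    by (simp add: r_def)
  let ?l = "- r *\<^sub>R One :: 'a" and ?u = "r *\<^sub>R One :: 'a"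
  have ne: "box ?l ?u \<noteq> {}"
    using r by (simp add: box_ne_empty)
  have sub: "cbox ?l ?u \<subseteq> ball 0 1"
  proof
    fix x assume "x \<in> cbox ?l ?u"
    then have "\<bar>x \<bullet> i\<bar> \<le> r" if "i \<in> Basis" for i
      using that by (auto simp: mem_box abs_le_iff)
    then have "(\<Sum>i\<in>Basis. \<bar>x \<bullet> i\<bar>) \<le> real DIM('a) * r"
      using sum_bounded_above[of Basis "\<lambda>i. \<bar>x \<bullet> i\<bar>" r] by simp
    then have "norm x \<le> 1 / 2"
      using norm_le_l1[of x] by (simp add: r_def)
    then show "x \<in> ball 0 1"
      by simp
  qed
  define m where "m = (LINT x|lborel. box_bump ?l ?u x)"
  have m: "m > 0"
    using box_bump_integral_pos(1)[OF ne] by (simp add: m_def)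
  define b where "b = (\<lambda>x. (1 / m) * box_bump ?l ?u x)"
  have zero: "box_bump ?l ?u x = 0" if "x \<notin> cbox ?l ?u" for x
    using that box_bump_pos_iff[of ?l ?u x] box_bump_nonneg[of ?l ?u x] box_subset_cbox[of ?l ?u] by force
  have b: "b \<in> test_functions (ball 0 1)"
  proof -
    have "C_k k b" for k
      unfolding b_def by (rule C_k_mult[OF C_k_const C_k_box_bump])
    moreover have "b x = 0" if "x \<notin> cbox ?l ?u" for x
      unfolding b_def zero[OF that] by (rule mult_zero_right)
    ultimately show ?thesis
      unfolding test_functions_def using sub by (intro CollectI conjI allI exI[of _ "cbox ?l ?u"] impI compact_cbox)
  qed
  obtain K where K: "compact K" "K \<subseteq> ball 0 1" "\<And>x. x \<notin> K \<Longrightarrow> b x = 0" "continuous_on UNIV b"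
    "\<And>x e. x \<notin> K \<Longrightarrow> frechet_derivative b (at x) e = 0"
    "\<And>e. continuous_on UNIV (\<lambda>x. frechet_derivative b (at x) e)"
    using test_functionE[OF b] by metis
  define \<kappa> where "\<kappa> = measure lborel (cball (0::'a) 1)"
  have \<kappa>: "\<kappa> > 0" "emeasure lborel (cball (0::'a) 1) = ennreal \<kappa>"
    using content_cball_pos[of 1 "0::'a"] emeasure_compact_finite[OF compact_cball, of "0::'a" 1]
    unfolding \<kappa>_def by (simp_all add: emeasure_eq_ennreal_measure)
  \<comment> \<open>The normalised indicator of the closed ball is a positive constant wherever the
    bump or its derivatives live, so it dominates each of them up to a factor.\<close>
  define w :: "'a \<Rightarrow> real" where "w = (\<lambda>y. indicator (cball 0 1) y / \<kappa>)"
  have bdd: "\<exists>B. \<forall>x. \<bar>\<psi> x\<bar> \<le> B * w x" if cont: "continuous_on UNIV \<psi>" and zero: "\<And>x. x \<notin> K \<Longrightarrow> \<psi> x = 0" for \<psi> :: "'a \<Rightarrow> real"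
  proof -
    obtain B where "\<And>x. \<bar>\<psi> x\<bar> \<le> B"
      using continuous_compact_support_bounded[OF cont K(1) zero] by auto
    moreover have "K \<subseteq> cball 0 1"
      using K(2) ball_subset_cball by blast
    moreover have "w x = 1 / \<kappa>" if "x \<in> cball 0 1" for x
      using that by (simp add: w_def)
    moreover have "w x \<ge> 0" for x
      using \<kappa>(1) by (simp add: w_def)
    ultimately have "\<bar>\<psi> x\<bar> \<le> (max B 0 * \<kappa>) * w x" for x
      using zero[of x] \<kappa>(1) by (cases "x \<in> K") (fastforce simp: le_max_iff_disj)+
    then show ?thesis
      by blast
  qed
  obtain B0 where B0: "\<bar>b x\<bar> \<le> B0 * w x" for x
    using bdd[OF K(4,3)] by blast
  have "\<forall>i. \<exists>B. \<forall>x. \<bar>frechet_derivative b (at x) i\<bar> \<le> B * w x"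
    using bdd[OF K(6) K(5)] by simp
  from choice[OF this] obtain B1 where B1': "\<forall>i x. \<bar>frechet_derivative b (at x) i\<bar> \<le> B1 i * w x"
    by (elim exE)
  then have B1: "\<bar>frechet_derivative b (at x) i\<bar> \<le> B1 i * w x" for i x
    by simp
  \<comment> \<open>One constant for the kernel and all its partial derivatives; the summand 1 keeps
    it positive.\<close>
  define B where "B = 1 + \<bar>B0\<bar> + (\<Sum>i\<in>(Basis::'a set). \<bar>B1 i\<bar>)"
  have w0: "w x \<ge> 0" for x
    using \<kappa> by (simp add: w_def)
  have le: "B0 \<le> B" "i \<in> Basis \<Longrightarrow> B1 i \<le> B" "B > 0" for i :: 'a
  proof -
    have "(\<Sum>i\<in>(Basis::'a set). \<bar>B1 i\<bar>) \<ge> 0"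
      by (simp add: sum_nonneg)
    then show "B0 \<le> B" "B > 0"
      unfolding B_def by linarith+
    assume "i \<in> Basis"
    then have "\<bar>B1 i\<bar> \<le> (\<Sum>i\<in>(Basis::'a set). \<bar>B1 i\<bar>)"
      by (intro member_le_sum) auto
    then show "B1 i \<le> B"
      unfolding B_def by linarith
  qed
  have "mollifier b w B"
  proof
    show "(LINT y|lborel. b y) = 1"
      using m by (simp add: b_def m_def)
    have "indicat_real (cball 0 1) \<in> borel_measurable (borel :: 'a measure)"
      by (rule borel_measurable_indicator) (simp add: borel_closed)
    then show "w \<in> borel_measurable borel"
      unfolding w_def by (rule borel_measurable_divide[OF _ borel_measurable_const])
    show "(\<integral>\<^sup>+y. ennreal (w y) \<partial>lborel) = 1"
    proof -
      have "(\<integral>\<^sup>+y. ennreal (w y) \<partial>lborel) = (\<integral>\<^sup>+y. ennreal (1 / \<kappa>) * indicator (cball (0::'a) 1) y \<partial>lborel)"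
        by (rule nn_integral_cong) (simp add: w_def indicator_def)
      also have "\<dots> = 1"
        using \<kappa> by (simp add: nn_integral_cmult_indicator ennreal_mult[symmetric])
      finally show ?thesis .
    qed
    show "\<bar>b y\<bar> \<le> B * w y" for y
      using B0[of y] mult_right_mono[OF le(1) w0[of y]] by linarith
    show "\<bar>frechet_derivative b (at y) i\<bar> \<le> B * w y" if "i \<in> Basis" for i y
      using B1[of y i] mult_right_mono[OF le(2)[OF that] w0[of y]] by linarith
    show "w y = 0" if "norm y > 1" for y
      using that by (simp add: w_def)
  qed (fact b w0 le(3))+
  then show ?thesis
    by blast
qed

text \<open>The ball of radius \<rho> about \<open>x + \<rho> *\<^sub>R c\<close>: displacement and
  radius shrink together, so that the ball stays in a fixed cone with vertex
  \<open>x\<close>.\<close>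

definition (in mollifier) average :: "real \<Rightarrow> 'a \<Rightarrow> ('a \<Rightarrow> real) \<Rightarrow> 'a \<Rightarrow> real" where
  "average \<rho> c F x = (LINT y|lborel. b y * F (x + \<rho> *\<^sub>R (c + y)))"

text \<open>The weight of the same average as a function of the integration point \<open>z\<close>.
  In this form it is a test function, on which weak derivatives can act.\<close>

definition (in mollifier) kernel :: "real \<Rightarrow> 'a \<Rightarrow> 'a \<Rightarrow> 'a \<Rightarrow> real" where
  "kernel \<rho> c x z = (1 / \<rho>) ^ DIM('a) * b ((1 / \<rho>) *\<^sub>R (z - x) - c)"

lemma (in mollifier) b_measurable [measurable]:
  "b \<in> borel_measurable borel" "(\<lambda>y. frechet_derivative b (at y) e) \<in> borel_measurable borel"
proof -
  obtain K where "continuous_on UNIV b" "continuous_on UNIV (\<lambda>x. frechet_derivative b (at x) e)"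
    using test_functionE[OF b_test] by metis
  then show "b \<in> borel_measurable borel" "(\<lambda>y. frechet_derivative b (at y) e) \<in> borel_measurable borel"
    by (auto intro: borel_measurable_continuous_onI)
qed

text \<open>The support lies in the image of the unit ball under
  \<open>y \<mapsto> x + \<rho> *\<^sub>R (c + y)\<close>, which the cone hypothesis places in
  \<open>W\<close>. The extra factor 1/\<rho> in the derivative is the cost that reappears in the
  estimate in time.\<close>

lemma (in mollifier) kernel_test:
  assumes "\<rho> > 0" and cone: "\<And>y. norm y \<le> 1 \<Longrightarrow> x + \<rho> *\<^sub>R (c + y) \<in> W"
  shows "kernel \<rho> c x \<in> test_functions W"
    and "frechet_derivative (kernel \<rho> c x) (at z) e
      = (1 / \<rho>) ^ DIM('a) * ((1 / \<rho>) * frechet_derivative b (at ((1 / \<rho>) *\<^sub>R (z - x) - c)) e)"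
proof -
  let ?A = "\<lambda>z. (1 / \<rho>) *\<^sub>R z" and ?v = "- (1 / \<rho>) *\<^sub>R x - c"
  have eq: "kernel \<rho> c x = (\<lambda>z. (1 / \<rho>) ^ DIM('a) * b (?A z + ?v))"
    by (simp add: kernel_def fun_eq_iff algebra_simps)
  have smooth: "C_k k (kernel \<rho> c x)" for k
    unfolding eq by (intro C_k_mult C_k_const C_k_affine bounded_linear_scaleR_right test_function_smooth[OF b_test])
  obtain K where K: "compact K" "K \<subseteq> ball 0 1" "\<And>x. x \<notin> K \<Longrightarrow> b x = 0"
    and der: "\<And>x. (b has_derivative frechet_derivative b (at x)) (at x)"
    using test_functionE[OF b_test] by metis
  let ?K = "(\<lambda>y. x + \<rho> *\<^sub>R (c + y)) ` K"
  have "compact ?K"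
    using K(1) by (intro compact_continuous_image continuous_intros)
  moreover have "?K \<subseteq> W"
    using K(2) cone by (auto simp: subset_iff)
  moreover have "kernel \<rho> c x z = 0" if "z \<notin> ?K" for z
  proof -
    have "z = x + \<rho> *\<^sub>R (c + ((1 / \<rho>) *\<^sub>R (z - x) - c))"
      using \<open>\<rho> > 0\<close> by simp
    then have "(1 / \<rho>) *\<^sub>R (z - x) - c \<notin> K"
      using that by (metis image_eqI)
    then show ?thesis
      using K(3) by (simp add: kernel_def)
  qed
  ultimately show "kernel \<rho> c x \<in> test_functions W"
    using smooth unfolding test_functions_def by blast
  have "((\<lambda>z. ?A z + ?v) has_derivative (\<lambda>e. (1 / \<rho>) *\<^sub>R e)) (at z)"
    by (auto intro!: derivative_eq_intros)
  from has_derivative_compose[OF this der]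
  have "((\<lambda>z. b (?A z + ?v)) has_derivative (\<lambda>e. frechet_derivative b (at (?A z + ?v)) ((1 / \<rho>) *\<^sub>R e))) (at z)" .
  from has_derivative_mult_right[OF this, of "(1 / \<rho>) ^ DIM('a)"]
  have "frechet_derivative (kernel \<rho> c x) (at z)
      = (\<lambda>e. (1 / \<rho>) ^ DIM('a) * frechet_derivative b (at (?A z + ?v)) ((1 / \<rho>) *\<^sub>R e))"
    unfolding eq using frechet_derivative_at by metis
  moreover have "?A z + ?v = (1 / \<rho>) *\<^sub>R (z - x) - c"
    by (simp add: algebra_simps)
  moreover have "frechet_derivative b (at v) ((1 / \<rho>) *\<^sub>R e) = (1 / \<rho>) * frechet_derivative b (at v) e" for v
    using linear_scale[OF has_derivative_linear[OF der]] by (metis real_scaleR_def)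
  ultimately show "frechet_derivative (kernel \<rho> c x) (at z) e
      = (1 / \<rho>) ^ DIM('a) * ((1 / \<rho>) * frechet_derivative b (at ((1 / \<rho>) *\<^sub>R (z - x) - c)) e)"
    by (simp only:)
qed

text \<open>Substitution \<open>z = x + \<rho> *\<^sub>R (c + y)\<close>. The function
  \<open>k\<close> is left general because it is used for \<open>b\<close> and for its partial
  derivatives.\<close>

lemma (in mollifier) integral_kernel:
  fixes F k :: "'a \<Rightarrow> real" and c x :: 'a
  assumes "\<rho> > 0" and [measurable]: "F \<in> borel_measurable borel" "k \<in> borel_measurable borel"
  shows "(LINT z|lborel. (1 / \<rho>) ^ DIM('a) * k ((1 / \<rho>) *\<^sub>R (z - x) - c) * F z) = (LINT y|lborel. k y * F (x + \<rho> *\<^sub>R (c + y)))"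
    and "integrable lborel (\<lambda>z. (1 / \<rho>) ^ DIM('a) * k ((1 / \<rho>) *\<^sub>R (z - x) - c) * F z) \<Longrightarrow> integrable lborel (\<lambda>y. k y * F (x + \<rho> *\<^sub>R (c + y)))"
proof -
  let ?H = "\<lambda>z. (1 / \<rho>) ^ DIM('a) * k ((1 / \<rho>) *\<^sub>R (z - x) - c) * F z"
  have H: "?H \<in> borel_measurable borel"
    by measurable
  have eq: "?H ((x + \<rho> *\<^sub>R c) + \<rho> *\<^sub>R y) = (1 / \<rho>) ^ DIM('a) * (k y * F (x + \<rho> *\<^sub>R (c + y)))" for y
    using \<open>\<rho> > 0\<close> by (simp add: algebra_simps)
  show "(LINT z|lborel. ?H z) = (LINT y|lborel. k y * F (x + \<rho> *\<^sub>R (c + y)))"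
    using \<open>\<rho> > 0\<close> unfolding integral_lborel_affine(1)[OF assms(1) H, of "x + \<rho> *\<^sub>R c"] eq by (simp add: power_one_over)
  show "integrable lborel (\<lambda>y. k y * F (x + \<rho> *\<^sub>R (c + y)))" if "integrable lborel ?H"
    using that \<open>\<rho> > 0\<close> unfolding integral_lborel_affine(2)[OF assms(1) H, of "x + \<rho> *\<^sub>R c"] eq by simp
qed

lemma (in mollifier) average_eq_kernel:
  assumes "\<rho> > 0" "F \<in> borel_measurable borel"
  shows "average \<rho> c F x = (LINT z|lborel. kernel \<rho> c x z * F z)"
  using integral_kernel(1)[OF assms b_measurable(1)] by (simp add: average_def kernel_def)

text \<open>As \<open>b\<close> has integral 1, \<open>f x\<close> minus its average is the integral
  of \<open>b\<close> against the increments of \<open>f\<close> from \<open>x\<close> to the points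
  \<open>x + \<rho> *\<^sub>R (c + y)\<close>. Each step has length at most
  \<open>\<rho> * (R + 1)\<close>, and its whole segment lies in \<open>W\<close> because the cone
  hypothesis covers every \<tau> up to \<rho>. The 4 is a 2 from the mean inequality times a 2 from
  the difference quotient.\<close>

lemma (in mollifier) average_Lp:
  assumes "open U" and [measurable]: "W \<in> sets borel" and V: "is_weak_gradient W f V"
    and [measurable]: "f \<in> borel_measurable borel" and Vm: "\<And>i. i \<in> Basis \<Longrightarrow> V i \<in> borel_measurable borel"
    and "\<rho> > 0" and c: "norm c \<le> R" and "p \<ge> 1"
    and cone: "\<And>x y \<tau>. x \<in> U \<Longrightarrow> norm y \<le> 1 \<Longrightarrow> 0 \<le> \<tau> \<Longrightarrow> \<tau> \<le> \<rho> \<Longrightarrow> x + \<tau> *\<^sub>R (c + y) \<in> W"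
  shows "(nn_integral_on U (\<lambda>x. \<bar>f x - average \<rho> c f x\<bar> powr p))
    \<le> ennreal ((4 * B * \<rho> * (R + 1)) powr p) * (nn_integral_on W (\<lambda>x. gradient_size V x powr p))"
    (is "_ \<le> _ * ?I")
proof -
  have [measurable]: "U \<in> sets borel"
    using \<open>open U\<close> by simp
  have li: "locally_integrable W f"
    using V nonempty_Basis unfolding is_weak_gradient_def weak_deriv_def by blast
  have bint: "integrable lborel b"
    using b_integral not_integrable_integral_eq by fastforce
  have pw: "ennreal (\<bar>f x - average \<rho> c f x\<bar> powr p)
      \<le> ennreal (2 powr p) * (\<integral>\<^sup>+y. ennreal (w y) * ennreal ((B * \<bar>f (x + \<rho> *\<^sub>R (c + y)) - f x\<bar>) powr p) \<partial>lborel)"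
    if "x \<in> U" for x
  proof (rule power_mean_le)
    \<comment> \<open>\<open>f\<close> is only locally integrable; its product with a test function
      on \<open>W\<close> is integrable, which is needed to write the difference as one
      integral.\<close>
    have "kernel \<rho> c x \<in> test_functions W"
      using kernel_test(1)[OF \<open>\<rho> > 0\<close>] cone[OF that] \<open>\<rho> > 0\<close> by simp
    then obtain K where "compact K" "K \<subseteq> W" "continuous_on UNIV (kernel \<rho> c x)" "\<And>z. z \<notin> K \<Longrightarrow> kernel \<rho> c x z = 0"
      using test_functionE by metis
    from set_integral_bounded_on_compact(2)[OF li this]
    have "integrable lborel (\<lambda>z. (1 / \<rho>) ^ DIM('a) * b ((1 / \<rho>) *\<^sub>R (z - x) - c) * f z)"
      by (simp add: kernel_def)
    then have "integrable lborel (\<lambda>y. b y * f (x + \<rho> *\<^sub>R (c + y)))"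
      using integral_kernel(2)[OF \<open>\<rho> > 0\<close> _ b_measurable(1)] by simp
    then have "f x - average \<rho> c f x = (LINT y|lborel. b y * f x - b y * f (x + \<rho> *\<^sub>R (c + y)))"
      using bint b_integral by (simp add: average_def)
    then have "ennreal \<bar>f x - average \<rho> c f x\<bar> = ennreal (norm (LINT y|lborel. b y * (f x - f (x + \<rho> *\<^sub>R (c + y)))))"
      by (simp add: right_diff_distrib)
    also have "\<dots> \<le> (\<integral>\<^sup>+y. ennreal (norm (b y * (f x - f (x + \<rho> *\<^sub>R (c + y))))) \<partial>lborel)"
      by (rule norm_integral_le_nn_integral)
    also have "\<dots> \<le> (\<integral>\<^sup>+y. ennreal (w y) * ennreal (B * \<bar>f (x + \<rho> *\<^sub>R (c + y)) - f x\<bar>) \<partial>lborel)"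
    proof (rule nn_integral_mono)
      fix y
      have "\<bar>b y\<bar> * \<bar>f x - f (x + \<rho> *\<^sub>R (c + y))\<bar> \<le> (B * w y) * \<bar>f x - f (x + \<rho> *\<^sub>R (c + y))\<bar>"
        by (rule mult_right_mono[OF b_le]) simp
      then show "ennreal (norm (b y * (f x - f (x + \<rho> *\<^sub>R (c + y))))) \<le> ennreal (w y) * ennreal (B * \<bar>f (x + \<rho> *\<^sub>R (c + y)) - f x\<bar>)"
        using w_nonneg B_pos by (simp add: abs_mult ennreal_mult[symmetric] abs_minus_commute mult_ac ennreal_leI)
    qed
    finally show "ennreal \<bar>f x - average \<rho> c f x\<bar> \<le> (\<integral>\<^sup>+y. ennreal (w y) * ennreal (B * \<bar>f (x + \<rho> *\<^sub>R (c + y)) - f x\<bar>) \<partial>lborel)" .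
  qed (use B_pos w_mass \<open>p \<ge> 1\<close> in auto)
  have "(nn_integral_on U (\<lambda>x. \<bar>f x - average \<rho> c f x\<bar> powr p))
    \<le> (\<integral>\<^sup>+x. ennreal (2 powr p) * (\<integral>\<^sup>+y. indicator U x * (ennreal (w y) * ennreal ((B * \<bar>f (x + \<rho> *\<^sub>R (c + y)) - f x\<bar>) powr p)) \<partial>lborel) \<partial>lborel)"
    using pw by (intro nn_integral_mono) (auto simp: indicator_def)
  also have "\<dots> = ennreal (2 powr p) * (\<integral>\<^sup>+x. \<integral>\<^sup>+y. indicator U x * (ennreal (w y) * ennreal ((B * \<bar>f (x + \<rho> *\<^sub>R (c + y)) - f x\<bar>) powr p)) \<partial>lborel \<partial>lborel)"
    by (rule nn_integral_cmult) measurable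
  also have "(\<integral>\<^sup>+x. \<integral>\<^sup>+y. indicator U x * (ennreal (w y) * ennreal ((B * \<bar>f (x + \<rho> *\<^sub>R (c + y)) - f x\<bar>) powr p)) \<partial>lborel \<partial>lborel)
    = (\<integral>\<^sup>+y. \<integral>\<^sup>+x. indicator U x * (ennreal (w y) * ennreal ((B * \<bar>f (x + \<rho> *\<^sub>R (c + y)) - f x\<bar>) powr p)) \<partial>lborel \<partial>lborel)"
    by (rule lborel_pair.Fubini') measurable
  also have "\<dots> \<le> (\<integral>\<^sup>+y. ennreal (w y) * (ennreal ((2 * B * \<rho> * (R + 1)) powr p) * ?I) \<partial>lborel)"
  proof (rule nn_integral_mono)
    fix y
    show "(\<integral>\<^sup>+x. indicator U x * (ennreal (w y) * ennreal ((B * \<bar>f (x + \<rho> *\<^sub>R (c + y)) - f x\<bar>) powr p)) \<partial>lborel)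
      \<le> ennreal (w y) * (ennreal ((2 * B * \<rho> * (R + 1)) powr p) * ?I)"
    proof (cases "norm y \<le> 1")
      case True
      let ?h = "\<rho> *\<^sub>R (c + y)"
      have "(\<integral>\<^sup>+x. indicator U x * (ennreal (w y) * ennreal ((B * \<bar>f (x + ?h) - f x\<bar>) powr p)) \<partial>lborel)
        = (\<integral>\<^sup>+x. (ennreal (w y) * ennreal (B powr p)) * (indicator U x * ennreal (\<bar>f (x + ?h) - f x\<bar> powr p)) \<partial>lborel)"
        using B_pos by (intro nn_integral_cong) (simp add: powr_mult ennreal_mult mult_ac)
      also have "\<dots> = (ennreal (w y) * ennreal (B powr p)) * (nn_integral_on U (\<lambda>x. \<bar>f (x + ?h) - f x\<bar> powr p))"
        by (rule nn_integral_cmult) measurable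
      also have "\<dots> \<le> (ennreal (w y) * ennreal (B powr p)) * (ennreal ((2 * norm ?h) powr p) * ?I)"
      proof (intro mult_left_mono difference_quotient_Lp[OF \<open>open U\<close> _ V _ Vm])
        fix x s assume xs: "x \<in> U" "s \<in> {0..1::real}"
        then show "x + s *\<^sub>R ?h \<in> W"
          using cone[OF xs(1) True, of "s * \<rho>"] \<open>\<rho> > 0\<close> by (simp add: mult_left_le_one_le)
      qed (use \<open>p \<ge> 1\<close> in auto)
      also have "\<dots> \<le> (ennreal (w y) * ennreal (B powr p)) * (ennreal ((2 * (\<rho> * (R + 1))) powr p) * ?I)"
      proof -
        have "norm (c + y) \<le> R + 1"
          using norm_triangle_ineq[of c y] c True by linarith
        then have "norm ?h \<le> \<rho> * (R + 1)"
          using \<open>\<rho> > 0\<close> by simp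
        then show ?thesis
          using \<open>p \<ge> 1\<close> by (intro mult_left_mono mult_right_mono ennreal_leI powr_mono2) auto
      qed
      also have "\<dots> = ennreal (w y) * (ennreal ((2 * B * \<rho> * (R + 1)) powr p) * ?I)"
      proof -
        have "R + 1 \<ge> 0"
          using c norm_ge_zero[of c] by linarith
        then have "(2 * B * \<rho> * (R + 1)) powr p = B powr p * (2 * (\<rho> * (R + 1))) powr p"
          using B_pos \<open>\<rho> > 0\<close> by (subst powr_mult[symmetric]) (auto simp: mult_ac)
        then show ?thesis
          by (simp only: ennreal_mult powr_ge_zero mult_ac)
      qed
      finally show ?thesis .
    next
      case False
      then show ?thesis
        using w_support[of y] by simp
    qed
  qed
  also have "\<dots> = ennreal ((2 * B * \<rho> * (R + 1)) powr p) * ?I"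
    using w_mass by (simp add: nn_integral_multc)
  finally have "(nn_integral_on U (\<lambda>x. \<bar>f x - average \<rho> c f x\<bar> powr p))
    \<le> ennreal (2 powr p) * (ennreal ((2 * B * \<rho> * (R + 1)) powr p) * ?I)"
    by (simp add: mult_left_mono)
  also have "\<dots> = ennreal ((4 * B * \<rho> * (R + 1)) powr p) * ?I"
  proof -
    have "R + 1 \<ge> 0"
      using c norm_ge_zero[of c] by linarith
    then have "(4 * B * \<rho> * (R + 1)) powr p = 2 powr p * (2 * B * \<rho> * (R + 1)) powr p"
      using B_pos \<open>\<rho> > 0\<close> by (subst powr_mult[symmetric]) (auto simp: mult.assoc)
    then show ?thesis
      by (simp add: ennreal_mult mult_ac)
  qed
  finally show ?thesis .
qed

subsection \<open>Time regularity of averages\<close>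

lemma integrable_product_kernel:
  fixes q :: "'a::euclidean_space \<times> real \<Rightarrow> real"
  assumes q: "locally_integrable (W \<times> I) q" and [measurable]: "q \<in> borel_measurable borel"
    "\<theta> \<in> borel_measurable borel" "\<eta> \<in> borel_measurable borel"
    and \<theta>: "\<And>x. \<bar>\<theta> x\<bar> \<le> B" "\<And>x. x \<notin> K \<Longrightarrow> \<theta> x = 0" and K: "compact K" "K \<subseteq> W"
    and \<eta>: "\<And>t. \<bar>\<eta> t\<bar> \<le> B'" "\<And>t. t \<notin> L \<Longrightarrow> \<eta> t = 0" and L: "compact L" "L \<subseteq> I"
  shows "integrable (lborel \<Otimes>\<^sub>M lborel) (\<lambda>(x, t). \<theta> x * \<eta> t * q (x, t))"
proof -
  have "set_integrable lborel (K \<times> L) q"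
    using q K L compact_Times unfolding locally_integrable_def by blast
  then have int: "integrable lborel (\<lambda>z. (B * B') * (indicator (K \<times> L) z *\<^sub>R q z))"
    by (simp add: set_integrable_def)
  have "integrable lborel (\<lambda>(x, t). \<theta> x * \<eta> t * q (x, t))"
  proof (rule Bochner_Integration.integrable_bound[OF int])
    show "(\<lambda>(x, t). \<theta> x * \<eta> t * q (x, t)) \<in> borel_measurable lborel"
      unfolding lborel_prod[symmetric] by measurable
    have "norm (\<theta> x * \<eta> t * q (x, t)) \<le> norm ((B * B') * (indicator (K \<times> L) (x, t) *\<^sub>R q (x, t)))" for x t
    proof (cases "x \<in> K \<and> t \<in> L")
      case True
      have "B \<ge> 0" "B' \<ge> 0"
        using \<theta>(1) \<eta>(1) by (meson abs_ge_zero order_trans)+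
      then have "\<bar>\<theta> x\<bar> * \<bar>\<eta> t\<bar> \<le> \<bar>B * B'\<bar>"
        using mult_mono[OF \<theta>(1) \<eta>(1)] by (simp add: abs_mult)
      then show ?thesis
        using True by (simp add: abs_mult mult_right_mono)
    next
      case False
      then have "\<theta> x * \<eta> t * q (x, t) = 0"
        using \<theta>(2) \<eta>(2) by auto
      then show ?thesis
        by (simp only: norm_zero norm_ge_zero)
    qed
    then show "AE z in lborel. norm (case z of (x, t) \<Rightarrow> \<theta> x * \<eta> t * q (x, t))
        \<le> norm ((B * B') * (indicator (K \<times> L) z *\<^sub>R q z))"
      by (intro AE_I2) (auto simp: split_beta)
  qed
  then show ?thesis
    by (simp add: lborel_prod)
qed

text \<open>Reduces statements on the cylinder to functions of time alone: the product of \<theta>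
  and \<eta> is bounded with compact support in the cylinder, so pairing with it splits by Fubini's
  theorem.\<close>

lemma slice_integral:
  fixes q :: "'a::euclidean_space \<times> real \<Rightarrow> real"
  assumes q: "locally_integrable (W \<times> I) q" and [measurable]: "q \<in> borel_measurable borel" and "open I"
    and \<theta>: "continuous_on UNIV \<theta>" "\<And>x. x \<notin> K \<Longrightarrow> \<theta> x = 0" and K: "compact K" "K \<subseteq> W"
  shows "(\<lambda>t. LINT x|lborel. \<theta> x * q (x, t)) \<in> borel_measurable borel"
    and "locally_integrable I (\<lambda>t. LINT x|lborel. \<theta> x * q (x, t))"
    and "\<lbrakk>continuous_on UNIV \<eta>; compact L; L \<subseteq> I; \<And>t. t \<notin> L \<Longrightarrow> \<eta> t = 0\<rbrakk>
      \<Longrightarrow> (LINT t|lborel. \<eta> t * (LINT x|lborel. \<theta> x * q (x, t))) = (LINT z|lborel. \<theta> (fst z) * \<eta> (snd z) * q z)"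
proof -
  have [measurable]: "\<theta> \<in> borel_measurable borel" "I \<in> sets borel"
    using \<theta>(1) \<open>open I\<close> by (auto intro: borel_measurable_continuous_onI)
  show meas [measurable]: "(\<lambda>t. LINT x|lborel. \<theta> x * q (x, t)) \<in> borel_measurable borel"
    by measurable
  obtain B where B: "\<And>x. \<bar>\<theta> x\<bar> \<le> B"
    using continuous_compact_support_bounded[OF \<theta>(1) K(1) \<theta>(2)] by auto
  have eq: "(LINT x|lborel. \<theta> x * \<eta> t * q (x, t)) = \<eta> t * (LINT x|lborel. \<theta> x * q (x, t))" for \<eta> :: "real \<Rightarrow> real" and t
    by (subst integral_mult_right_zero[symmetric]) (simp add: mult_ac)
  show "locally_integrable I (\<lambda>t. LINT x|lborel. \<theta> x * q (x, t))"
    unfolding locally_integrable_def set_borel_measurable_def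
  proof (intro conjI allI impI)
    fix L assume L: "compact L \<and> L \<subseteq> I"
    then have [measurable]: "L \<in> sets borel"
      by (simp add: borel_compact)
    have "integrable (lborel \<Otimes>\<^sub>M lborel) (\<lambda>(x, t). \<theta> x * indicat_real L t * q (x, t))"
      by (rule integrable_product_kernel[OF q _ _ _ B \<theta>(2) K, where B' = 1 and L = L])
        (use L in \<open>auto simp: indicator_def\<close>)
    from lborel_pair.integrable_snd[OF this]
    show "set_integrable lborel L (\<lambda>t. LINT x|lborel. \<theta> x * q (x, t))"
      unfolding set_integrable_def eq by simp
  qed measurable
  assume \<eta>: "continuous_on UNIV \<eta>" "compact L" "L \<subseteq> I" "\<And>t. t \<notin> L \<Longrightarrow> \<eta> t = 0"
  have [measurable]: "\<eta> \<in> borel_measurable borel"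
    using \<eta>(1) by (rule borel_measurable_continuous_onI)
  obtain B' where B': "\<And>t. \<bar>\<eta> t\<bar> \<le> B'"
    using continuous_compact_support_bounded[OF \<eta>(1,2,4)] by auto
  have "integrable (lborel \<Otimes>\<^sub>M lborel) (\<lambda>(x, t). \<theta> x * \<eta> t * q (x, t))"
    by (rule integrable_product_kernel[OF q _ _ _ B \<theta>(2) K B' \<eta>(4,2,3)]) measurable
  from lborel_pair.integral_snd[OF this]
  have "(LINT t|lborel. LINT x|lborel. \<theta> x * \<eta> t * q (x, t)) = integral\<^sup>L lborel (\<lambda>(x, t). \<theta> x * \<eta> t * q (x, t))"
    by (simp add: lborel_prod)
  then show "(LINT t|lborel. \<eta> t * (LINT x|lborel. \<theta> x * q (x, t))) = (LINT z|lborel. \<theta> (fst z) * \<eta> (snd z) * q z)"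
    unfolding eq by (simp add: case_prod_unfold)
qed

lemma locally_integrable_uminus: "locally_integrable U f \<Longrightarrow> locally_integrable U (\<lambda>x. - f x :: real)"
  using locally_integrable_sum[of "{()}" U "\<lambda>_. f" "\<lambda>_. -1"] by simp

text \<open>The weak formulation of \<open>\<partial>\<^sub>t f = \<partial>\<^sub>i D\<close>, satisfied by \<open>f = \<partial>\<^sub>i u\<close> and \<open>D = \<partial>\<^sub>t u\<close>.\<close>

definition weak_time_relation ::
    "'a::euclidean_space set \<Rightarrow> real set \<Rightarrow> 'a \<Rightarrow> ('a \<times> real \<Rightarrow> real) \<Rightarrow> ('a \<times> real \<Rightarrow> real) \<Rightarrow> bool" where
  "weak_time_relation W I i f D \<longleftrightarrow> (\<forall>\<psi>\<in>test_functions W. \<forall>\<zeta>\<in>test_functions I.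
     (LINT z|lborel. \<psi> (fst z) * frechet_derivative \<zeta> (at (snd z)) 1 * f z)
       = (LINT z|lborel. frechet_derivative \<psi> (at (fst z)) i * \<zeta> (snd z) * D z))"

text \<open>Although \<open>f\<close> need not have a time derivative, its pairing with \<psi> has
  one: by the relation, the derivative in direction \<open>i\<close> falls on \<psi>. The result is
  phrased as a weak gradient over the real line, whose only basis vector is 1, so that the increment
  estimates apply in the time variable.\<close>

lemma slice_weak_gradient:
  fixes f D :: "'a::euclidean_space \<times> real \<Rightarrow> real"
  assumes f: "locally_integrable (W \<times> I) f" "f \<in> borel_measurable borel"
    and D: "locally_integrable (W \<times> I) D" "D \<in> borel_measurable borel" and "open I"
    and rel: "weak_time_relation W I i f D" and \<psi>: "\<psi> \<in> test_functions W"
  shows "is_weak_gradient I (\<lambda>t. LINT x|lborel. \<psi> x * f (x, t))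
    (\<lambda>_ t. - (LINT x|lborel. frechet_derivative \<psi> (at x) i * D (x, t)))"
proof -
  obtain K where K: "compact K" "K \<subseteq> W" and \<psi>K: "continuous_on UNIV \<psi>" "\<And>x. x \<notin> K \<Longrightarrow> \<psi> x = 0"
    and \<psi>'K: "continuous_on UNIV (\<lambda>x. frechet_derivative \<psi> (at x) i)" "\<And>x. x \<notin> K \<Longrightarrow> frechet_derivative \<psi> (at x) i = 0"
    using test_functionE[OF \<psi>] by metis
  have A: "locally_integrable I (\<lambda>t. LINT x|lborel. \<psi> x * f (x, t))"
    by (rule slice_integral(2)[OF f \<open>open I\<close> _ _ K]) (use \<psi>K in auto)
  have E: "locally_integrable I (\<lambda>t. LINT x|lborel. frechet_derivative \<psi> (at x) i * D (x, t))"
    by (rule slice_integral(2)[OF D \<open>open I\<close> _ _ K]) (use \<psi>'K in auto)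
  have "weak_deriv I 1 (\<lambda>t. LINT x|lborel. \<psi> x * f (x, t))
      (\<lambda>t. - (LINT x|lborel. frechet_derivative \<psi> (at x) i * D (x, t)))"
    unfolding weak_deriv_def
  proof (intro conjI ballI A locally_integrable_uminus E)
    fix \<zeta> assume \<zeta>: "\<zeta> \<in> test_functions I"
    obtain L where L: "compact L" "L \<subseteq> I" and \<zeta>L: "continuous_on UNIV \<zeta>" "\<And>x. x \<notin> L \<Longrightarrow> \<zeta> x = 0"
      and \<zeta>'L: "continuous_on UNIV (\<lambda>x. frechet_derivative \<zeta> (at x) 1)" "\<And>x. x \<notin> L \<Longrightarrow> frechet_derivative \<zeta> (at x) 1 = 0"
      using test_functionE[OF \<zeta>] by metis
    have "(LINT t:I|lborel. frechet_derivative \<zeta> (at t) 1 *\<^sub>R (LINT x|lborel. \<psi> x * f (x, t)))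
        = (LINT z|lborel. \<psi> (fst z) * frechet_derivative \<zeta> (at (snd z)) 1 * f z)"
      by (subst set_integral_bounded_on_compact(3)[OF A L \<zeta>'L(1)])
        (use slice_integral(3)[OF f \<open>open I\<close> \<psi>K(1) _ K, of "\<lambda>t. frechet_derivative \<zeta> (at t) 1" L] \<psi>K \<zeta>'L L in auto)
    also have "\<dots> = (LINT z|lborel. frechet_derivative \<psi> (at (fst z)) i * \<zeta> (snd z) * D z)"
      using rel \<psi> \<zeta> by (simp add: weak_time_relation_def)
    also have "\<dots> = (LINT t|lborel. \<zeta> t * (LINT x|lborel. frechet_derivative \<psi> (at x) i * D (x, t)))"
      by (rule slice_integral(3)[OF D \<open>open I\<close> _ _ K, symmetric]) (use \<psi>'K \<zeta>L L in auto)
    also have "\<dots> = - (LINT t:I|lborel. \<zeta> t *\<^sub>R - (LINT x|lborel. frechet_derivative \<psi> (at x) i * D (x, t)))"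
      by (subst set_integral_bounded_on_compact(3)[OF locally_integrable_uminus[OF E] L \<zeta>L(1)])
        (use \<zeta>L in auto)
    finally show "(LINT t:I|lborel. frechet_derivative \<zeta> (at t) 1 *\<^sub>R (LINT x|lborel. \<psi> x * f (x, t)))
      = - (LINT t:I|lborel. \<zeta> t *\<^sub>R - (LINT x|lborel. frechet_derivative \<psi> (at x) i * D (x, t)))" .
  qed
  then show ?thesis
    by (simp add: is_weak_gradient_def)
qed

text \<open>For fixed \<open>x\<close> the averaging kernel plays the role of \<psi>. An increment
  over time \<open>h\<close> contributes the factor \<open>h\<close>, the derivative of the kernel
  the factor 1/\<rho>, and that derivative is then dominated by the density
  \<open>w\<close>.\<close>

lemma (in mollifier) average_time_difference:
  fixes f D :: "'a \<times> real \<Rightarrow> real" and h T :: real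
  assumes f: "locally_integrable (W \<times> {0<..<T}) f" and fm [measurable]: "f \<in> borel_measurable borel"
    and D: "locally_integrable (W \<times> {0<..<T}) D" and Dm [measurable]: "D \<in> borel_measurable borel"
    and rel: "weak_time_relation W {0<..<T} i f D" and i: "i \<in> Basis"
    and "\<rho> > 0" "h > 0" and cone: "\<And>y. norm y \<le> 1 \<Longrightarrow> x + \<rho> *\<^sub>R (c + y) \<in> W"
  shows "AE t in lborel. t \<in> {0<..<T - h} \<longrightarrow>
    ennreal \<bar>average \<rho> c (\<lambda>x. f (x, t + h)) x - average \<rho> c (\<lambda>x. f (x, t)) x\<bar>
    \<le> (\<integral>\<^sup>+s. indicator {0..1} s * (\<integral>\<^sup>+y. ennreal (w y) * ennreal (h * B / \<rho> * \<bar>D (x + \<rho> *\<^sub>R (c + y), t + s * h)\<bar>) \<partial>lborel) \<partial>lborel)"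
proof -
  let ?k = "kernel \<rho> c x"
  define A where "A t = (LINT z|lborel. ?k z * f (z, t))" for t
  define E where "E t = (LINT z|lborel. frechet_derivative ?k (at z) i * D (z, t))" for t
  have k: "?k \<in> test_functions W"
    using kernel_test(1)[OF \<open>\<rho> > 0\<close> cone] .
  have k': "frechet_derivative ?k (at z) i
      = (1 / \<rho>) ^ DIM('a) * ((1 / \<rho>) * frechet_derivative b (at ((1 / \<rho>) *\<^sub>R (z - x) - c)) i)" for z
    by (rule kernel_test(2)[OF \<open>\<rho> > 0\<close> cone])
  have A: "A t = average \<rho> c (\<lambda>x. f (x, t)) x" for t
    using average_eq_kernel[OF \<open>\<rho> > 0\<close>, of "\<lambda>x. f (x, t)" c x] by (simp add: A_def)
  have E: "E t = (1 / \<rho>) * (LINT y|lborel. frechet_derivative b (at y) i * D (x + \<rho> *\<^sub>R (c + y), t))" for t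
  proof -
    have "E t = (LINT z|lborel. (1 / \<rho>) * ((1 / \<rho>) ^ DIM('a) * frechet_derivative b (at ((1 / \<rho>) *\<^sub>R (z - x) - c)) i * D (z, t)))"
      unfolding E_def k' by (simp only: mult_ac)
    also have "\<dots> = (1 / \<rho>) * (LINT z|lborel. (1 / \<rho>) ^ DIM('a) * frechet_derivative b (at ((1 / \<rho>) *\<^sub>R (z - x) - c)) i * D (z, t))"
      by (rule integral_mult_right_zero)
    also have "(LINT z|lborel. (1 / \<rho>) ^ DIM('a) * frechet_derivative b (at ((1 / \<rho>) *\<^sub>R (z - x) - c)) i * D (z, t))
        = (LINT y|lborel. frechet_derivative b (at y) i * D (x + \<rho> *\<^sub>R (c + y), t))"
      by (rule integral_kernel(1)[OF \<open>\<rho> > 0\<close>, of "\<lambda>z. D (z, t)" "\<lambda>y. frechet_derivative b (at y) i"]) measurable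
    finally show ?thesis .
  qed
  have [measurable]: "A \<in> borel_measurable borel" "E \<in> borel_measurable borel"
    unfolding A[abs_def] average_def E[abs_def] by measurable
  have Ele: "ennreal \<bar>E t\<bar> \<le> (\<integral>\<^sup>+y. ennreal (w y) * ennreal (B / \<rho> * \<bar>D (x + \<rho> *\<^sub>R (c + y), t)\<bar>) \<partial>lborel)" for t
  proof -
    let ?F = "\<lambda>y. (1 / \<rho>) * (frechet_derivative b (at y) i * D (x + \<rho> *\<^sub>R (c + y), t))"
    have "ennreal \<bar>E t\<bar> = ennreal (norm (LINT y|lborel. ?F y))"
      unfolding E integral_mult_right_zero by simp
    also have "\<dots> \<le> (\<integral>\<^sup>+y. ennreal (norm (?F y)) \<partial>lborel)"
      by (rule norm_integral_le_nn_integral)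
    also have "\<dots> \<le> (\<integral>\<^sup>+y. ennreal (w y) * ennreal (B / \<rho> * \<bar>D (x + \<rho> *\<^sub>R (c + y), t)\<bar>) \<partial>lborel)"
    proof (rule nn_integral_mono)
      fix y
      have "\<bar>frechet_derivative b (at y) i\<bar> * \<bar>D (x + \<rho> *\<^sub>R (c + y), t)\<bar> \<le> (B * w y) * \<bar>D (x + \<rho> *\<^sub>R (c + y), t)\<bar>"
        by (rule mult_right_mono[OF b_derivative_le[OF i]]) simp
      then have "norm (?F y) \<le> w y * (B / \<rho> * \<bar>D (x + \<rho> *\<^sub>R (c + y), t)\<bar>)"
        using \<open>\<rho> > 0\<close> by (simp add: abs_mult field_simps)
      then show "ennreal (norm (?F y)) \<le> ennreal (w y) * ennreal (B / \<rho> * \<bar>D (x + \<rho> *\<^sub>R (c + y), t)\<bar>)"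
        using w_nonneg B_pos \<open>\<rho> > 0\<close> by (subst ennreal_mult[symmetric]) (auto intro!: ennreal_leI)
    qed
    finally show ?thesis .
  qed
  have "is_weak_gradient {0<..<T} A (\<lambda>_ t. - E t)"
    unfolding A_def E_def by (rule slice_weak_gradient[OF f fm D Dm _ rel k]) simp
  \<comment> \<open>The segment estimate in dimension one: the segment from \<open>t\<close> to
    \<open>t + h\<close> stays in the time interval when \<open>t < T - h\<close>.\<close>
  then have "AE t in lborel. t \<in> {0<..<T - h} \<longrightarrow> ennreal \<bar>A (t + h) - A t\<bar>
    \<le> (nn_integral_on {0..1} (\<lambda>s. norm h * gradient_size (\<lambda>_ t. - E t) (t + s *\<^sub>R h)))"
  proof (rule difference_le_segment_integral[rotated])
    fix t s assume "t \<in> {0<..<T - h}" "s \<in> {0..1::real}"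
    moreover from this have "0 \<le> s * h" "s * h \<le> h"
      using \<open>h > 0\<close> by (auto simp: mult_left_le_one_le)
    ultimately show "t + s *\<^sub>R h \<in> {0<..<T}"
      by auto
  qed auto
  then show ?thesis
  proof eventually_elim
    case (elim t)
    show ?case
    proof
      assume "t \<in> {0<..<T - h}"
      then have "ennreal \<bar>average \<rho> c (\<lambda>x. f (x, t + h)) x - average \<rho> c (\<lambda>x. f (x, t)) x\<bar>
        \<le> (nn_integral_on {0..1} (\<lambda>s. h * \<bar>E (t + s * h)\<bar>))"
        using elim \<open>h > 0\<close> by (simp add: A gradient_size_def)
      also have "\<dots> \<le> (\<integral>\<^sup>+s. indicator {0..1} s * (\<integral>\<^sup>+y. ennreal (w y) * ennreal (h * B / \<rho> * \<bar>D (x + \<rho> *\<^sub>R (c + y), t + s * h)\<bar>) \<partial>lborel) \<partial>lborel)"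
      proof (intro nn_integral_mono mult_left_mono)
        fix s
        have "ennreal (h * \<bar>E (t + s * h)\<bar>) = ennreal h * ennreal \<bar>E (t + s * h)\<bar>"
          using \<open>h > 0\<close> by (simp add: ennreal_mult)
        also have "\<dots> \<le> ennreal h * (\<integral>\<^sup>+y. ennreal (w y) * ennreal (B / \<rho> * \<bar>D (x + \<rho> *\<^sub>R (c + y), t + s * h)\<bar>) \<partial>lborel)"
          by (intro mult_left_mono Ele) simp
        also have "\<dots> = (\<integral>\<^sup>+y. ennreal h * (ennreal (w y) * ennreal (B / \<rho> * \<bar>D (x + \<rho> *\<^sub>R (c + y), t + s * h)\<bar>)) \<partial>lborel)"
          by (rule nn_integral_cmult[symmetric]) measurable
        also have "\<dots> = (\<integral>\<^sup>+y. ennreal (w y) * ennreal (h * B / \<rho> * \<bar>D (x + \<rho> *\<^sub>R (c + y), t + s * h)\<bar>) \<partial>lborel)"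
          using \<open>h > 0\<close> \<open>\<rho> > 0\<close> B_pos w_nonneg
          by (intro nn_integral_cong) (simp add: ennreal_mult[symmetric] mult_ac)
        finally show "ennreal (h * \<bar>E (t + s * h)\<bar>)
          \<le> (\<integral>\<^sup>+y. ennreal (w y) * ennreal (h * B / \<rho> * \<bar>D (x + \<rho> *\<^sub>R (c + y), t + s * h)\<bar>) \<partial>lborel)" .
      qed simp
      finally show "ennreal \<bar>average \<rho> c (\<lambda>x. f (x, t + h)) x - average \<rho> c (\<lambda>x. f (x, t)) x\<bar>
        \<le> (\<integral>\<^sup>+s. indicator {0..1} s * (\<integral>\<^sup>+y. ennreal (w y) * ennreal (h * B / \<rho> * \<bar>D (x + \<rho> *\<^sub>R (c + y), t + s * h)\<bar>) \<partial>lborel) \<partial>lborel)" .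
    qed
  qed
qed

text \<open>The pointwise bound is a mean jointly in \<open>s\<close> and \<open>y\<close>, with a
  weight of total mass 1 on the product space; the mean inequality is applied there once, and
  translation invariance in \<open>x\<close> does the rest.\<close>

lemma (in mollifier) average_time_difference_Lp:
  fixes f D :: "'a \<times> real \<Rightarrow> real" and h T :: real
  assumes f: "locally_integrable (W \<times> {0<..<T}) f" and fm [measurable]: "f \<in> borel_measurable borel"
    and D: "locally_integrable (W \<times> {0<..<T}) D" and Dm [measurable]: "D \<in> borel_measurable borel"
    and rel: "weak_time_relation W {0<..<T} i f D" and i: "i \<in> Basis"
    and "open U" and Wm [measurable]: "W \<in> sets borel" and "\<rho> > 0" "h > 0" "p \<ge> 1"
    and cone: "\<And>x y. x \<in> U \<Longrightarrow> norm y \<le> 1 \<Longrightarrow> x + \<rho> *\<^sub>R (c + y) \<in> W"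
  shows "AE t in lborel. t \<in> {0<..<T - h} \<longrightarrow>
    (nn_integral_on U (\<lambda>x. \<bar>average \<rho> c (\<lambda>x. f (x, t + h)) x - average \<rho> c (\<lambda>x. f (x, t)) x\<bar> powr p))
    \<le> ennreal ((2 * h * B / \<rho>) powr p) *
      (\<integral>\<^sup>+s. indicator {0..1} s * (nn_integral_on W (\<lambda>z. \<bar>D (z, t + s * h)\<bar> powr p)) \<partial>lborel)"
proof -
  have [measurable]: "U \<in> sets borel"
    using \<open>open U\<close> by simp
  define \<Delta> where "\<Delta> x t = \<bar>average \<rho> c (\<lambda>x. f (x, t + h)) x - average \<rho> c (\<lambda>x. f (x, t)) x\<bar>" for x t
  have [measurable]: "(\<lambda>z. \<Delta> (fst z) (snd z)) \<in> borel_measurable (lborel \<Otimes>\<^sub>M lborel)"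
    "(\<lambda>x. \<Delta> x t) \<in> borel_measurable borel" for t
    unfolding \<Delta>_def average_def by measurable
  define R where "R x t = (\<integral>\<^sup>+s. indicator {0..1} s * (\<integral>\<^sup>+y. ennreal (w y) * ennreal (h * B / \<rho> * \<bar>D (x + \<rho> *\<^sub>R (c + y), t + s * h)\<bar>) \<partial>lborel) \<partial>lborel)" for x t
  have [measurable]: "(\<lambda>z. R (fst z) (snd z)) \<in> borel_measurable (lborel \<Otimes>\<^sub>M lborel)"
    unfolding R_def by measurable
  have "AE x in lborel. AE t in lborel. x \<in> U \<longrightarrow> t \<in> {0<..<T - h} \<longrightarrow> ennreal (\<Delta> x t) \<le> R x t"
  proof (rule AE_I2)
    fix x :: 'a
    show "AE t in lborel. x \<in> U \<longrightarrow> t \<in> {0<..<T - h} \<longrightarrow> ennreal (\<Delta> x t) \<le> R x t"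
    proof (cases "x \<in> U")
      case True
      show ?thesis
        using average_time_difference[OF f fm D Dm rel i \<open>\<rho> > 0\<close> \<open>h > 0\<close> cone[OF True]]
        unfolding \<Delta>_def R_def by simp
    qed simp
  qed
  \<comment> \<open>The exceptional set of times depends on \<open>x\<close>; joint measurability of
    both sides allows the two almost-everywhere quantifiers to be exchanged.\<close>
  then have "AE t in lborel. AE x in lborel. x \<in> U \<longrightarrow> t \<in> {0<..<T - h} \<longrightarrow> ennreal (\<Delta> x t) \<le> R x t"
    by (subst (asm) lborel_pair.AE_commute) measurable
  then show ?thesis
  proof eventually_elim
    case (elim t)
    show ?case
    proof
      assume t: "t \<in> {0<..<T - h}"
      let ?w = "\<lambda>z. indicator {0..1} (fst z) * ennreal (w (snd z)) :: ennreal"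
      let ?F = "\<lambda>x z. h * B / \<rho> * \<bar>D (x + \<rho> *\<^sub>R (c + snd z), t + fst z * h)\<bar>"
      let ?P = "lborel \<Otimes>\<^sub>M lborel :: (real \<times> 'a) measure"
      have mass: "(\<integral>\<^sup>+z. ?w z \<partial>?P) \<le> 1"
        by (subst lborel.nn_integral_fst[symmetric]) (auto simp: nn_integral_cmult w_mass)
      have R: "R x t = (\<integral>\<^sup>+z. ?w z * ennreal (?F x z) \<partial>?P)" for x
        unfolding R_def by (subst lborel.nn_integral_fst[symmetric]) (auto simp: nn_integral_cmult[symmetric] mult_ac)
      have "AE x in lborel. indicator U x * ennreal (\<Delta> x t powr p)
        \<le> indicator U x * (ennreal (2 powr p) * (\<integral>\<^sup>+z. ?w z * ennreal (?F x z powr p) \<partial>?P))"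
        using elim
      proof eventually_elim
        case (elim x)
        show ?case
        proof (cases "x \<in> U")
          case True
          have "ennreal (\<Delta> x t powr p) \<le> ennreal (2 powr p) * (\<integral>\<^sup>+z. ?w z * ennreal (?F x z powr p) \<partial>?P)"
          proof (rule power_mean_le[OF _ _ mass \<open>p \<ge> 1\<close>])
            show "ennreal (\<Delta> x t) \<le> (\<integral>\<^sup>+z. ?w z * ennreal (?F x z) \<partial>?P)"
              using elim True t R by simp
          qed (use \<open>\<rho> > 0\<close> \<open>h > 0\<close> B_pos in \<open>auto simp: \<Delta>_def\<close>)
          then show ?thesis
            by (simp add: mult_left_mono)
        qed simp
      qed
      then have "(nn_integral_on U (\<lambda>x. \<Delta> x t powr p))
        \<le> (\<integral>\<^sup>+x. indicator U x * (ennreal (2 powr p) * (\<integral>\<^sup>+z. ?w z * ennreal (?F x z powr p) \<partial>?P)) \<partial>lborel)"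
        by (rule nn_integral_mono_AE)
      also have "\<dots> = ennreal (2 powr p) * (\<integral>\<^sup>+x. \<integral>\<^sup>+z. indicator U x * (?w z * ennreal (?F x z powr p)) \<partial>?P \<partial>lborel)"
        by (simp add: nn_integral_cmult mult.left_commute[of _ "ennreal (2 powr p)"])
      also have "(\<integral>\<^sup>+x. \<integral>\<^sup>+z. indicator U x * (?w z * ennreal (?F x z powr p)) \<partial>?P \<partial>lborel)
        = (\<integral>\<^sup>+z. \<integral>\<^sup>+x. indicator U x * (?w z * ennreal (?F x z powr p)) \<partial>lborel \<partial>?P)"
        unfolding lborel_prod by (rule lborel_pair.Fubini') (unfold lborel_prod[symmetric], measurable)
      also have "\<dots> \<le> (\<integral>\<^sup>+z. ennreal ((h * B / \<rho>) powr p) * (ennreal (w (snd z)) * (indicator {0..1} (fst z) * (nn_integral_on W (\<lambda>x. \<bar>D (x, t + fst z * h)\<bar> powr p)))) \<partial>?P)"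
      proof (rule nn_integral_mono)
        fix z :: "real \<times> 'a"
        let ?v = "\<rho> *\<^sub>R (c + snd z)"
        show "(\<integral>\<^sup>+x. indicator U x * (?w z * ennreal (?F x z powr p)) \<partial>lborel)
          \<le> ennreal ((h * B / \<rho>) powr p) * (ennreal (w (snd z)) * (indicator {0..1} (fst z) * (nn_integral_on W (\<lambda>x. \<bar>D (x, t + fst z * h)\<bar> powr p))))"
        proof (cases "norm (snd z) \<le> 1")
          case True
          have "(\<integral>\<^sup>+x. indicator U x * (?w z * ennreal (?F x z powr p)) \<partial>lborel)
            \<le> (\<integral>\<^sup>+x. (?w z * ennreal ((h * B / \<rho>) powr p)) * (indicator W (x + ?v) * ennreal (\<bar>D (x + ?v, t + fst z * h)\<bar> powr p)) \<partial>lborel)"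
          proof (rule nn_integral_mono)
            fix x
            have "?F x z powr p = (h * B / \<rho>) powr p * \<bar>D (x + ?v, t + fst z * h)\<bar> powr p"
              using \<open>\<rho> > 0\<close> \<open>h > 0\<close> B_pos by (subst powr_mult) auto
            then show "indicator U x * (?w z * ennreal (?F x z powr p))
              \<le> (?w z * ennreal ((h * B / \<rho>) powr p)) * (indicator W (x + ?v) * ennreal (\<bar>D (x + ?v, t + fst z * h)\<bar> powr p))"
              using cone[OF _ True, of x] by (cases "x \<in> U") (simp_all add: ennreal_mult mult_ac)
          qed
          also have "\<dots> = (?w z * ennreal ((h * B / \<rho>) powr p)) * (\<integral>\<^sup>+x. indicator W (x + ?v) * ennreal (\<bar>D (x + ?v, t + fst z * h)\<bar> powr p) \<partial>lborel)"
            by (rule nn_integral_cmult) measurable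
          also have "(\<integral>\<^sup>+x. indicator W (x + ?v) * ennreal (\<bar>D (x + ?v, t + fst z * h)\<bar> powr p) \<partial>lborel)
            = (nn_integral_on W (\<lambda>x. \<bar>D (x, t + fst z * h)\<bar> powr p))"
            by (rule nn_integral_lborel_shift[of "\<lambda>x. indicator W x * ennreal (\<bar>D (x, t + fst z * h)\<bar> powr p)"]) measurable
          finally show ?thesis
            by (simp add: mult_ac)
        next
          case False
          then show ?thesis
            using w_support[of "snd z"] by simp
        qed
      qed
      also have "\<dots> = ennreal ((h * B / \<rho>) powr p) * (\<integral>\<^sup>+z. ennreal (w (snd z)) * (indicator {0..1} (fst z) * (nn_integral_on W (\<lambda>x. \<bar>D (x, t + fst z * h)\<bar> powr p))) \<partial>?P)"
        by (rule nn_integral_cmult) measurable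
      also have "(\<integral>\<^sup>+z. ennreal (w (snd z)) * (indicator {0..1} (fst z) * (nn_integral_on W (\<lambda>x. \<bar>D (x, t + fst z * h)\<bar> powr p))) \<partial>?P)
        = (\<integral>\<^sup>+s. indicator {0..1} s * (nn_integral_on W (\<lambda>x. \<bar>D (x, t + s * h)\<bar> powr p)) \<partial>lborel)"
        by (subst lborel.nn_integral_fst[symmetric]) (simp_all add: nn_integral_multc w_mass)
      finally have "(nn_integral_on U (\<lambda>x. \<Delta> x t powr p))
        \<le> ennreal (2 powr p) * (ennreal ((h * B / \<rho>) powr p) * (\<integral>\<^sup>+s. indicator {0..1} s * (nn_integral_on W (\<lambda>z. \<bar>D (z, t + s * h)\<bar> powr p)) \<partial>lborel))"
        by (simp add: mult_left_mono)
      also have "\<dots> = ennreal ((2 * h * B / \<rho>) powr p) * (\<integral>\<^sup>+s. indicator {0..1} s * (nn_integral_on W (\<lambda>z. \<bar>D (z, t + s * h)\<bar> powr p)) \<partial>lborel)"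
      proof -
        have "(2 * h * B / \<rho>) powr p = 2 powr p * (h * B / \<rho>) powr p"
          using B_pos \<open>\<rho> > 0\<close> \<open>h > 0\<close> by (subst powr_mult[symmetric]) (auto simp: mult.assoc)
        then show ?thesis
          by (simp add: ennreal_mult mult.assoc)
      qed
      finally show "(nn_integral_on U (\<lambda>x. \<bar>average \<rho> c (\<lambda>x. f (x, t + h)) x - average \<rho> c (\<lambda>x. f (x, t)) x\<bar> powr p))
        \<le> ennreal ((2 * h * B / \<rho>) powr p) *
          (\<integral>\<^sup>+s. indicator {0..1} s * (nn_integral_on W (\<lambda>z. \<bar>D (z, t + s * h)\<bar> powr p)) \<partial>lborel)"
        unfolding \<Delta>_def .
    qed
  qed
qed

subsection \<open>Translations in time\<close>

text \<open>What is kept of the problem for one component of the gradient. \<open>m\<close> and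
  \<open>n\<close> stand for the slice norms but are Borel functions with one-sided bounds, so that
  no measurability of norms has to be discussed; \<open>m\<close> controls both the gradient of a
  slice in \<open>L\<^sup>p\<close> and the slice in \<open>L\<^sup>q\<close>. The gradients of the
  slices are chosen separately for each time, because only their norms enter.\<close>

locale parabolic_pair =
  fixes W :: "'a::euclidean_space set" and T p q :: real and i :: 'a
    and f D :: "'a \<times> real \<Rightarrow> real" and m n :: "real \<Rightarrow> real"
  assumes open_W: "open W" and i_Basis: "i \<in> Basis"
    and p_gt: "p > 1" and p_less: "p < 2" and q_def: "q = real DIM('a) * p / (real DIM('a) - p)"
    and q_ge: "q \<ge> 2" and dim: "DIM('a) \<ge> 2"
    and f_measurable [measurable]: "f \<in> borel_measurable borel"
    and D_measurable [measurable]: "D \<in> borel_measurable borel"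
    and f_local: "locally_integrable (W \<times> {0<..<T}) f" and D_local: "locally_integrable (W \<times> {0<..<T}) D"
    and relation: "weak_time_relation W {0<..<T} i f D"
    and m_measurable [measurable]: "m \<in> borel_measurable borel" and m_nonneg: "m t \<ge> 0"
    and n_measurable [measurable]: "n \<in> borel_measurable borel" and n_nonneg: "n t \<ge> 0"
    and f_gradient: "AE t in lborel. t \<in> {0<..<T} \<longrightarrow> (\<exists>V. is_weak_gradient W (\<lambda>x. f (x, t)) V \<and>
      (\<forall>j\<in>Basis. V j \<in> borel_measurable borel) \<and>
      (nn_integral_on W (\<lambda>x. gradient_size V x powr p)) \<le> ennreal (m t powr p))"
    and f_Lq: "AE t in lborel. t \<in> {0<..<T} \<longrightarrow>
      (nn_integral_on W (\<lambda>x. \<bar>f (x, t)\<bar> powr q)) \<le> ennreal (m t powr q)"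
    and D_Lp: "AE t in lborel. t \<in> {0<..<T} \<longrightarrow>
      (nn_integral_on W (\<lambda>x. \<bar>D (x, t)\<bar> powr p)) \<le> ennreal (n t powr p)"

text \<open>The balls of radius \<tau> about \<open>x + \<tau> *\<^sub>R c\<close> sweep out a
  truncated cone with vertex \<open>x\<close> and axis \<open>c\<close>; all smaller \<tau> are
  included because segments have to stay in \<open>W\<close> too. The choice \<open>c = 0\<close>
  gives the plain ball about an interior point.\<close>

definition cone_condition :: "'a::euclidean_space set \<Rightarrow> 'a set \<Rightarrow> 'a \<Rightarrow> real \<Rightarrow> bool" where
  "cone_condition U W c \<tau>0 \<longleftrightarrow>
    (\<forall>x\<in>U. \<forall>y. norm y \<le> 1 \<longrightarrow> (\<forall>\<tau>. 0 \<le> \<tau> \<and> \<tau> \<le> \<tau>0 \<longrightarrow> x + \<tau> *\<^sub>R (c + y) \<in> W))"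

lemma powr_abs_add3_le:
  fixes u v w p :: real
  assumes "p \<ge> 0"
  shows "\<bar>u + v + w\<bar> powr p \<le> 3 powr p * (\<bar>u\<bar> powr p + \<bar>v\<bar> powr p + \<bar>w\<bar> powr p)"
proof -
  let ?m = "max \<bar>u\<bar> (max \<bar>v\<bar> \<bar>w\<bar>)"
  have "\<bar>u + v + w\<bar> powr p \<le> (3 * ?m) powr p"
    using assms by (intro powr_mono2) auto
  also have "\<dots> = 3 powr p * ?m powr p"
    by (simp add: powr_mult)
  also have "?m powr p \<le> \<bar>u\<bar> powr p + \<bar>v\<bar> powr p + \<bar>w\<bar> powr p"
    by (auto simp: max_def)
  finally show ?thesis
    by simp
qed

text \<open>Triangle inequality through the averages at the two times: two errors in space and one
  increment of the average in time. With time step \<open>\<rho>\<^sup>2\<close> the increment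
  carries \<open>\<rho>\<^sup>2 / \<rho>\<close>, so all three are of order \<rho>. The 12 is a 3
  from the three terms times the 4 of the averages.\<close>

lemma (in parabolic_pair) local_difference_Lp:
  fixes b w :: "'a \<Rightarrow> real"
  assumes "mollifier b w B" and "open U" and c: "norm c \<le> R" and "\<rho> > 0" and cone: "cone_condition U W c \<rho>"
  shows "AE t in lborel. t \<in> {0<..<T - \<rho>\<^sup>2} \<longrightarrow>
    (nn_integral_on U (\<lambda>x. \<bar>f (x, t + \<rho>\<^sup>2) - f (x, t)\<bar> powr p))
    \<le> ennreal ((12 * B * (R + 1) * \<rho>) powr p) * (ennreal (m t powr p) + ennreal (m (t + \<rho>\<^sup>2) powr p)
        + (nn_integral_on {0..1} (\<lambda>s. n (t + s * \<rho>\<^sup>2) powr p)))"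
proof -
  interpret mollifier b w B
    by fact
  let ?h = "\<rho>\<^sup>2"
  have h: "?h > 0"
    using \<open>\<rho> > 0\<close> by simp
  have R: "R \<ge> 0"
    using c norm_ge_zero[of c] by linarith
  have [measurable]: "U \<in> sets borel" "W \<in> sets borel"
    using \<open>open U\<close> open_W by auto
  have cone1: "\<And>x y \<tau>. x \<in> U \<Longrightarrow> norm y \<le> 1 \<Longrightarrow> 0 \<le> \<tau> \<Longrightarrow> \<tau> \<le> \<rho> \<Longrightarrow> x + \<tau> *\<^sub>R (c + y) \<in> W"
    using cone by (simp add: cone_condition_def)
  have cone2: "\<And>x y. x \<in> U \<Longrightarrow> norm y \<le> 1 \<Longrightarrow> x + \<rho> *\<^sub>R (c + y) \<in> W"
    using cone1 \<open>\<rho> > 0\<close> by simp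
  have space: "(nn_integral_on U (\<lambda>x. \<bar>f (x, t) - average \<rho> c (\<lambda>x. f (x, t)) x\<bar> powr p))
    \<le> ennreal ((4 * B * \<rho> * (R + 1)) powr p) * ennreal (m t powr p)"
    if ex: "\<exists>V. is_weak_gradient W (\<lambda>x. f (x, t)) V \<and> (\<forall>j\<in>Basis. V j \<in> borel_measurable borel) \<and>
      (nn_integral_on W (\<lambda>x. gradient_size V x powr p)) \<le> ennreal (m t powr p)" for t
  proof -
    obtain V where V: "is_weak_gradient W (\<lambda>x. f (x, t)) V" "\<And>j. j \<in> Basis \<Longrightarrow> V j \<in> borel_measurable borel"
      "(nn_integral_on W (\<lambda>x. gradient_size V x powr p)) \<le> ennreal (m t powr p)"
      using ex by blast
    have "(nn_integral_on U (\<lambda>x. \<bar>f (x, t) - average \<rho> c (\<lambda>x. f (x, t)) x\<bar> powr p))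
      \<le> ennreal ((4 * B * \<rho> * (R + 1)) powr p) * (nn_integral_on W (\<lambda>x. gradient_size V x powr p))"
      by (rule average_Lp[OF \<open>open U\<close> _ V(1) _ V(2) \<open>\<rho> > 0\<close> c _ cone1]) (use p_gt in auto)
    also have "\<dots> \<le> ennreal ((4 * B * \<rho> * (R + 1)) powr p) * ennreal (m t powr p)"
      by (intro mult_left_mono V(3)) simp
    finally show ?thesis .
  qed
  \<comment> \<open>Both ends of the time step have to avoid the exceptional set, and a translate of
    a null set is a null set.\<close>
  have AE_interval: "AE t in lborel. t \<in> {0<..<T - ?h} \<longrightarrow> P t \<and> P (t + ?h)"
    if "AE t in lborel. t \<in> {0<..<T} \<longrightarrow> P t" for P
    using that AE_lborel_shift[OF that, of ?h]
  proof eventually_elim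
    case (elim t)
    show ?case
    proof
      assume "t \<in> {0<..<T - ?h}"
      then have "t \<in> {0<..<T}" "t + ?h \<in> {0<..<T}"
        using h unfolding greaterThanLessThan_iff by linarith+
      then show "P t \<and> P (t + ?h)"
        using elim by blast
    qed
  qed
  have D': "AE t in lborel. t \<in> {0<..<T - ?h} \<longrightarrow>
      (\<integral>\<^sup>+s. indicator {0..1} s * (nn_integral_on W (\<lambda>z. \<bar>D (z, t + s * ?h)\<bar> powr p)) \<partial>lborel)
      \<le> (nn_integral_on {0..1} (\<lambda>s. n (t + s * ?h) powr p))"
  proof -
    let ?P = "\<lambda>t. t \<in> {0<..<T} \<longrightarrow> (nn_integral_on W (\<lambda>x. \<bar>D (x, t)\<bar> powr p)) \<le> ennreal (n t powr p)"
    \<comment> \<open>For each \<open>s\<close> the exceptional times are a translate of one null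
      set; exchanging the quantifiers gives, for almost every \<open>t\<close>, the bound at almost
      every point of the time segment.\<close>
    have "AE s in lborel. AE t in lborel. ?P (t + s * ?h)"
      by (intro AE_I2 AE_lborel_shift D_Lp)
    then have "AE t in lborel. AE s in lborel. ?P (t + s * ?h)"
      by (subst (asm) lborel_pair.AE_commute) measurable
    then show ?thesis
    proof eventually_elim
      case (elim t)
      show ?case
      proof
        assume t: "t \<in> {0<..<T - ?h}"
        have "t + s * ?h \<in> {0<..<T}" if "s \<in> {0..1}" for s
        proof -
          have "0 \<le> s * ?h" "s * ?h \<le> ?h"
            using that h by (auto simp: mult_left_le_one_le)
          then show ?thesis
            using t by auto
        qed
        then have "AE s in lborel. indicator {0..1} s * (nn_integral_on W (\<lambda>z. \<bar>D (z, t + s * ?h)\<bar> powr p))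
            \<le> indicator {0..1} s * ennreal (n (t + s * ?h) powr p)"
          using elim by (auto elim!: eventually_mono simp: indicator_def)
        then show "(\<integral>\<^sup>+s. indicator {0..1} s * (nn_integral_on W (\<lambda>z. \<bar>D (z, t + s * ?h)\<bar> powr p)) \<partial>lborel)
          \<le> (nn_integral_on {0..1} (\<lambda>s. n (t + s * ?h) powr p))"
          by (rule nn_integral_mono_AE)
      qed
    qed
  qed
  have time: "AE t in lborel. t \<in> {0<..<T - ?h} \<longrightarrow>
    (nn_integral_on U (\<lambda>x. \<bar>average \<rho> c (\<lambda>x. f (x, t + ?h)) x - average \<rho> c (\<lambda>x. f (x, t)) x\<bar> powr p))
    \<le> ennreal ((2 * ?h * B / \<rho>) powr p) *
      (\<integral>\<^sup>+s. indicator {0..1} s * (nn_integral_on W (\<lambda>z. \<bar>D (z, t + s * ?h)\<bar> powr p)) \<partial>lborel)"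
    by (rule average_time_difference_Lp[OF f_local _ D_local _ relation i_Basis \<open>open U\<close> _ \<open>\<rho> > 0\<close> h _ cone2])
      (use p_gt in auto)
  have const: "(4 * B * \<rho> * (R + 1)) powr p \<le> (4 * B * (R + 1) * \<rho>) powr p"
    "(2 * ?h * B / \<rho>) powr p \<le> (4 * B * (R + 1) * \<rho>) powr p"
  proof -
    show "(4 * B * \<rho> * (R + 1)) powr p \<le> (4 * B * (R + 1) * \<rho>) powr p"
      by (simp add: mult_ac)
    have "B * 2 \<le> B * (4 * (R + 1))"
      using B_pos R by (intro mult_left_mono) auto
    then have "2 * ?h * B / \<rho> \<le> 4 * B * (R + 1) * \<rho>"
      using mult_right_mono[of "B * 2" "B * (4 * (R + 1))" \<rho>] \<open>\<rho> > 0\<close> by (simp add: power2_eq_square mult_ac)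
    then show "(2 * ?h * B / \<rho>) powr p \<le> (4 * B * (R + 1) * \<rho>) powr p"
      using B_pos \<open>\<rho> > 0\<close> p_gt by (intro powr_mono2) auto
  qed
  show ?thesis
    using AE_interval[OF f_gradient] D' time
  proof eventually_elim
    case (elim t)
    show ?case
    proof
      assume t: "t \<in> {0<..<T - ?h}"
      let ?a = "\<lambda>t. average \<rho> c (\<lambda>x. f (x, t))"
      let ?C = "ennreal ((4 * B * (R + 1) * \<rho>) powr p)"
      let ?N = "nn_integral_on {0..1} (\<lambda>s. n (t + s * ?h) powr p)"
      have [measurable]: "?a t \<in> borel_measurable borel" for t
        unfolding average_def by measurable
      let ?X = "\<lambda>g. nn_integral_on U (\<lambda>x. \<bar>g x\<bar> powr p)"
      have 1: "?X (\<lambda>x. f (x, t + ?h) - ?a (t + ?h) x) \<le> ?C * ennreal (m (t + ?h) powr p)"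
        using space[of "t + ?h"] elim(1) t const(1) mult_right_mono[OF ennreal_leI[OF const(1)], of "ennreal (m (t + ?h) powr p)"]
        by (meson order_trans zero_le)
      have 2: "?X (\<lambda>x. f (x, t) - ?a t x) \<le> ?C * ennreal (m t powr p)"
        using space[of t] elim(1) t const(1) mult_right_mono[OF ennreal_leI[OF const(1)], of "ennreal (m t powr p)"]
        by (meson order_trans zero_le)
      have "?X (\<lambda>x. ?a (t + ?h) x - ?a t x) \<le> ennreal ((2 * ?h * B / \<rho>) powr p) *
          (\<integral>\<^sup>+s. indicator {0..1} s * (nn_integral_on W (\<lambda>z. \<bar>D (z, t + s * ?h)\<bar> powr p)) \<partial>lborel)"
        using elim(3) t by blast
      also have "\<dots> \<le> ?C * ?N"
        using elim(2) t const(2) by (intro mult_mono ennreal_leI) auto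
      finally have 3: "?X (\<lambda>x. ?a (t + ?h) x - ?a t x) \<le> ?C * ?N" .
      have "?X (\<lambda>x. f (x, t + ?h) - f (x, t))
        \<le> (\<integral>\<^sup>+x. ennreal (3 powr p) * (indicator U x * ennreal (\<bar>f (x, t + ?h) - ?a (t + ?h) x\<bar> powr p)
            + indicator U x * ennreal (\<bar>f (x, t) - ?a t x\<bar> powr p)
            + indicator U x * ennreal (\<bar>?a (t + ?h) x - ?a t x\<bar> powr p)) \<partial>lborel)"
      proof (rule nn_integral_mono)
        fix x
        have "\<bar>f (x, t + ?h) - f (x, t)\<bar> powr p \<le> 3 powr p * (\<bar>f (x, t + ?h) - ?a (t + ?h) x\<bar> powr p
            + \<bar>f (x, t) - ?a t x\<bar> powr p + \<bar>?a (t + ?h) x - ?a t x\<bar> powr p)"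
          using powr_abs_add3_le[of p "f (x, t + ?h) - ?a (t + ?h) x" "- (f (x, t) - ?a t x)" "?a (t + ?h) x - ?a t x"] p_gt
          by (simp add: abs_minus_commute)
        then have "ennreal (\<bar>f (x, t + ?h) - f (x, t)\<bar> powr p) \<le> ennreal (3 powr p) * (ennreal (\<bar>f (x, t + ?h) - ?a (t + ?h) x\<bar> powr p)
            + ennreal (\<bar>f (x, t) - ?a t x\<bar> powr p) + ennreal (\<bar>?a (t + ?h) x - ?a t x\<bar> powr p))"
          by (simp add: ennreal_mult[symmetric] ennreal_plus[symmetric] ennreal_leI del: ennreal_plus)
        then show "indicator U x * ennreal (\<bar>f (x, t + ?h) - f (x, t)\<bar> powr p)
          \<le> ennreal (3 powr p) * (indicator U x * ennreal (\<bar>f (x, t + ?h) - ?a (t + ?h) x\<bar> powr p)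
            + indicator U x * ennreal (\<bar>f (x, t) - ?a t x\<bar> powr p)
            + indicator U x * ennreal (\<bar>?a (t + ?h) x - ?a t x\<bar> powr p))"
          by (cases "x \<in> U") auto
      qed
      also have "\<dots> = ennreal (3 powr p) * (?X (\<lambda>x. f (x, t + ?h) - ?a (t + ?h) x) + ?X (\<lambda>x. f (x, t) - ?a t x) + ?X (\<lambda>x. ?a (t + ?h) x - ?a t x))"
        by (simp add: nn_integral_cmult nn_integral_add)
      also have "\<dots> \<le> ennreal (3 powr p) * (?C * ennreal (m (t + ?h) powr p) + ?C * ennreal (m t powr p) + ?C * ?N)"
        by (intro mult_left_mono add_mono 1 2 3) simp
      also have "\<dots> = (ennreal (3 powr p) * ?C) * (ennreal (m t powr p) + ennreal (m (t + ?h) powr p) + ?N)"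
        by (simp add: distrib_left mult_ac add_ac)
      also have "ennreal (3 powr p) * ?C = ennreal ((12 * B * (R + 1) * \<rho>) powr p)"
        using B_pos R \<open>\<rho> > 0\<close> by (subst ennreal_mult[symmetric], simp, simp, subst powr_mult[symmetric]) (auto simp: mult_ac)
      finally show "?X (\<lambda>x. f (x, t + ?h) - f (x, t)) \<le> ennreal ((12 * B * (R + 1) * \<rho>) powr p) * (ennreal (m t powr p) + ennreal (m (t + ?h) powr p) + ?N)" .
    qed
  qed
qed

text \<open>All that the analysis uses of the shape of the domain. Only \<open>k\<close>,
  \<open>R\<close> and \<open>\<tau>0\<close> reach the constants; the pieces and their axes may
  vary with the domain.\<close>

definition cone_cover :: "nat \<Rightarrow> real \<Rightarrow> real \<Rightarrow> 'a::euclidean_space set \<Rightarrow> bool" where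
  "cone_cover k R \<tau>0 W \<longleftrightarrow> (\<exists>F. finite F \<and> card F \<le> k \<and> W \<subseteq> (\<Union>(U, c)\<in>F. U) \<and>
    (\<forall>(U, c)\<in>F. open U \<and> norm c \<le> R \<and> cone_condition U W c \<tau>0))"

text \<open>Summing the local estimates over the pieces costs the factor \<open>k\<close>; overlaps
  do no harm since the integrand is nonnegative.\<close>

lemma (in parabolic_pair) difference_Lp:
  fixes b w :: "'a \<Rightarrow> real"
  assumes "mollifier b w B" and cover: "cone_cover k R \<tau>0 W" and "0 < \<rho>" "\<rho> \<le> \<tau>0"
  shows "AE t in lborel. t \<in> {0<..<T - \<rho>\<^sup>2} \<longrightarrow>
    (nn_integral_on W (\<lambda>x. \<bar>f (x, t + \<rho>\<^sup>2) - f (x, t)\<bar> powr p))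
    \<le> ennreal (real k * (12 * B * (R + 1) * \<rho>) powr p) * (ennreal (m t powr p) + ennreal (m (t + \<rho>\<^sup>2) powr p)
        + (nn_integral_on {0..1} (\<lambda>s. n (t + s * \<rho>\<^sup>2) powr p)))"
proof -
  obtain F where F: "finite F" "card F \<le> k" "W \<subseteq> (\<Union>(U, c)\<in>F. U)"
    "\<And>U c. (U, c) \<in> F \<Longrightarrow> open U \<and> norm c \<le> R \<and> cone_condition U W c \<tau>0"
    using cover unfolding cone_cover_def by blast
  have cone: "cone_condition U W c \<rho>" if "(U, c) \<in> F" for U c
    using F(4)[OF that] \<open>\<rho> \<le> \<tau>0\<close> unfolding cone_condition_def by (meson order_trans)
  let ?K = "ennreal ((12 * B * (R + 1) * \<rho>) powr p)"
  let ?M = "\<lambda>t. ennreal (m t powr p) + ennreal (m (t + \<rho>\<^sup>2) powr p)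
        + (nn_integral_on {0..1} (\<lambda>s. n (t + s * \<rho>\<^sup>2) powr p))"
  have "AE t in lborel. \<forall>z\<in>F. t \<in> {0<..<T - \<rho>\<^sup>2} \<longrightarrow>
    (nn_integral_on (fst z) (\<lambda>x. \<bar>f (x, t + \<rho>\<^sup>2) - f (x, t)\<bar> powr p)) \<le> ?K * ?M t"
  proof (rule AE_finite_allI[OF F(1)])
    fix z assume "z \<in> F"
    then have z: "(fst z, snd z) \<in> F"
      by simp
    show "AE t in lborel. t \<in> {0<..<T - \<rho>\<^sup>2} \<longrightarrow>
      (nn_integral_on (fst z) (\<lambda>x. \<bar>f (x, t + \<rho>\<^sup>2) - f (x, t)\<bar> powr p)) \<le> ?K * ?M t"
      using local_difference_Lp[OF assms(1) _ _ \<open>0 < \<rho>\<close> cone[OF z], of R] F(4)[OF z] by blast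
  qed
  then show ?thesis
  proof eventually_elim
    case (elim t)
    show ?case
    proof
      assume t: "t \<in> {0<..<T - \<rho>\<^sup>2}"
      let ?g = "\<lambda>x. ennreal (\<bar>f (x, t + \<rho>\<^sup>2) - f (x, t)\<bar> powr p)"
      have "(\<integral>\<^sup>+x. indicator W x * ?g x \<partial>lborel) \<le> (\<integral>\<^sup>+x. (\<Sum>z\<in>F. indicator (fst z) x * ?g x) \<partial>lborel)"
      proof (rule nn_integral_mono)
        fix x
        show "indicator W x * ?g x \<le> (\<Sum>z\<in>F. indicator (fst z) x * ?g x)"
        proof (cases "x \<in> W")
          case True
          then obtain U c where z: "(U, c) \<in> F" "x \<in> U"
            using F(3) by blast
          have "indicator W x * ?g x \<le> indicator (fst (U, c)) x * ?g x"
            using z True by simp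
          also have "\<dots> \<le> (\<Sum>z\<in>F. indicator (fst z) x * ?g x)"
            by (rule member_le_sum[OF z(1) _ F(1)]) simp
          finally show ?thesis .
        qed simp
      qed
      also have "\<dots> = (\<Sum>z\<in>F. \<integral>\<^sup>+x. indicator (fst z) x * ?g x \<partial>lborel)"
      proof (rule nn_integral_sum)
        fix z assume "z \<in> F"
        then have "open (fst z)"
          using F(4)[of "fst z" "snd z"] by simp
        then have [measurable]: "fst z \<in> sets borel"
          by simp
        show "(\<lambda>x. indicator (fst z) x * ?g x) \<in> borel_measurable lborel"
          by measurable
      qed
      also have "\<dots> \<le> (\<Sum>z\<in>F. ?K * ?M t)"
        by (rule sum_mono) (use elim t in blast)
      also have "\<dots> = of_nat (card F) * (?K * ?M t)"
        by simp
      also have "\<dots> \<le> of_nat k * (?K * ?M t)"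
        using F(2) by (intro mult_right_mono) auto
      also have "\<dots> = ennreal (real k * (12 * B * (R + 1) * \<rho>) powr p) * ?M t"
        by (simp add: ennreal_mult ennreal_of_nat_eq_real_of_nat mult.assoc)
      finally show "(\<integral>\<^sup>+x. indicator W x * ?g x \<partial>lborel) \<le> ennreal (real k * (12 * B * (R + 1) * \<rho>) powr p) * ?M t" .
    qed
  qed
qed

section \<open>Increments in \<open>L\<^sup>2\<close> by interpolation\<close>

lemma square_le_powr_sum:
  fixes y l p q :: real
  assumes "y \<ge> 0" "l > 0" "p \<le> 2" "2 \<le> q" "p > 0"
  shows "y\<^sup>2 \<le> l powr (2 - p) * y powr p + l powr (2 - q) * y powr q"
proof (cases "y = 0")
  case False
  then have y: "y > 0"
    using assms by simp
  \<comment> \<open>Below the threshold the surplus exponent \<open>2 - p\<close> is nonnegative, so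
    its power is largest at \<open>l\<close>; above the threshold \<open>2 - q\<close> is
    nonpositive, and its power is again largest at \<open>l\<close>.\<close>
  show ?thesis
  proof (cases "y \<le> l")
    case True
    have "y\<^sup>2 = y powr (2 - p) * y powr p"
      using y by (simp add: powr_add[symmetric])
    also have "\<dots> \<le> l powr (2 - p) * y powr p"
      using True y assms by (intro mult_right_mono powr_mono2) auto
    finally show ?thesis
      by (simp add: add_increasing2)
  next
    case False
    have "y\<^sup>2 = y powr (2 - q) * y powr q"
      using y by (simp add: powr_add[symmetric])
    also have "\<dots> \<le> l powr (2 - q) * y powr q"
      using False y assms by (intro mult_right_mono powr_mono2') auto
    finally show ?thesis
      by (simp add: add_increasing)
  qed
qed (use assms in simp)

lemma nn_integral_square_le:
  fixes g :: "'a::euclidean_space \<Rightarrow> real"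
  assumes [measurable]: "g \<in> borel_measurable borel" "W \<in> sets borel" and l: "l > 0" and "p \<le> 2" "2 \<le> q" "p > 0"
  shows "(nn_integral_on W (\<lambda>x. (g x)\<^sup>2))
    \<le> ennreal (l powr (2 - p)) * (nn_integral_on W (\<lambda>x. \<bar>g x\<bar> powr p))
      + ennreal (l powr (2 - q)) * (nn_integral_on W (\<lambda>x. \<bar>g x\<bar> powr q))"
proof -
  have "(nn_integral_on W (\<lambda>x. (g x)\<^sup>2))
    \<le> (\<integral>\<^sup>+x. ennreal (l powr (2 - p)) * (indicator W x * ennreal (\<bar>g x\<bar> powr p))
      + ennreal (l powr (2 - q)) * (indicator W x * ennreal (\<bar>g x\<bar> powr q)) \<partial>lborel)"
  proof (rule nn_integral_mono)
    fix x
    have "ennreal ((g x)\<^sup>2) \<le> ennreal (l powr (2 - p)) * ennreal (\<bar>g x\<bar> powr p) + ennreal (l powr (2 - q)) * ennreal (\<bar>g x\<bar> powr q)"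
      using square_le_powr_sum[of "\<bar>g x\<bar>" l p q] assms
      by (simp add: ennreal_mult[symmetric] ennreal_plus[symmetric] ennreal_leI del: ennreal_plus)
    then show "indicator W x * ennreal ((g x)\<^sup>2) \<le> ennreal (l powr (2 - p)) * (indicator W x * ennreal (\<bar>g x\<bar> powr p))
      + ennreal (l powr (2 - q)) * (indicator W x * ennreal (\<bar>g x\<bar> powr q))"
      by (cases "x \<in> W") auto
  qed
  also have "\<dots> = ennreal (l powr (2 - p)) * (nn_integral_on W (\<lambda>x. \<bar>g x\<bar> powr p))
      + ennreal (l powr (2 - q)) * (nn_integral_on W (\<lambda>x. \<bar>g x\<bar> powr q))"
    by (simp add: nn_integral_add nn_integral_cmult)
  finally show ?thesis .
qed

text \<open>Interpolation of \<open>L\<^sup>2\<close> between \<open>L\<^sup>p\<close> and \<open>L\<^sup>q\<close>: the threshold \<open>S * \<rho> powr (- (d - p) / p)\<close> balances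
  the two contributions.\<close>

lemma interpolation_L2:
  fixes g :: "'a::euclidean_space \<Rightarrow> real" and p q S \<rho> :: real
  assumes [measurable]: "g \<in> borel_measurable borel" "W \<in> sets borel"
    and "p < 2" "2 \<le> q" "p > 1" and q: "q = real DIM('a) * p / (real DIM('a) - p)" and "DIM('a) \<ge> 2"
    and "\<rho> > 0" "S \<ge> 0" "K \<ge> 0" "L \<ge> 0"
    and gp: "(nn_integral_on W (\<lambda>x. \<bar>g x\<bar> powr p)) \<le> ennreal (K * (\<rho> * S) powr p)"
    and gq: "(nn_integral_on W (\<lambda>x. \<bar>g x\<bar> powr q)) \<le> ennreal (L * S powr q)"
  shows "(nn_integral_on W (\<lambda>x. (g x)\<^sup>2))
    \<le> ennreal ((K + L) * \<rho> powr (2 * (1 + real DIM('a) / 2 - real DIM('a) / p)) * S\<^sup>2)"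
proof (cases "S = 0")
  case True
  then have "AE x in lborel. indicator W x * ennreal (\<bar>g x\<bar> powr p) = 0"
    using gp nn_integral_0_iff_AE[of "\<lambda>x. indicator W x * ennreal (\<bar>g x\<bar> powr p)" lborel] by simp
  then have "AE x in lborel. indicator W x * ennreal ((g x)\<^sup>2) = 0"
  proof eventually_elim
    case (elim x)
    then show ?case
      by (auto simp: ennreal_eq_0_iff indicator_def split: if_splits)
  qed
  then have "(nn_integral_on W (\<lambda>x. (g x)\<^sup>2)) = 0"
    by (subst nn_integral_0_iff_AE) auto
  then show ?thesis
    by simp
next
  case False
  then have S: "S > 0"
    using \<open>S \<ge> 0\<close> by simp
  let ?d = "real DIM('a)"
  have d: "?d - p > 0"
    using \<open>DIM('a) \<ge> 2\<close> \<open>p < 2\<close> by linarith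
  define l where "l = S * \<rho> powr (- ((?d - p) / p))"
  have l: "l > 0"
    using S \<open>\<rho> > 0\<close> by (simp add: l_def)
  let ?e = "2 * (1 + ?d / 2 - ?d / p)"
  have e1: "- ((?d - p) / p) * (2 - p) + p = ?e"
    using \<open>p > 1\<close> by (simp add: field_simps)
  have e2: "- ((?d - p) / p) * (2 - q) = ?e"
    using \<open>p > 1\<close> d unfolding q by (simp add: field_simps)
  have lp: "l powr (2 - p) * (K * (\<rho> * S) powr p) = K * \<rho> powr ?e * S\<^sup>2"
  proof -
    have "l powr (2 - p) * (K * (\<rho> * S) powr p) = K * (\<rho> powr (- ((?d - p) / p) * (2 - p)) * \<rho> powr p) * (S powr (2 - p) * S powr p)"
      using S \<open>\<rho> > 0\<close> by (simp add: l_def powr_mult powr_powr)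
    also have "\<dots> = K * \<rho> powr ?e * S\<^sup>2"
      using S unfolding powr_add[symmetric] e1 by simp
    finally show ?thesis .
  qed
  have lq: "l powr (2 - q) * (L * S powr q) = L * \<rho> powr ?e * S\<^sup>2"
  proof -
    have "l powr (2 - q) * (L * S powr q) = L * \<rho> powr (- ((?d - p) / p) * (2 - q)) * (S powr (2 - q) * S powr q)"
      using S \<open>\<rho> > 0\<close> by (simp add: l_def powr_mult powr_powr)
    also have "\<dots> = L * \<rho> powr ?e * S\<^sup>2"
      using S unfolding powr_add[symmetric] e2 by simp
    finally show ?thesis .
  qed
  have "(nn_integral_on W (\<lambda>x. (g x)\<^sup>2))
    \<le> ennreal (l powr (2 - p)) * (nn_integral_on W (\<lambda>x. \<bar>g x\<bar> powr p))
      + ennreal (l powr (2 - q)) * (nn_integral_on W (\<lambda>x. \<bar>g x\<bar> powr q))"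
    by (rule nn_integral_square_le) (use l assms in auto)
  also have "\<dots> \<le> ennreal (l powr (2 - p)) * ennreal (K * (\<rho> * S) powr p) + ennreal (l powr (2 - q)) * ennreal (L * S powr q)"
    by (intro add_mono mult_left_mono gp gq) auto
  also have "\<dots> = ennreal (l powr (2 - p) * (K * (\<rho> * S) powr p) + l powr (2 - q) * (L * S powr q))"
    using \<open>K \<ge> 0\<close> \<open>L \<ge> 0\<close> by (simp add: ennreal_mult)
  also have "l powr (2 - p) * (K * (\<rho> * S) powr p) + l powr (2 - q) * (L * S powr q) = K * \<rho> powr ?e * S\<^sup>2 + L * \<rho> powr ?e * S\<^sup>2"
    unfolding lp lq ..
  also have "\<dots> = ennreal ((K + L) * \<rho> powr ?e * S\<^sup>2)"
    by (simp add: algebra_simps)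
  finally show ?thesis .
qed

text \<open>The interpolation needs bounds in \<open>L\<^sup>p\<close> and \<open>L\<^sup>q\<close>
  of a common size \<open>S\<close>; here \<open>S\<^sup>2\<close> is the sum of the three time
  terms, and only the \<open>L\<^sup>p\<close> bound carries the gain \<rho>.\<close>

lemma (in parabolic_pair) difference_L2:
  fixes b w :: "'a \<Rightarrow> real"
  assumes "mollifier b w B" and cover: "cone_cover k R \<tau>0 W" and "R \<ge> 0" and "0 < \<rho>" "\<rho> \<le> \<tau>0"
  shows "AE t in lborel. t \<in> {0<..<T - \<rho>\<^sup>2} \<longrightarrow>
    (nn_integral_on W (\<lambda>x. (f (x, t + \<rho>\<^sup>2) - f (x, t))\<^sup>2))
    \<le> ennreal ((4 * real k * (12 * B * (R + 1)) powr p + 2 * 2 powr q) * \<rho> powr (2 * (1 + real DIM('a) / 2 - real DIM('a) / p))) *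
      (ennreal ((m t)\<^sup>2) + ennreal ((m (t + \<rho>\<^sup>2))\<^sup>2) + (nn_integral_on {0..1} (\<lambda>s. (n (t + s * \<rho>\<^sup>2))\<^sup>2)))"
proof -
  have B: "B > 0"
    using assms(1) by (simp add: mollifier_def)
  have [measurable]: "W \<in> sets borel"
    using open_W by simp
  let ?h = "\<rho>\<^sup>2" and ?K = "4 * real k * (12 * B * (R + 1)) powr p" and ?L = "2 * 2 powr q"
  let ?r = "\<rho> powr (2 * (1 + real DIM('a) / 2 - real DIM('a) / p))"
  have h: "?h > 0"
    using \<open>0 < \<rho>\<close> by simp
  have L: "(?K + ?L) * ?r > 0"
    using \<open>0 < \<rho>\<close> by (intro mult_pos_pos add_nonneg_pos) auto
  show ?thesis
    using f_Lq AE_lborel_shift[OF f_Lq, of ?h] difference_Lp[OF assms(1) cover \<open>0 < \<rho>\<close> \<open>\<rho> \<le> \<tau>0\<close>]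
  proof eventually_elim
    case (elim t)
    show ?case
    proof
      assume t: "t \<in> {0<..<T - ?h}"
      then have t': "t \<in> {0<..<T}" "t + ?h \<in> {0<..<T}"
        using h unfolding greaterThanLessThan_iff by linarith+
      let ?I = "nn_integral_on {0..1} (\<lambda>s. (n (t + s * ?h))\<^sup>2)"
      let ?g = "\<lambda>x. f (x, t + ?h) - f (x, t)"
      define Q where "Q = ennreal ((m t)\<^sup>2) + ennreal ((m (t + ?h))\<^sup>2) + ?I"
      show "(nn_integral_on W (\<lambda>x. (?g x)\<^sup>2)) \<le> ennreal ((?K + ?L) * ?r) *
          (ennreal ((m t)\<^sup>2) + ennreal ((m (t + ?h))\<^sup>2) + ?I)"
      proof (cases Q)
        \<comment> \<open>The right-hand side is then infinite, because the constant in front is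
          positive.\<close>
        case top
        have "ennreal ((?K + ?L) * ?r) \<noteq> 0"
          using L unfolding ennreal_eq_0_iff not_le .
        then show ?thesis
          unfolding Q_def[symmetric] top by (simp only: ennreal_mult_top if_False top_greatest)
      next
        case (real r)
        define S where "S = sqrt r"
        have S: "S \<ge> 0" "Q = ennreal (S\<^sup>2)"
          using real by (auto simp: S_def)
        have "ennreal ((m t)\<^sup>2) \<le> Q" "ennreal ((m (t + ?h))\<^sup>2) \<le> Q" and I: "?I \<le> Q"
          by (auto simp: Q_def add_increasing add_increasing2)
        then have mS: "m t \<le> S" "m (t + ?h) \<le> S"
          using S power2_le_imp_le by (auto simp: ennreal_le_iff)
        have powS: "m t powr e \<le> S powr e" "m (t + ?h) powr e \<le> S powr e" if "e \<ge> 0" for e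
          using mS m_nonneg that by (auto intro!: powr_mono2)
        \<comment> \<open>From the square mean of \<open>n\<close> over the time segment to its mean
          of order \<open>p\<close>: the mean inequality with exponent \<open>2 / p\<close>, applied
          to \<open>n powr p\<close>. Its factor 2 makes the three terms add up to
          \<open>4 * S powr p\<close>.\<close>
        have nS: "(nn_integral_on {0..1} (\<lambda>s. n (t + s * ?h) powr p)) \<le> ennreal (2 * S powr p)"
        proof (rule weighted_mean_le[where p = "2 / p"])
          have "(nn_integral_on {0..1} (\<lambda>s. (n (t + s * ?h) powr p) powr (2 / p))) = ?I"
            using p_gt n_nonneg by (simp add: powr_powr)
          also have "\<dots> \<le> ennreal ((S powr p) powr (2 / p))"
            using I S p_gt by (simp add: powr_powr)
          finally show "(nn_integral_on {0..1} (\<lambda>s. (n (t + s * ?h) powr p) powr (2 / p)))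
            \<le> ennreal ((S powr p) powr (2 / p))" .
        qed (use p_gt p_less in auto)
        have gp: "(nn_integral_on W (\<lambda>x. \<bar>?g x\<bar> powr p)) \<le> ennreal (?K * (\<rho> * S) powr p)"
        proof -
          have "(nn_integral_on W (\<lambda>x. \<bar>?g x\<bar> powr p))
            \<le> ennreal (real k * (12 * B * (R + 1) * \<rho>) powr p) * (ennreal (m t powr p) + ennreal (m (t + ?h) powr p)
              + (nn_integral_on {0..1} (\<lambda>s. n (t + s * ?h) powr p)))"
            using elim(3) t by blast
          also have "\<dots> \<le> ennreal (real k * (12 * B * (R + 1) * \<rho>) powr p) * (ennreal (S powr p) + ennreal (S powr p) + ennreal (2 * S powr p))"
            using p_gt by (intro mult_left_mono add_mono nS ennreal_leI powS) auto
          also have "ennreal (S powr p) + ennreal (S powr p) + ennreal (2 * S powr p) = ennreal (4 * S powr p)"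
          proof -
            have "4 * S powr p = S powr p + S powr p + 2 * S powr p"
              by simp
            also have "ennreal \<dots> = ennreal (S powr p) + ennreal (S powr p) + ennreal (2 * S powr p)"
              by (simp only: ennreal_plus add_nonneg_nonneg mult_nonneg_nonneg powr_ge_zero zero_le_numeral)
            finally show ?thesis ..
          qed
          also have "ennreal (real k * (12 * B * (R + 1) * \<rho>) powr p) * ennreal (4 * S powr p)
            = ennreal (real k * (12 * B * (R + 1) * \<rho>) powr p * (4 * S powr p))"
            by (rule ennreal_mult[symmetric]) auto
          also have "real k * (12 * B * (R + 1) * \<rho>) powr p * (4 * S powr p) = ?K * (\<rho> * S) powr p"
          proof -
            have "(12 * B * (R + 1) * \<rho>) powr p = (12 * B * (R + 1)) powr p * \<rho> powr p" "(\<rho> * S) powr p = \<rho> powr p * S powr p"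
              using B \<open>R \<ge> 0\<close> \<open>0 < \<rho>\<close> S by (auto intro!: powr_mult)
            then show ?thesis
              by simp
          qed
          finally show ?thesis .
        qed
        have gq: "(nn_integral_on W (\<lambda>x. \<bar>?g x\<bar> powr q)) \<le> ennreal (?L * S powr q)"
        proof -
          have "(nn_integral_on W (\<lambda>x. \<bar>?g x\<bar> powr q))
            \<le> (\<integral>\<^sup>+x. ennreal (2 powr q) * (indicator W x * ennreal (\<bar>f (x, t + ?h)\<bar> powr q) + indicator W x * ennreal (\<bar>f (x, t)\<bar> powr q)) \<partial>lborel)"
          proof (rule nn_integral_mono)
            fix x
            have "\<bar>?g x\<bar> powr q \<le> (2 * max \<bar>f (x, t + ?h)\<bar> \<bar>f (x, t)\<bar>) powr q"
              using q_ge by (intro powr_mono2) auto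
            also have "\<dots> = 2 powr q * max \<bar>f (x, t + ?h)\<bar> \<bar>f (x, t)\<bar> powr q"
              by (simp add: powr_mult)
            also have "\<dots> \<le> 2 powr q * (\<bar>f (x, t + ?h)\<bar> powr q + \<bar>f (x, t)\<bar> powr q)"
              by (auto simp: max_def)
            finally have "ennreal (\<bar>?g x\<bar> powr q) \<le> ennreal (2 powr q) * (ennreal (\<bar>f (x, t + ?h)\<bar> powr q) + ennreal (\<bar>f (x, t)\<bar> powr q))"
              by (simp add: ennreal_mult[symmetric] ennreal_plus[symmetric] ennreal_leI del: ennreal_plus)
            then show "indicator W x * ennreal (\<bar>?g x\<bar> powr q)
              \<le> ennreal (2 powr q) * (indicator W x * ennreal (\<bar>f (x, t + ?h)\<bar> powr q) + indicator W x * ennreal (\<bar>f (x, t)\<bar> powr q))"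
              by (cases "x \<in> W") auto
          qed
          also have "\<dots> = ennreal (2 powr q) * ((nn_integral_on W (\<lambda>x. \<bar>f (x, t + ?h)\<bar> powr q)) + (nn_integral_on W (\<lambda>x. \<bar>f (x, t)\<bar> powr q)))"
            by (simp add: nn_integral_cmult nn_integral_add)
          also have "\<dots> \<le> ennreal (2 powr q) * (ennreal (m (t + ?h) powr q) + ennreal (m t powr q))"
            using elim(1,2) t' by (intro mult_left_mono add_mono) auto
          also have "\<dots> \<le> ennreal (2 powr q) * (ennreal (S powr q) + ennreal (S powr q))"
            using q_ge by (intro mult_left_mono add_mono ennreal_leI powS) auto
          also have "\<dots> = ennreal (?L * S powr q)"
            by (simp add: ennreal_mult[symmetric] ennreal_plus[symmetric] del: ennreal_plus)
          finally show ?thesis .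
        qed
        have "(nn_integral_on W (\<lambda>x. (?g x)\<^sup>2)) \<le> ennreal ((?K + ?L) * ?r * S\<^sup>2)"
          by (rule interpolation_L2[OF _ _ p_less q_ge p_gt q_def dim \<open>0 < \<rho>\<close> S(1) _ _ gp gq]) auto
        also have "\<dots> = ennreal ((?K + ?L) * ?r) * Q"
          using L S by (simp add: ennreal_mult)
        finally show ?thesis
          by (simp add: Q_def)
      qed
    qed
  qed
qed

text \<open>Shifts by \<open>s * h\<close> with \<open>s\<close> in [0, 1] map the shortened time
  interval into the full one, so each time term is bounded by an integral over {0<..<T}. With \<rho>
  = sqrt h the gain \<rho>^(2\<alpha>) becomes h^\<alpha>.\<close>

lemma (in parabolic_pair) integrated_difference_L2:
  fixes b w :: "'a \<Rightarrow> real"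
  assumes "mollifier b w B" and cover: "cone_cover k R \<tau>0 W" and "R \<ge> 0" and "0 < h" "h \<le> \<tau>0\<^sup>2" "\<tau>0 > 0"
  shows "(\<integral>\<^sup>+t. indicator {0<..<T - h} t * (nn_integral_on W (\<lambda>x. (f (x, t + h) - f (x, t))\<^sup>2)) \<partial>lborel)
    \<le> ennreal (2 * (4 * real k * (12 * B * (R + 1)) powr p + 2 * 2 powr q) * h powr (1 + real DIM('a) / 2 - real DIM('a) / p)) *
      (\<integral>\<^sup>+t. indicator {0<..<T} t * (ennreal ((m t)\<^sup>2) + ennreal ((n t)\<^sup>2)) \<partial>lborel)"
proof -
  define \<rho> where "\<rho> = sqrt h"
  have \<rho>: "\<rho> > 0" "\<rho>\<^sup>2 = h" "\<rho> \<le> \<tau>0"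
    using assms(4-6) real_sqrt_le_mono[of h "\<tau>0\<^sup>2"] by (auto simp: \<rho>_def)
  have [measurable]: "W \<in> sets borel"
    using open_W by simp
  let ?\<alpha> = "1 + real DIM('a) / 2 - real DIM('a) / p"
  let ?K = "4 * real k * (12 * B * (R + 1)) powr p + 2 * 2 powr q"
  have pow: "\<rho> powr (2 * a) = h powr a" for a
    using \<open>0 < h\<close> by (simp add: \<rho>_def powr_half_sqrt[symmetric] powr_powr)
  let ?M = "nn_integral_on {0<..<T} (\<lambda>t. (m t)\<^sup>2)"
  let ?N = "nn_integral_on {0<..<T} (\<lambda>t. (n t)\<^sup>2)"
  have shift: "(nn_integral_on {0<..<T - h} (\<lambda>t. (F (t + s * h))\<^sup>2))
      \<le> (nn_integral_on {0<..<T} (\<lambda>t. (F t)\<^sup>2))"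
    if [measurable]: "F \<in> borel_measurable borel" and s: "s \<in> {0..1}" for F :: "real \<Rightarrow> real" and s
  proof -
    have "0 \<le> s * h" "s * h \<le> h"
      using s \<open>0 < h\<close> by (auto simp: mult_left_le_one_le)
    then have "(nn_integral_on {0<..<T - h} (\<lambda>t. (F (t + s * h))\<^sup>2))
        \<le> (\<integral>\<^sup>+t. indicator {0<..<T} (t + s * h) * ennreal ((F (t + s * h))\<^sup>2) \<partial>lborel)"
      by (intro nn_integral_mono) (auto simp: indicator_def)
    also have "\<dots> = (nn_integral_on {0<..<T} (\<lambda>t. (F t)\<^sup>2))"
      by (rule nn_integral_lborel_shift[of "\<lambda>t. indicator {0<..<T} t * ennreal ((F t)\<^sup>2)"]) measurable
    finally show ?thesis .
  qed
  have N: "(\<integral>\<^sup>+t. indicator {0<..<T - h} t * (nn_integral_on {0..1} (\<lambda>s. (n (t + s * h))\<^sup>2)) \<partial>lborel) \<le> ?N"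
  proof -
    have "(\<integral>\<^sup>+t. indicator {0<..<T - h} t * (nn_integral_on {0..1} (\<lambda>s. (n (t + s * h))\<^sup>2)) \<partial>lborel)
      = (\<integral>\<^sup>+t. \<integral>\<^sup>+s. indicator {0..1} s * (indicator {0<..<T - h} t * ennreal ((n (t + s * h))\<^sup>2)) \<partial>lborel \<partial>lborel)"
      by (subst nn_integral_cmult[symmetric]) (auto simp: mult_ac)
    also have "\<dots> = (\<integral>\<^sup>+s. \<integral>\<^sup>+t. indicator {0..1} s * (indicator {0<..<T - h} t * ennreal ((n (t + s * h))\<^sup>2)) \<partial>lborel \<partial>lborel)"
      by (rule lborel_pair.Fubini') measurable
    also have "\<dots> = (\<integral>\<^sup>+s. indicator {0..1} s * (nn_integral_on {0<..<T - h} (\<lambda>t. (n (t + s * h))\<^sup>2)) \<partial>lborel)"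
      by (simp add: nn_integral_cmult)
    also have "\<dots> \<le> (\<integral>\<^sup>+s. indicator {0..1} (s::real) * ?N \<partial>lborel)"
      using shift[OF n_measurable] by (intro nn_integral_mono) (auto simp: indicator_def)
    also have "\<dots> = ?N"
      by (simp add: nn_integral_multc)
    finally show ?thesis .
  qed
  have "AE t in lborel. indicator {0<..<T - h} t * (nn_integral_on W (\<lambda>x. (f (x, t + h) - f (x, t))\<^sup>2))
    \<le> ennreal (?K * h powr ?\<alpha>) * (indicator {0<..<T - h} t * ennreal ((m t)\<^sup>2) + indicator {0<..<T - h} t * ennreal ((m (t + h))\<^sup>2)
      + indicator {0<..<T - h} t * (nn_integral_on {0..1} (\<lambda>s. (n (t + s * h))\<^sup>2)))"
    using difference_L2[OF assms(1) cover \<open>R \<ge> 0\<close> \<rho>(1,3)] unfolding \<rho>(2) pow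
    by eventually_elim (auto simp: indicator_def)
  then have "(\<integral>\<^sup>+t. indicator {0<..<T - h} t * (nn_integral_on W (\<lambda>x. (f (x, t + h) - f (x, t))\<^sup>2)) \<partial>lborel)
    \<le> (\<integral>\<^sup>+t. ennreal (?K * h powr ?\<alpha>) * (indicator {0<..<T - h} t * ennreal ((m t)\<^sup>2) + indicator {0<..<T - h} t * ennreal ((m (t + h))\<^sup>2)
      + indicator {0<..<T - h} t * (nn_integral_on {0..1} (\<lambda>s. (n (t + s * h))\<^sup>2))) \<partial>lborel)"
    by (rule nn_integral_mono_AE)
  also have "\<dots> = ennreal (?K * h powr ?\<alpha>) * ((nn_integral_on {0<..<T - h} (\<lambda>t. (m t)\<^sup>2))
      + (nn_integral_on {0<..<T - h} (\<lambda>t. (m (t + h))\<^sup>2))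
      + (\<integral>\<^sup>+t. indicator {0<..<T - h} t * (nn_integral_on {0..1} (\<lambda>s. (n (t + s * h))\<^sup>2)) \<partial>lborel))"
    by (simp add: nn_integral_cmult nn_integral_add)
  also have "\<dots> \<le> ennreal (?K * h powr ?\<alpha>) * (?M + ?M + ?N)"
    using shift[OF m_measurable, of 0] shift[OF m_measurable, of 1] N by (intro mult_left_mono add_mono) auto
  also have "\<dots> \<le> ennreal (?K * h powr ?\<alpha>) * (2 * (?M + ?N))"
  proof (intro mult_left_mono)
    have "?M + ?M + ?N \<le> ?M + ?M + ?N + ?N"
      by (rule add_increasing2) simp_all
    also have "\<dots> = 2 * (?M + ?N)"
      by (simp only: mult_2 add_ac)
    finally show "?M + ?M + ?N \<le> 2 * (?M + ?N)" .
  qed simp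
  also have "\<dots> = (2 * ennreal (?K * h powr ?\<alpha>)) * (?M + ?N)"
    by (simp only: mult_ac)
  also have "2 * ennreal (?K * h powr ?\<alpha>) = ennreal (2 * ?K * h powr ?\<alpha>)"
    unfolding mult.assoc[of 2] by (subst ennreal_mult) auto
  also have "?M + ?N = (\<integral>\<^sup>+t. indicator {0<..<T} t * (ennreal ((m t)\<^sup>2) + ennreal ((n t)\<^sup>2)) \<partial>lborel)"
    by (simp add: distrib_left nn_integral_add)
  finally show ?thesis .
qed

subsection \<open>Decay on short time intervals\<close>

definition interval_integral :: "(real \<Rightarrow> ennreal) \<Rightarrow> real \<Rightarrow> real \<Rightarrow> ennreal" where
  "interval_integral \<Phi> s l = (\<integral>\<^sup>+t. indicator {s<..<s + l} t * \<Phi> t \<partial>lborel)"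

lemma interval_integral_mono:
  assumes "s' \<le> s" "s + l \<le> s' + l'"
  shows "interval_integral \<Phi> s l \<le> interval_integral \<Phi> s' l'"
  unfolding interval_integral_def using assms by (intro nn_integral_mono) (auto simp: indicator_def)

lemma interval_integral_superadditive:
  assumes [measurable]: "\<Phi> \<in> borel_measurable borel" and "a \<ge> 0" "b \<ge> 0"
  shows "interval_integral \<Phi> s a + interval_integral \<Phi> (s + a) b \<le> interval_integral \<Phi> s (a + b)"
proof -
  have "interval_integral \<Phi> s a + interval_integral \<Phi> (s + a) b
      = (\<integral>\<^sup>+t. indicator {s<..<s + a} t * \<Phi> t + indicator {s + a<..<s + a + b} t * \<Phi> t \<partial>lborel)"
    unfolding interval_integral_def by (subst nn_integral_add) auto
  also have "\<dots> \<le> interval_integral \<Phi> s (a + b)"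
    unfolding interval_integral_def using assms by (intro nn_integral_mono) (auto simp: indicator_def)
  finally show ?thesis .
qed

lemma sum_interval_integral_le:
  assumes \<Phi>: "\<Phi> \<in> borel_measurable borel" and "l \<ge> 0"
  shows "(\<Sum>j<n. interval_integral \<Phi> (s + real j * l) l) \<le> interval_integral \<Phi> s (real n * l)"
proof (induction n)
  case (Suc n)
  have "(\<Sum>j<Suc n. interval_integral \<Phi> (s + real j * l) l)
      \<le> interval_integral \<Phi> s (real n * l) + interval_integral \<Phi> (s + real n * l) l"
    using Suc by (simp add: add_right_mono)
  also have "\<dots> \<le> interval_integral \<Phi> s (real n * l + l)"
    using assms by (intro interval_integral_superadditive) auto
  finally show ?case
    by (simp add: algebra_simps)
qed simp

text \<open>\<open>K\<close> is fixed before \<Phi>, \<open>E\<close> and \<open>T\<close>, so it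
  can depend on \<alpha>, \<open>h0\<close> and \<open>T0\<close> only: this is the uniformity over
  domains and functions that is required in the end. The factor 2 in the hypothesis is the loss in
  squaring a sum.\<close>

definition is_decay_constant :: "real \<Rightarrow> real \<Rightarrow> real \<Rightarrow> real \<Rightarrow> bool" where
  "is_decay_constant \<alpha> h0 T0 K \<longleftrightarrow> (\<forall>\<Phi> E T. \<Phi> \<in> borel_measurable borel \<longrightarrow> T \<ge> T0 \<longrightarrow>
    (\<forall>s l h. 0 \<le> s \<longrightarrow> 0 < l \<longrightarrow> 0 < h \<longrightarrow> h \<le> h0 \<longrightarrow> s + h + l \<le> T \<longrightarrow>
      interval_integral \<Phi> s l \<le> 2 * interval_integral \<Phi> (s + h) l + ennreal (h powr \<alpha>) * E \<and>
      interval_integral \<Phi> (s + h) l \<le> 2 * interval_integral \<Phi> s l + ennreal (h powr \<alpha>) * E) \<longrightarrow>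
    (\<forall>s l. 0 \<le> s \<longrightarrow> 0 < l \<longrightarrow> s + l \<le> T \<longrightarrow>
      interval_integral \<Phi> s l \<le> ennreal (K * l powr \<alpha>) * (E + interval_integral \<Phi> 0 T)))"

text \<open>Translations change the integral over an interval of length \<open>l\<close> by at most \<open>E * (L * l) powr \<alpha>\<close>.
  Comparing it with its \<open>L\<close> translates inside an interval of length \<open>L * l\<close> gives
  \<open>X l \<le> 2 / L * X (L * l) + E * (L * l) powr \<alpha>\<close>; as \<open>\<alpha> < 1\<close>, this iterates to \<open>X l \<lesssim> l powr \<alpha>\<close>
  once \<open>L powr (1 - \<alpha>) \<ge> 4\<close>.\<close>

lemma interval_integral_decay:
  fixes \<alpha> h0 T0 :: real
  assumes "0 \<le> \<alpha>" "\<alpha> < 1" "h0 > 0" "T0 > 0"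
  shows "\<exists>K>0. is_decay_constant \<alpha> h0 T0 K"
proof -
  obtain L :: nat where L4: "4 powr (1 / (1 - \<alpha>)) \<le> real L"
    using real_arch_simple by blast
  have "1 \<le> 1 / (1 - \<alpha>)"
    using assms by simp
  then have "(4::real) powr 1 \<le> 4 powr (1 / (1 - \<alpha>))"
    by (intro powr_mono) auto
  then have L: "real L \<ge> 4"
    using L4 by simp
  have La: "4 * real L powr \<alpha> \<le> real L"
  proof -
    have "4 = (4 powr (1 / (1 - \<alpha>))) powr (1 - \<alpha>)"
      using assms by (simp add: powr_powr)
    also have "\<dots> \<le> real L powr (1 - \<alpha>)"
      using L4 assms by (intro powr_mono2) auto
    finally have "4 * real L powr \<alpha> \<le> real L powr (1 - \<alpha>) * real L powr \<alpha>"
      by (rule mult_right_mono) simp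
    then show ?thesis
      using L by (simp add: powr_add[symmetric])
  qed
  \<comment> \<open>For lengths up to \<open>h1\<close> a window of \<open>L\<close> cells fits into
    half the time interval, and every shift inside it is at most \<open>h0\<close>. This is where
    the lower bound \<open>T0\<close> enters.\<close>
  define h1 where "h1 = min h0 (T0 / 2) / real L"
  have h1: "h1 > 0" "real L * h1 \<le> h0" "real L * h1 \<le> T0 / 2"
    using assms L by (auto simp: h1_def)
  \<comment> \<open>The second summand settles lengths of at least \<open>h1\<close>, by comparison
    with the whole interval; the first ensures \<open>real L \<le> K\<close>, which absorbs the
    inhomogeneous term.\<close>
  define K where "K = real L + h1 powr (- \<alpha>)"
  have K: "K > 0" "K \<ge> real L" "K * h1 powr \<alpha> \<ge> 1"
  proof -
    show "K > 0" "K \<ge> real L"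
      using L by (auto simp: K_def add_pos_nonneg)
    have "h1 powr (- \<alpha>) * h1 powr \<alpha> = 1"
      using h1 by (simp add: powr_add[symmetric])
    then show "K * h1 powr \<alpha> \<ge> 1"
      by (simp add: K_def distrib_right)
  qed
  show ?thesis
    unfolding is_decay_constant_def
  proof (intro exI[of _ K] conjI K(1) allI impI)
    fix \<Phi> E T s l
    assume \<Phi> [measurable]: "\<Phi> \<in> borel_measurable borel" and T: "T \<ge> T0"
      and step: "\<forall>s l h. 0 \<le> s \<longrightarrow> 0 < l \<longrightarrow> 0 < h \<longrightarrow> h \<le> h0 \<longrightarrow> s + h + l \<le> T \<longrightarrow>
        interval_integral \<Phi> s l \<le> 2 * interval_integral \<Phi> (s + h) l + ennreal (h powr \<alpha>) * E \<and>
        interval_integral \<Phi> (s + h) l \<le> 2 * interval_integral \<Phi> s l + ennreal (h powr \<alpha>) * E"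
      and sl: "(0::real) \<le> s" "0 < (l::real)" "s + l \<le> T"
    define X where "X = interval_integral \<Phi>"
    define A where "A = E + X 0 T"
    have large: "X s l \<le> ennreal (K * l powr \<alpha>) * A" if "0 \<le> s" "s + l \<le> T" "h1 \<le> l" for s l
    proof -
      have "X s l \<le> X 0 T"
        unfolding X_def using that by (intro interval_integral_mono) auto
      also have "\<dots> \<le> ennreal 1 * A"
        by (simp add: A_def)
      also have "\<dots> \<le> ennreal (K * l powr \<alpha>) * A"
      proof (intro mult_right_mono ennreal_leI)
        have "K * h1 powr \<alpha> \<le> K * l powr \<alpha>"
          using that h1 K assms by (intro mult_left_mono powr_mono2) auto
        then show "1 \<le> K * l powr \<alpha>"
          using K by linarith
      qed simp
      finally show ?thesis .
    qed
    \<comment> \<open>\<open>N\<close> bounds the number of dilations by \<open>L\<close> that are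
      needed to lift \<open>l\<close> to at least \<open>h1\<close>.\<close>
    have "\<And>s l. 0 \<le> s \<Longrightarrow> 0 < l \<Longrightarrow> s + l \<le> T \<Longrightarrow> h1 \<le> l * real L ^ N \<Longrightarrow> X s l \<le> ennreal (K * l powr \<alpha>) * A" for N
    proof (induction N)
      case 0
      then show ?case
        using large by simp
    next
      case (Suc N)
      show ?case
      proof (cases "h1 \<le> l")
        case True
        then show ?thesis
          using large Suc.prems by simp
      next
        case False
        have Ll: "real L * l \<le> h0" "real L * l \<le> T / 2"
          using False h1 L T mult_left_mono[of l h1 "real L"] by linarith+
        \<comment> \<open>The window starts at \<open>s\<close> if it fits. Otherwise it ends at
          \<open>s + l\<close>, and the given interval is its last cell, number
          \<open>L - 1\<close>; then \<open>real L * l \<le> T / 2\<close> keeps the left end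
          nonnegative.\<close>
        have "\<exists>s' i. s = s' + real i * l \<and> i < L \<and> 0 \<le> s' \<and> s' + real L * l \<le> T"
        proof (cases "s + real L * l \<le> T")
          case True
          then show ?thesis
            using Suc.prems L by (intro exI[of _ s] exI[of _ 0]) auto
        next
          case False
          have "real (L - 1) = real L - 1"
            using L by simp
          then show ?thesis
            using Suc.prems L Ll False
            by (intro exI[of _ "s + l - real L * l"] exI[of _ "L - 1"]) (auto simp: algebra_simps)
        qed
        then obtain s' i where s': "s = s' + real i * l" "i < L" "0 \<le> s'" "s' + real L * l \<le> T"
          by blast
        have IH: "X s' (real L * l) \<le> ennreal (K * (real L * l) powr \<alpha>) * A"
          using Suc.IH[of s' "real L * l"] s' Suc.prems L by (simp add: mult_ac)
        have trans: "X s l \<le> 2 * X (s' + real j * l) l + ennreal ((real L * l) powr \<alpha>) * E" if j: "j < L" for j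
        proof -
          have jl: "s' + real j * l + l \<le> T" "s' + real i * l + l \<le> T"
          proof -
            have "(real j + 1) * l \<le> real L * l" "(real i + 1) * l \<le> real L * l"
              using j s'(2) Suc.prems by (auto intro!: mult_right_mono)
            then show "s' + real j * l + l \<le> T" "s' + real i * l + l \<le> T"
              using s'(4) by (auto simp: distrib_right)
          qed
          consider "j = i" | "i < j" | "j < i"
            by linarith
          then show ?thesis
          proof cases
            case 1
            then show ?thesis
              using s'(1) by (simp add: mult_2 add_increasing2)
          next
            case 2
            define h where "h = real (j - i) * l"
            have h: "0 < h" "h \<le> real L * l" "s + h = s' + real j * l"
            proof -
              show "0 < h"
                using 2 Suc.prems by (simp add: h_def)
              show "h \<le> real L * l"
                unfolding h_def using j Suc.prems by (intro mult_right_mono) auto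
              show "s + h = s' + real j * l"
                using 2 s'(1) by (simp add: h_def of_nat_diff algebra_simps)
            qed
            have "X s l \<le> 2 * X (s + h) l + ennreal (h powr \<alpha>) * E"
              using step[rule_format, of s l h] h Suc.prems Ll jl unfolding X_def by simp
            also have "\<dots> \<le> 2 * X (s + h) l + ennreal ((real L * l) powr \<alpha>) * E"
              using h assms by (intro add_left_mono mult_right_mono ennreal_leI powr_mono2) auto
            finally show ?thesis
              using h by simp
          next
            case 3
            define h where "h = real (i - j) * l"
            have h: "0 < h" "h \<le> real L * l" "s = s' + real j * l + h"
            proof -
              show "0 < h"
                using 3 Suc.prems by (simp add: h_def)
              show "h \<le> real L * l"
                unfolding h_def using s'(2) Suc.prems by (intro mult_right_mono) auto
              show "s = s' + real j * l + h"
                using 3 s'(1) by (simp add: h_def of_nat_diff algebra_simps)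
            qed
            have "0 \<le> s' + real j * l"
              using s' Suc.prems by simp
            then have "X s l \<le> 2 * X (s' + real j * l) l + ennreal (h powr \<alpha>) * E"
              using step[rule_format, of "s' + real j * l" l h] h Suc.prems Ll unfolding X_def by simp
            also have "\<dots> \<le> 2 * X (s' + real j * l) l + ennreal ((real L * l) powr \<alpha>) * E"
              using h assms by (intro add_left_mono mult_right_mono ennreal_leI powr_mono2) auto
            finally show ?thesis .
          qed
        qed
        \<comment> \<open>Adding the comparisons with all \<open>L\<close> cells replaces the
          translates by the integral over the window, which the induction hypothesis controls; the
          division by \<open>L\<close> comes at the end.\<close>
        have "of_nat L * X s l = (\<Sum>j<L. X s l)"
          by simp
        also have "\<dots> \<le> (\<Sum>j<L. 2 * X (s' + real j * l) l + ennreal ((real L * l) powr \<alpha>) * E)"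
          by (rule sum_mono) (use trans in auto)
        also have "\<dots> = 2 * (\<Sum>j<L. X (s' + real j * l) l) + of_nat L * (ennreal ((real L * l) powr \<alpha>) * E)"
          by (simp add: sum.distrib sum_distrib_left)
        also have "\<dots> \<le> 2 * X s' (real L * l) + of_nat L * (ennreal ((real L * l) powr \<alpha>) * A)"
          unfolding X_def A_def using Suc.prems
          by (intro add_mono mult_left_mono sum_interval_integral_le[OF \<Phi>]) auto
        also have "\<dots> \<le> 2 * (ennreal (K * (real L * l) powr \<alpha>) * A) + of_nat L * (ennreal ((real L * l) powr \<alpha>) * A)"
          by (intro add_right_mono mult_left_mono IH) simp
        also have "\<dots> = ennreal (2 * (K * (real L * l) powr \<alpha>) + real L * (real L * l) powr \<alpha>) * A"
          using K by (simp add: ennreal_mult distrib_right mult.assoc ennreal_of_nat_eq_real_of_nat flip: ennreal_numeral)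
        also have "\<dots> \<le> ennreal (real L * (K * l powr \<alpha>)) * A"
        proof (intro mult_right_mono ennreal_leI)
          \<comment> \<open>First \<open>real L \<le> K\<close> absorbs the inhomogeneous term, then
            \<open>4 * real L powr \<alpha> \<le> real L\<close> closes the recursion: it reproduces
            its own constant.\<close>
          have "2 * K * real L powr \<alpha> + real L * real L powr \<alpha> \<le> 2 * K * real L powr \<alpha> + K * real L powr \<alpha>"
            using K by (intro add_left_mono mult_right_mono) auto
          also have "\<dots> \<le> K * (4 * real L powr \<alpha>)"
            using K by (simp add: algebra_simps)
          also have "\<dots> \<le> K * real L"
            using La K by (intro mult_left_mono) auto
          finally have "(2 * K * real L powr \<alpha> + real L * real L powr \<alpha>) * l powr \<alpha> \<le> (K * real L) * l powr \<alpha>"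
            by (rule mult_right_mono) simp
          then show "2 * (K * (real L * l) powr \<alpha>) + real L * (real L * l) powr \<alpha> \<le> real L * (K * l powr \<alpha>)"
            using Suc.prems by (simp add: powr_mult algebra_simps)
        qed simp
        also have "\<dots> = of_nat L * (ennreal (K * l powr \<alpha>) * A)"
          using K by (simp add: ennreal_mult mult.assoc ennreal_of_nat_eq_real_of_nat)
        finally show ?thesis
          using L by (subst (asm) ennreal_mult_le_mult_iff) (auto simp: ennreal_of_nat_eq_real_of_nat)
      qed
    qed
    moreover obtain N where "h1 / l \<le> real L ^ N"
      using real_arch_pow[of "real L" "h1 / l"] L by (auto intro: less_imp_le)
    ultimately show "interval_integral \<Phi> s l \<le> ennreal (K * l powr \<alpha>) * (E + interval_integral \<Phi> 0 T)"
      using sl unfolding X_def A_def by (simp add: field_simps)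
  qed
qed

text \<open>The mean inequality with exponent \<open>q / 2\<close>, for the weight 1/\<mu> on
  \<open>W\<close>. Taking \<mu> at least 1 allows the weight to be dropped from the
  \<open>L\<^sup>q\<close> integral, so that only the first power of \<mu> appears.\<close>

lemma (in parabolic_pair) slice_L2_le:
  assumes \<mu>: "emeasure lborel W \<le> ennreal \<mu>" "\<mu> \<ge> 1"
  shows "AE t in lborel. t \<in> {0<..<T} \<longrightarrow>
    (nn_integral_on W (\<lambda>x. (f (x, t))\<^sup>2)) \<le> ennreal (2 * \<mu>) * ennreal ((m t)\<^sup>2)"
  using f_Lq
proof eventually_elim
  case (elim t)
  have [measurable]: "W \<in> sets borel"
    using open_W by simp
  show ?case
  proof
    assume t: "t \<in> {0<..<T}"
    let ?w = "\<lambda>x. ennreal (1 / \<mu>) * indicator W x"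
    have "(\<integral>\<^sup>+x. ?w x * ennreal ((f (x, t))\<^sup>2) \<partial>lborel) \<le> ennreal (2 * (m t)\<^sup>2)"
    proof (rule weighted_mean_le[where p = "q / 2"])
      have "(\<integral>\<^sup>+x. ?w x \<partial>lborel) = ennreal (1 / \<mu>) * emeasure lborel W"
        by (simp add: nn_integral_cmult_indicator)
      also have "\<dots> \<le> ennreal (1 / \<mu>) * ennreal \<mu>"
        by (intro mult_left_mono \<mu>) simp
      also have "\<dots> = 1"
        using \<mu>(2) by (simp add: ennreal_mult[symmetric])
      finally show "(\<integral>\<^sup>+x. ?w x \<partial>lborel) \<le> 1" .
      have sq: "(y\<^sup>2) powr (q / 2) = \<bar>y\<bar> powr q" for y :: real
      proof -
        have "y\<^sup>2 = \<bar>y\<bar> powr 2"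
          by simp
        then show ?thesis
          by (simp only: powr_powr) simp
      qed
      have "(\<integral>\<^sup>+x. ?w x * ennreal (((f (x, t))\<^sup>2) powr (q / 2)) \<partial>lborel)
          \<le> (nn_integral_on W (\<lambda>x. \<bar>f (x, t)\<bar> powr q))"
      proof (rule nn_integral_mono)
        fix x
        have "ennreal (1 / \<mu>) * indicator W x \<le> 1 * indicator W x"
          using \<mu>(2) by (intro mult_right_mono) auto
        then show "?w x * ennreal (((f (x, t))\<^sup>2) powr (q / 2)) \<le> indicator W x * ennreal (\<bar>f (x, t)\<bar> powr q)"
          unfolding sq by (intro mult_right_mono) auto
      qed
      also have "\<dots> \<le> ennreal (((m t)\<^sup>2) powr (q / 2))"
        using elim t m_nonneg[of t] unfolding sq by simp
      finally show "(\<integral>\<^sup>+x. ?w x * ennreal (((f (x, t))\<^sup>2) powr (q / 2)) \<partial>lborel) \<le> ennreal (((m t)\<^sup>2) powr (q / 2))" .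
    qed (use q_ge in auto)
    then have "ennreal \<mu> * (\<integral>\<^sup>+x. ?w x * ennreal ((f (x, t))\<^sup>2) \<partial>lborel) \<le> ennreal \<mu> * ennreal (2 * (m t)\<^sup>2)"
      by (rule mult_left_mono) simp
    moreover have "ennreal \<mu> * (\<integral>\<^sup>+x. ?w x * ennreal ((f (x, t))\<^sup>2) \<partial>lborel)
        = (\<integral>\<^sup>+x. ennreal \<mu> * (?w x * ennreal ((f (x, t))\<^sup>2)) \<partial>lborel)"
      by (rule nn_integral_cmult[symmetric]) measurable
    moreover have "ennreal \<mu> * (?w x * ennreal ((f (x, t))\<^sup>2)) = indicator W x * ennreal ((f (x, t))\<^sup>2)" for x
      using \<mu>(2) by (simp add: mult.assoc[symmetric] ennreal_mult[symmetric])
    moreover have "ennreal \<mu> * ennreal (2 * (m t)\<^sup>2) = ennreal (2 * \<mu>) * ennreal ((m t)\<^sup>2)"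
      using \<mu>(2) by (simp only: ennreal_mult[symmetric] zero_le_power2 mult_nonneg_nonneg) (simp add: mult_ac ennreal_mult[symmetric])
    ultimately show "(nn_integral_on W (\<lambda>x. (f (x, t))\<^sup>2)) \<le> ennreal (2 * \<mu>) * ennreal ((m t)\<^sup>2)"
      by simp
  qed
qed

text \<open>The decay property is applied to the squared \<open>L\<^sup>2\<close> norm of the
  slices. Translated intervals are compared by
  \<open>u\<^sup>2 \<le> 2 * v\<^sup>2 + 2 * (u - v)\<^sup>2\<close> and the increment estimate,
  which yields the summand with \<open>k\<close>; the integral over the whole time interval yields
  the summand \<open>2 * \<mu>\<close>.\<close>

lemma (in parabolic_pair) short_time_L2:
  fixes b w :: "'a \<Rightarrow> real"
  assumes mol: "mollifier b w B" and cover: "cone_cover k R \<tau>0 W" and "R \<ge> 0" "\<tau>0 > 0"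
    and \<mu>: "emeasure lborel W \<le> ennreal \<mu>" "\<mu> \<ge> 1"
    and K: "is_decay_constant (1 + real DIM('a) / 2 - real DIM('a) / p) (\<tau>0\<^sup>2) T0 K" "K > 0" and "T \<ge> T0"
    and sl: "0 \<le> s" "0 < l" "s + l \<le> T"
  shows "interval_integral (\<lambda>t. nn_integral_on W (\<lambda>x. (f (x, t))\<^sup>2)) s l
    \<le> ennreal (K * (4 * (4 * real k * (12 * B * (R + 1)) powr p + 2 * 2 powr q) + 2 * \<mu>)
        * l powr (1 + real DIM('a) / 2 - real DIM('a) / p)) *
      (\<integral>\<^sup>+t. indicator {0<..<T} t * (ennreal ((m t)\<^sup>2) + ennreal ((n t)\<^sup>2)) \<partial>lborel)"
proof -
  have [measurable]: "W \<in> sets borel"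
    using open_W by simp
  let ?\<alpha> = "1 + real DIM('a) / 2 - real DIM('a) / p"
  let ?C = "4 * real k * (12 * B * (R + 1)) powr p + 2 * 2 powr q"
  let ?A = "\<integral>\<^sup>+t. indicator {0<..<T} t * (ennreal ((m t)\<^sup>2) + ennreal ((n t)\<^sup>2)) \<partial>lborel"
  define \<Phi> where "\<Phi> t = (nn_integral_on W (\<lambda>x. (f (x, t))\<^sup>2))" for t
  have [measurable]: "\<Phi> \<in> borel_measurable borel"
    unfolding \<Phi>_def by measurable
  have C: "?C \<ge> 0"
    by simp
  have total: "interval_integral \<Phi> 0 T \<le> ennreal (2 * \<mu>) * ?A"
  proof -
    have "interval_integral \<Phi> 0 T \<le> (\<integral>\<^sup>+t. ennreal (2 * \<mu>) * (indicator {0<..<T} t * (ennreal ((m t)\<^sup>2) + ennreal ((n t)\<^sup>2))) \<partial>lborel)"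
      unfolding interval_integral_def
    proof (rule nn_integral_mono_AE)
      show "AE t in lborel. indicator {0<..<0 + T} t * \<Phi> t \<le> ennreal (2 * \<mu>) * (indicator {0<..<T} t * (ennreal ((m t)\<^sup>2) + ennreal ((n t)\<^sup>2)))"
        using slice_L2_le[OF \<mu>]
      proof eventually_elim
        case (elim t)
        show ?case
        proof (cases "t \<in> {0<..<T}")
          case True
          then have "\<Phi> t \<le> ennreal (2 * \<mu>) * ennreal ((m t)\<^sup>2)"
            using elim by (simp add: \<Phi>_def)
          also have "\<dots> \<le> ennreal (2 * \<mu>) * (ennreal ((m t)\<^sup>2) + ennreal ((n t)\<^sup>2))"
            by (intro mult_left_mono) auto
          finally show ?thesis
            using True by simp
        qed simp
      qed
    qed
    also have "\<dots> = ennreal (2 * \<mu>) * ?A"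
      by (rule nn_integral_cmult) measurable
    finally show ?thesis .
  qed
  define \<Delta> where "\<Delta> h = (\<integral>\<^sup>+t. indicator {0<..<T - h} t * (nn_integral_on W (\<lambda>x. (f (x, t + h) - f (x, t))\<^sup>2)) \<partial>lborel)" for h
  have \<Delta>: "2 * \<Delta> h \<le> ennreal (h powr ?\<alpha>) * (ennreal (4 * ?C) * ?A)" if "0 < h" "h \<le> \<tau>0\<^sup>2" for h
  proof -
    have "2 * \<Delta> h \<le> 2 * (ennreal (2 * ?C * h powr ?\<alpha>) * ?A)"
      unfolding \<Delta>_def
      by (intro mult_left_mono integrated_difference_L2[OF mol cover \<open>R \<ge> 0\<close> that \<open>\<tau>0 > 0\<close>]) simp
    also have "\<dots> = (ennreal 2 * ennreal (2 * ?C * h powr ?\<alpha>)) * ?A"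
      by (simp only: mult.assoc ennreal_numeral)
    also have "ennreal 2 * ennreal (2 * ?C * h powr ?\<alpha>) = ennreal (h powr ?\<alpha>) * ennreal (4 * ?C)"
      using C by (subst (1 2) ennreal_mult[symmetric]) (auto simp: algebra_simps)
    finally show ?thesis
      by (simp only: mult.assoc)
  qed
  have step: "interval_integral \<Phi> s l \<le> 2 * interval_integral \<Phi> (s + h) l + 2 * \<Delta> h \<and>
      interval_integral \<Phi> (s + h) l \<le> 2 * interval_integral \<Phi> s l + 2 * \<Delta> h"
    if "0 \<le> s" "0 < l" "0 < h" "s + h + l \<le> T" for s l h
  proof -
    define D2 where "D2 t = (nn_integral_on W (\<lambda>x. (f (x, t + h) - f (x, t))\<^sup>2))" for t
    have [measurable]: "D2 \<in> borel_measurable borel"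
      unfolding D2_def by measurable
    have sq: "u\<^sup>2 \<le> 2 * v\<^sup>2 + 2 * (u - v)\<^sup>2" for u v :: real
      using zero_le_power2[of "u - 2 * v"] by (simp add: power2_eq_square algebra_simps)
    have sq': "ennreal (u\<^sup>2) \<le> 2 * ennreal (v\<^sup>2) + 2 * ennreal ((u - v)\<^sup>2)" for u v :: real
    proof -
      have "ennreal (u\<^sup>2) \<le> ennreal (2 * v\<^sup>2 + 2 * (u - v)\<^sup>2)"
        by (intro ennreal_leI sq)
      also have "\<dots> = 2 * ennreal (v\<^sup>2) + 2 * ennreal ((u - v)\<^sup>2)"
        by (simp add: ennreal_mult)
      finally show ?thesis .
    qed
    have split: "(nn_integral_on W (\<lambda>x. (u x)\<^sup>2))
        \<le> 2 * (nn_integral_on W (\<lambda>x. (v x)\<^sup>2)) + 2 * (nn_integral_on W (\<lambda>x. (u x - v x)\<^sup>2))"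
      if [measurable]: "u \<in> borel_measurable borel" "v \<in> borel_measurable borel" for u v :: "'a \<Rightarrow> real"
    proof -
      have "(nn_integral_on W (\<lambda>x. (u x)\<^sup>2))
        \<le> (\<integral>\<^sup>+x. 2 * (indicator W x * ennreal ((v x)\<^sup>2)) + 2 * (indicator W x * ennreal ((u x - v x)\<^sup>2)) \<partial>lborel)"
        using sq' by (intro nn_integral_mono) (auto simp: indicator_def)
      then show ?thesis
        by (simp add: nn_integral_add nn_integral_cmult)
    qed
    have "\<Phi> t \<le> 2 * \<Phi> (t + h) + 2 * D2 t" "\<Phi> (t + h) \<le> 2 * \<Phi> t + 2 * D2 t" for t
      unfolding \<Phi>_def D2_def using split[of "\<lambda>x. f (x, t)" "\<lambda>x. f (x, t + h)"] split[of "\<lambda>x. f (x, t + h)" "\<lambda>x. f (x, t)"]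
      by (simp_all add: power2_commute)
    note \<Phi>_le = this
    have eq: "interval_integral \<Phi> (s + h) l = (\<integral>\<^sup>+t. indicator {s<..<s + l} t * \<Phi> (t + h) \<partial>lborel)"
    proof -
      have "(\<integral>\<^sup>+t. indicator {s + h<..<s + h + l} (t + h) * \<Phi> (t + h) \<partial>lborel) = interval_integral \<Phi> (s + h) l"
        unfolding interval_integral_def
        by (rule nn_integral_lborel_shift[of "\<lambda>t. indicator {s + h<..<s + h + l} t * \<Phi> t"]) measurable
      moreover have "indicator {s + h<..<s + h + l} (t + h) = (indicator {s<..<s + l} t :: ennreal)" for t
        by (auto simp: indicator_def)
      ultimately show ?thesis
        by simp
    qed
    have D2: "(\<integral>\<^sup>+t. indicator {s<..<s + l} t * D2 t \<partial>lborel) \<le> \<Delta> h"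
      unfolding \<Delta>_def D2_def[symmetric] using that by (intro nn_integral_mono) (auto simp: indicator_def)
    have "interval_integral \<Phi> s l \<le> (\<integral>\<^sup>+t. 2 * (indicator {s<..<s + l} t * \<Phi> (t + h)) + 2 * (indicator {s<..<s + l} t * D2 t) \<partial>lborel)"
      unfolding interval_integral_def using \<Phi>_le by (intro nn_integral_mono) (auto simp: indicator_def)
    also have "\<dots> = 2 * interval_integral \<Phi> (s + h) l + 2 * (\<integral>\<^sup>+t. indicator {s<..<s + l} t * D2 t \<partial>lborel)"
      unfolding eq by (simp add: nn_integral_add nn_integral_cmult)
    also have "\<dots> \<le> 2 * interval_integral \<Phi> (s + h) l + 2 * \<Delta> h"
      by (intro add_left_mono mult_left_mono D2) simp
    finally have 1: "interval_integral \<Phi> s l \<le> 2 * interval_integral \<Phi> (s + h) l + 2 * \<Delta> h" .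
    have "interval_integral \<Phi> (s + h) l \<le> (\<integral>\<^sup>+t. 2 * (indicator {s<..<s + l} t * \<Phi> t) + 2 * (indicator {s<..<s + l} t * D2 t) \<partial>lborel)"
      unfolding eq using \<Phi>_le by (intro nn_integral_mono) (auto simp: indicator_def)
    also have "\<dots> = 2 * interval_integral \<Phi> s l + 2 * (\<integral>\<^sup>+t. indicator {s<..<s + l} t * D2 t \<partial>lborel)"
      unfolding interval_integral_def by (simp add: nn_integral_add nn_integral_cmult)
    also have "\<dots> \<le> 2 * interval_integral \<Phi> s l + 2 * \<Delta> h"
      by (intro add_left_mono mult_left_mono D2) simp
    finally show ?thesis
      using 1 by blast
  qed
  have "interval_integral \<Phi> s l \<le> ennreal (K * l powr ?\<alpha>) * (ennreal (4 * ?C) * ?A + interval_integral \<Phi> 0 T)"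
  proof (rule K(1)[unfolded is_decay_constant_def, rule_format, OF _ \<open>T \<ge> T0\<close> _ sl])
    fix s l h :: real
    assume slh: "0 \<le> s" "0 < l" "0 < h" "h \<le> \<tau>0\<^sup>2" "s + h + l \<le> T"
    show "interval_integral \<Phi> s l \<le> 2 * interval_integral \<Phi> (s + h) l + ennreal (h powr ?\<alpha>) * (ennreal (4 * ?C) * ?A) \<and>
      interval_integral \<Phi> (s + h) l \<le> 2 * interval_integral \<Phi> s l + ennreal (h powr ?\<alpha>) * (ennreal (4 * ?C) * ?A)"
      using step[OF slh(1,2,3,5)] add_left_mono[OF \<Delta>[OF slh(3,4)]] by (meson order_trans)
  qed measurable
  also have "\<dots> \<le> ennreal (K * l powr ?\<alpha>) * (ennreal (4 * ?C) * ?A + ennreal (2 * \<mu>) * ?A)"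
    by (intro mult_left_mono add_left_mono total) simp
  also have "\<dots> = (ennreal (K * l powr ?\<alpha>) * ennreal (4 * ?C + 2 * \<mu>)) * ?A"
    using C \<mu>(2) by (subst ennreal_plus) (auto simp: distrib_right mult.assoc)
  also have "ennreal (K * l powr ?\<alpha>) * ennreal (4 * ?C + 2 * \<mu>) = ennreal (K * (4 * ?C + 2 * \<mu>) * l powr ?\<alpha>)"
    using C \<mu>(2) K(2) by (subst ennreal_mult[symmetric]) (auto simp: mult_ac)
  finally show ?thesis
    unfolding \<Phi>_def .
qed

subsection \<open>Geometry of Lipschitz domains\<close>

text \<open>A connected set that meets both \<open>S\<close> and its complement meets the
  frontier.\<close>

lemma ball_subset_if_disjoint_frontier:
  fixes x :: "'a::real_normed_vector"
  assumes "x \<in> S" "r > 0" "ball x r \<inter> frontier S = {}"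
  shows "ball x r \<subseteq> S"
  using connected_Int_frontier[OF connected_ball, of x r S] assms by (metis Diff_eq_empty_iff IntI centre_in_ball empty_iff)

text \<open>In a chart the axis is \<open>(M + 1) *\<^sub>R \<nu>\<close>: a step
  \<open>\<tau> *\<^sub>R (c + y)\<close> gains height at least \<open>M * \<tau>\<close>, while its
  horizontal part has length at most \<tau> and raises the graph by at most
  \<open>M * \<tau>\<close>. Steps have length at most r0/4, so they lead from the balls of radius
  3/2 r0 only into the doubled balls. Points farther than 5/4 r0 from all centres are at distance at
  least r0/4 from the boundary and form one further piece, hence \<open>Suc N\<close>.\<close>

lemma lipschitz_domain_cone_cover:
  fixes \<Omega> :: "'a::euclidean_space set"
  assumes dom: "bounded_lipschitz_domain r0 M N \<Omega>"
  shows "cone_cover (Suc N) (\<bar>M\<bar> + 1) (r0 / (4 * (\<bar>M\<bar> + 2))) \<Omega>"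
proof -
  \<comment> \<open>The modulus of \<open>M\<close> is taken because \<open>M \<ge> 0\<close>
    becomes available only once a chart is at hand.\<close>
  let ?\<tau> = "r0 / (4 * (\<bar>M\<bar> + 2))"
  obtain Z where "open \<Omega>" "r0 > 0" and Z: "finite Z" "card Z \<le> N" "frontier \<Omega> \<subseteq> (\<Union>z\<in>Z. ball z r0)"
    and graph: "\<And>z. z \<in> Z \<Longrightarrow> \<exists>\<nu> \<psi>. norm \<nu> = 1 \<and> M-lipschitz_on {y. y \<bullet> \<nu> = 0} \<psi> \<and>
          \<Omega> \<inter> ball z (2 * r0) = {x \<in> ball z (2 * r0). \<psi> (x - (x \<bullet> \<nu>) *\<^sub>R \<nu>) < x \<bullet> \<nu>}"
    using dom unfolding bounded_lipschitz_domain_def by blast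
  have \<tau>: "?\<tau> > 0" "?\<tau> * (\<bar>M\<bar> + 2) = r0 / 4" "?\<tau> < r0 / 4"
    using \<open>r0 > 0\<close> by (auto simp: field_simps add_pos_nonneg)
  have boundary: "\<exists>c. norm c \<le> \<bar>M\<bar> + 1 \<and> cone_condition (\<Omega> \<inter> ball z (3 / 2 * r0)) \<Omega> c ?\<tau>" if z: "z \<in> Z" for z
  proof -
    obtain \<nu> \<psi> where \<nu>: "norm \<nu> = 1" and lip: "M-lipschitz_on {y. y \<bullet> \<nu> = 0} \<psi>"
      and eq: "\<Omega> \<inter> ball z (2 * r0) = {x \<in> ball z (2 * r0). \<psi> (x - (x \<bullet> \<nu>) *\<^sub>R \<nu>) < x \<bullet> \<nu>}"
      using graph[OF z] by blast
    have M: "M \<ge> 0"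
      using lipschitz_on_nonneg[OF lip] .
    have \<nu>\<nu>: "\<nu> \<bullet> \<nu> = 1"
      using \<nu> by (simp add: dot_square_norm)
    define P where "P x = x - (x \<bullet> \<nu>) *\<^sub>R \<nu>" for x
    have P0: "P x \<bullet> \<nu> = 0" for x
      by (simp add: P_def inner_diff_left \<nu>\<nu>)
    have Pnorm: "norm (P y) \<le> norm y" for y
    proof -
      have "(norm (P y))\<^sup>2 = (norm y)\<^sup>2 - (y \<bullet> \<nu>)\<^sup>2"
      proof -
        have "P y \<bullet> P y = P y \<bullet> y - (y \<bullet> \<nu>) * (P y \<bullet> \<nu>)"
          unfolding P_def[of y] by (simp add: inner_diff_right)
        also have "\<dots> = y \<bullet> y - (y \<bullet> \<nu>)\<^sup>2"
          unfolding P0 by (simp add: P_def inner_diff_left power2_eq_square inner_commute[of \<nu> y])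
        finally show ?thesis
          by (simp only: power2_norm_eq_inner)
      qed
      then have "(norm (P y))\<^sup>2 \<le> (norm y)\<^sup>2"
        by simp
      then show ?thesis
        by (rule power2_le_imp_le) simp
    qed
    let ?c = "(M + 1) *\<^sub>R \<nu>"
    have "cone_condition (\<Omega> \<inter> ball z (3 / 2 * r0)) \<Omega> ?c ?\<tau>"
      unfolding cone_condition_def
    proof (intro ballI allI impI)
      fix x y :: 'a and \<tau> :: real
      assume x: "x \<in> \<Omega> \<inter> ball z (3 / 2 * r0)" and y: "norm y \<le> 1" and t: "0 \<le> \<tau> \<and> \<tau> \<le> ?\<tau>"
      let ?x = "x + \<tau> *\<^sub>R (?c + y)"
      have "norm (?c + y) \<le> \<bar>M\<bar> + 2"
        using norm_triangle_ineq[of ?c y] y \<nu> M by simp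
      then have "norm (\<tau> *\<^sub>R (?c + y)) \<le> ?\<tau> * (\<bar>M\<bar> + 2)"
        unfolding norm_scaleR using t by (intro mult_mono) auto
      then have dist: "dist x ?x \<le> r0 / 4"
        unfolding \<tau>(2) by (simp add: dist_norm)
      have zx: "dist z x < 3 / 2 * r0"
        using x by simp
      have ball2: "x \<in> ball z (2 * r0)" "?x \<in> ball z (2 * r0)"
        using zx dist dist_triangle[of z ?x x] \<open>r0 > 0\<close> unfolding mem_ball by linarith+
      have "\<psi> (P x) < x \<bullet> \<nu>"
        using x ball2(1) eq unfolding P_def by blast
      have "P ?x - P x = \<tau> *\<^sub>R P y"
        by (simp add: P_def inner_add_left \<nu>\<nu> algebra_simps)
      then have "dist (P ?x) (P x) \<le> \<tau>"
        using t y Pnorm[of y] by (simp add: dist_norm mult_left_le order_trans)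
      then have "M * dist (P ?x) (P x) \<le> M * \<tau>"
        using M by (rule mult_left_mono)
      moreover have "dist (\<psi> (P ?x)) (\<psi> (P x)) \<le> M * dist (P ?x) (P x)"
        using lipschitz_onD[OF lip, of "P ?x" "P x"] P0 by simp
      ultimately have "\<psi> (P ?x) \<le> \<psi> (P x) + M * \<tau>"
        unfolding dist_real_def by linarith
      moreover have "x \<bullet> \<nu> + M * \<tau> \<le> ?x \<bullet> \<nu>"
      proof -
        have "\<bar>y \<bullet> \<nu>\<bar> \<le> 1"
          using Cauchy_Schwarz_ineq2[of y \<nu>] \<nu> y by simp
        then have "\<tau> * (M + 1 + y \<bullet> \<nu>) \<ge> \<tau> * M"
          using t by (intro mult_left_mono) auto
        then show ?thesis
          by (simp add: inner_add_left \<nu>\<nu> mult_ac)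
      qed
      ultimately have "\<psi> (P ?x) < ?x \<bullet> \<nu>"
        using \<open>\<psi> (P x) < x \<bullet> \<nu>\<close> by linarith
      then show "?x \<in> \<Omega>"
        using ball2(2) eq unfolding P_def by blast
    qed
    moreover have "norm ?c \<le> \<bar>M\<bar> + 1"
      using \<nu> M by simp
    ultimately show ?thesis
      by blast
  qed
  have "\<forall>z. \<exists>c. z \<in> Z \<longrightarrow> norm c \<le> \<bar>M\<bar> + 1 \<and> cone_condition (\<Omega> \<inter> ball z (3 / 2 * r0)) \<Omega> c ?\<tau>"
    using boundary by blast
  from choice[OF this] obtain c where
    c: "\<And>z. z \<in> Z \<Longrightarrow> norm (c z) \<le> \<bar>M\<bar> + 1 \<and> cone_condition (\<Omega> \<inter> ball z (3 / 2 * r0)) \<Omega> (c z) ?\<tau>"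
    by blast
  \<comment> \<open>Removing closed balls keeps this set open, and their radius 5/4 r0 is below 3/2
    r0, so together with the boundary pieces it covers \<Omega>.\<close>
  define U0 where "U0 = \<Omega> - (\<Union>z\<in>Z. cball z (5 / 4 * r0))"
  have U0: "open U0" "cone_condition U0 \<Omega> 0 ?\<tau>"
  proof -
    have "closed (\<Union>z\<in>Z. cball z (5 / 4 * r0))"
      using Z(1) by (intro closed_UN) auto
    then show "open U0"
      unfolding U0_def using \<open>open \<Omega>\<close> by (rule open_Diff[rotated])
    show "cone_condition U0 \<Omega> 0 ?\<tau>"
      unfolding cone_condition_def
    proof (intro ballI allI impI)
      fix x y :: 'a and \<tau> :: real
      assume x: "x \<in> U0" and y: "norm y \<le> 1" and t: "0 \<le> \<tau> \<and> \<tau> \<le> ?\<tau>"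
      have "ball x (r0 / 4) \<inter> frontier \<Omega> = {}"
      proof -
        have False if v: "v \<in> ball x (r0 / 4)" "v \<in> frontier \<Omega>" for v
        proof -
          obtain z where z: "z \<in> Z" "dist z v < r0"
            using v(2) Z(3) by auto
          moreover have "dist z x \<le> dist z v + dist x v"
            by (metis dist_commute dist_triangle)
          ultimately have "dist z x \<le> 5 / 4 * r0"
            using v(1) by simp
          then show False
            using x z(1) by (auto simp: U0_def)
        qed
        then show ?thesis
          by blast
      qed
      then have "ball x (r0 / 4) \<subseteq> \<Omega>"
        using x \<open>r0 > 0\<close> by (intro ball_subset_if_disjoint_frontier) (auto simp: U0_def)
      moreover have "norm (\<tau> *\<^sub>R (0 + y)) < r0 / 4"
      proof -
        have "norm (\<tau> *\<^sub>R (0 + y)) \<le> ?\<tau> * 1"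
          unfolding norm_scaleR using t y by (intro mult_mono) auto
        then show ?thesis
          using \<tau>(3) by linarith
      qed
      ultimately show "x + \<tau> *\<^sub>R (0 + y) \<in> \<Omega>"
        by (auto simp: dist_norm)
    qed
  qed
  let ?F = "insert (U0, 0) ((\<lambda>z. (\<Omega> \<inter> ball z (3 / 2 * r0), c z)) ` Z)"
  show ?thesis
    unfolding cone_cover_def
  proof (intro exI[of _ ?F] conjI)
    show "finite ?F"
      using Z(1) by simp
    have "card ?F \<le> Suc (card ((\<lambda>z. (\<Omega> \<inter> ball z (3 / 2 * r0), c z)) ` Z))"
      by (rule card_insert_le_m1) auto
    also have "\<dots> \<le> Suc N"
      using card_image_le[OF Z(1)] Z(2) order_trans by auto
    finally show "card ?F \<le> Suc N" .
    show "\<Omega> \<subseteq> (\<Union>(U, c)\<in>?F. U)"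
    proof
      fix x assume x: "x \<in> \<Omega>"
      show "x \<in> (\<Union>(U, c)\<in>?F. U)"
      proof (cases "\<exists>z\<in>Z. dist z x < 3 / 2 * r0")
        case True
        then show ?thesis
          using x by auto
      next
        case False
        then have "x \<in> U0"
          using x \<open>r0 > 0\<close> by (force simp: U0_def)
        then show ?thesis
          by auto
      qed
    qed
    show "\<forall>(U, c)\<in>?F. open U \<and> norm c \<le> \<bar>M\<bar> + 1 \<and> cone_condition U \<Omega> c ?\<tau>"
      using U0 c \<open>open \<Omega>\<close> by auto
  qed
qed

text \<open>A connected domain has points at every height between those of \<open>x\<close> and
  \<open>y\<close>. A line through such a point along a second coordinate axis must leave the
  bounded set \<Omega>, and it meets the boundary at the same height. So the heights are covered by
  the projections of at most \<open>N\<close> balls, intervals of length \<open>2 * r0\<close>. The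
  second axis is where the dimension has to be at least 2.\<close>

lemma lipschitz_domain_width_le:
  fixes \<Omega> :: "'a::euclidean_space set"
  assumes dom: "bounded_lipschitz_domain r0 M N \<Omega>" and dim: "DIM('a) \<ge> 2"
    and x: "x \<in> \<Omega>" "y \<in> \<Omega>" and i: "i \<in> Basis"
  shows "y \<bullet> i - x \<bullet> i \<le> 2 * real N * r0"
proof (cases "x \<bullet> i \<le> y \<bullet> i")
  case True
  obtain Z where "connected \<Omega>" "bounded \<Omega>" "r0 > 0" and Z: "finite Z" "card Z \<le> N" "frontier \<Omega> \<subseteq> (\<Union>z\<in>Z. ball z r0)"
    using dom unfolding bounded_lipschitz_domain_def by auto
  obtain j :: 'a where j: "j \<in> Basis" "j \<noteq> i"
  proof -
    have "card (Basis - {i} :: 'a set) \<ge> 1"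
      using dim i by (simp add: card_Diff_singleton)
    then show ?thesis
      using that by (metis Diff_iff card.empty ex_in_conv not_one_le_zero singletonI)
  qed
  have ji: "j \<bullet> i = 0" "norm j = 1"
    using i j by (auto simp: inner_Basis)
  have cover: "{x \<bullet> i..y \<bullet> i} \<subseteq> (\<Union>z\<in>Z. {z \<bullet> i - r0..z \<bullet> i + r0})"
  proof
    fix a assume "a \<in> {x \<bullet> i..y \<bullet> i}"
    then obtain v where v: "v \<in> \<Omega>" "v \<bullet> i = a"
      using connected_ivt_component[OF \<open>connected \<Omega>\<close> x] by auto
    obtain b where b: "\<And>u. u \<in> \<Omega> \<Longrightarrow> norm u \<le> b"
      using \<open>bounded \<Omega>\<close> by (auto simp: bounded_iff)
    let ?l = "range (\<lambda>t::real. v + t *\<^sub>R j)"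
    \<comment> \<open>Two points of \<Omega> are at distance at most \<open>2 * b\<close>, so a step
      of length \<open>2 * b + 1\<close> leaves it.\<close>
    have "v + (2 * b + 1) *\<^sub>R j \<notin> \<Omega>"
    proof
      assume "v + (2 * b + 1) *\<^sub>R j \<in> \<Omega>"
      moreover have "norm ((2 * b + 1) *\<^sub>R j) \<le> norm (v + (2 * b + 1) *\<^sub>R j) + norm v"
        using norm_triangle_ineq4[of "v + (2 * b + 1) *\<^sub>R j" v] by simp
      moreover have "b \<ge> 0"
        using b[OF v(1)] norm_ge_zero[of v] by linarith
      ultimately show False
        using b[of "v + (2 * b + 1) *\<^sub>R j"] b[OF v(1)] ji(2) by simp
    qed
    then have "?l - \<Omega> \<noteq> {}"
      by blast
    moreover have "?l \<inter> \<Omega> \<noteq> {}"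
    proof -
      have "v \<in> ?l"
        by (rule range_eqI[of _ _ 0]) simp
      then show ?thesis
        using v(1) by blast
    qed
    moreover have "connected ?l"
      by (intro connected_continuous_image continuous_intros connected_UNIV)
    ultimately obtain t where "v + t *\<^sub>R j \<in> frontier \<Omega>"
      using connected_Int_frontier[of ?l \<Omega>] by blast
    then obtain z where z: "z \<in> Z" "dist z (v + t *\<^sub>R j) < r0"
      using Z(3) by auto
    have "\<bar>(z - (v + t *\<^sub>R j)) \<bullet> i\<bar> < r0"
      using Basis_le_norm[OF i, of "z - (v + t *\<^sub>R j)"] z(2) by (simp add: dist_norm)
    then have "\<bar>z \<bullet> i - a\<bar> < r0"
      using v(2) ji(1) by (simp add: inner_diff_left inner_add_left)
    then show "a \<in> (\<Union>z\<in>Z. {z \<bullet> i - r0..z \<bullet> i + r0})"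
      using z(1) by (force simp: abs_less_iff)
  qed
  have "ennreal (y \<bullet> i - x \<bullet> i) = emeasure lborel {x \<bullet> i..y \<bullet> i}"
    using True by simp
  also have "\<dots> \<le> emeasure lborel (\<Union>z\<in>Z. {z \<bullet> i - r0..z \<bullet> i + r0})"
    using Z(1) by (intro emeasure_mono cover) auto
  also have "\<dots> \<le> (\<Sum>z\<in>Z. emeasure lborel {z \<bullet> i - r0..z \<bullet> i + r0})"
    using Z(1) by (intro emeasure_subadditive_finite) auto
  also have "\<dots> = ennreal (real (card Z) * (2 * r0))"
    using \<open>r0 > 0\<close> by (simp add: ennreal_mult ennreal_of_nat_eq_real_of_nat)
  also have "\<dots> \<le> ennreal (2 * real N * r0)"
    using Z(2) \<open>r0 > 0\<close> by (intro ennreal_leI) simp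
  finally show ?thesis
    using \<open>r0 > 0\<close> by simp
next
  case False
  have "r0 > 0"
    using dom by (simp add: bounded_lipschitz_domain_def)
  then have "0 \<le> 2 * real N * r0"
    by simp
  then show ?thesis
    using False by linarith
qed

text \<open>The width bound holds in every coordinate and in both directions, so \<Omega> fits into
  a cube centred at any of its points.\<close>

lemma lipschitz_domain_volume_le:
  fixes \<Omega> :: "'a::euclidean_space set"
  assumes dom: "bounded_lipschitz_domain r0 M N \<Omega>" and dim: "DIM('a) \<ge> 2"
  shows "emeasure lborel \<Omega> \<le> ennreal ((4 * real N * r0) ^ DIM('a))"
proof -
  obtain x where x: "x \<in> \<Omega>" and "r0 > 0"
    using dom by (auto simp: bounded_lipschitz_domain_def)
  let ?w = "2 * real N * r0"
  have w: "?w \<ge> 0"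
    using \<open>r0 > 0\<close> by simp
  have "\<Omega> \<subseteq> cbox (x - ?w *\<^sub>R One) (x + ?w *\<^sub>R One)"
  proof
    fix y assume y: "y \<in> \<Omega>"
    have "x \<bullet> i - ?w \<le> y \<bullet> i \<and> y \<bullet> i \<le> x \<bullet> i + ?w" if "i \<in> Basis" for i
      using lipschitz_domain_width_le[OF dom dim x y that] lipschitz_domain_width_le[OF dom dim y x that] by linarith
    then show "y \<in> cbox (x - ?w *\<^sub>R One) (x + ?w *\<^sub>R One)"
      by (simp add: mem_box inner_diff_left inner_add_left)
  qed
  then have "emeasure lborel \<Omega> \<le> emeasure lborel (cbox (x - ?w *\<^sub>R One) (x + ?w *\<^sub>R One))"
    by (rule emeasure_mono) simp
  also have "\<dots> = ennreal (\<Prod>i\<in>Basis. (x + ?w *\<^sub>R One) \<bullet> i - (x - ?w *\<^sub>R One) \<bullet> i)"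
    using w by (subst emeasure_lborel_cbox) (auto simp: inner_diff_left inner_add_left inner_diff_right)
  also have "(\<Prod>i\<in>Basis. (x + ?w *\<^sub>R One) \<bullet> i - (x - ?w *\<^sub>R One) \<bullet> i) = (4 * real N * r0) ^ DIM('a)"
  proof -
    have "(\<Prod>i\<in>Basis. (x + ?w *\<^sub>R One) \<bullet> i - (x - ?w *\<^sub>R One) \<bullet> i) = (\<Prod>i\<in>(Basis::'a set). 4 * real N * r0)"
      by (rule prod.cong) (simp_all add: inner_diff_left inner_add_left)
    then show ?thesis
      by (simp only: prod_constant)
  qed
  finally show ?thesis .
qed

subsection \<open>From the function spaces to integral bounds\<close>

text \<open>Equality is required on \<open>U\<close> only, so that \<open>f\<close> may be a
  component cut off by an indicator.\<close>

lemma locally_integrable_component: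
  fixes v :: "'a::euclidean_space \<Rightarrow> 'b::euclidean_space"
  assumes v: "locally_integrable U v" and eq: "\<And>x. x \<in> U \<Longrightarrow> f x = v x \<bullet> i"
  shows "locally_integrable U f"
proof -
  have ind: "indicator S x *\<^sub>R f x = (indicator S x *\<^sub>R v x) \<bullet> i" if "S \<subseteq> U" for S x
    using eq[of x] that by (auto simp: indicator_def)
  show ?thesis
    using v unfolding locally_integrable_def set_borel_measurable_def set_integrable_def
    by (auto simp only: ind subset_refl intro!: borel_measurable_inner borel_measurable_const integrable_inner_left)
qed

lemma weak_deriv_component:
  fixes v V :: "'a::euclidean_space \<Rightarrow> 'b::euclidean_space"
  assumes wd: "weak_deriv U e v V" and f: "\<And>x. x \<in> U \<Longrightarrow> f x = v x \<bullet> i" and g: "\<And>x. x \<in> U \<Longrightarrow> g x = V x \<bullet> i"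
  shows "weak_deriv U e f g"
  unfolding weak_deriv_def
proof (intro conjI ballI)
  have li: "locally_integrable U v" "locally_integrable U V"
    using wd by (auto simp: weak_deriv_def)
  show "locally_integrable U f" "locally_integrable U g"
    using locally_integrable_component[OF li(1) f] locally_integrable_component[OF li(2) g] by auto
  fix \<phi> assume \<phi>: "\<phi> \<in> test_functions U"
  obtain K where K: "compact K" "K \<subseteq> U" "continuous_on UNIV \<phi>" "\<And>x. x \<notin> K \<Longrightarrow> \<phi> x = 0"
    "continuous_on UNIV (\<lambda>x. frechet_derivative \<phi> (at x) e)" "\<And>x. x \<notin> K \<Longrightarrow> frechet_derivative \<phi> (at x) e = 0"
    using test_functionE[OF \<phi>] by metis
  have comp: "(LINT x:U|lborel. \<theta> x *\<^sub>R F x) = (LINT x:U|lborel. \<theta> x *\<^sub>R H x) \<bullet> i"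
    if "locally_integrable U H" "continuous_on UNIV \<theta>" "\<And>x. x \<notin> K \<Longrightarrow> \<theta> x = 0" "\<And>x. x \<in> U \<Longrightarrow> F x = H x \<bullet> i"
    for \<theta> F :: "'a \<Rightarrow> real" and H :: "'a \<Rightarrow> 'b"
  proof -
    have "integrable lborel (\<lambda>x. indicator U x *\<^sub>R (\<theta> x *\<^sub>R H x))"
      using set_integral_bounded_on_compact(1)[OF that(1) K(1,2) that(2,3)] by (simp add: set_integrable_def)
    from integral_inner_left[OF this, of i]
    have "(LINT x:U|lborel. \<theta> x *\<^sub>R H x) \<bullet> i = (LINT x|lborel. (indicator U x *\<^sub>R (\<theta> x *\<^sub>R H x)) \<bullet> i)"
      by (simp add: set_lebesgue_integral_def)
    also have "\<dots> = (LINT x:U|lborel. \<theta> x *\<^sub>R F x)"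
      unfolding set_lebesgue_integral_def using that(4)
      by (intro Bochner_Integration.integral_cong) (auto simp: indicator_def)
    finally show ?thesis ..
  qed
  have "(LINT x:U|lborel. frechet_derivative \<phi> (at x) e *\<^sub>R f x) = (LINT x:U|lborel. frechet_derivative \<phi> (at x) e *\<^sub>R v x) \<bullet> i"
    by (rule comp[OF li(1) K(5) K(6) f])
  also have "\<dots> = - ((LINT x:U|lborel. \<phi> x *\<^sub>R V x) \<bullet> i)"
    using wd \<phi> by (simp add: weak_deriv_def)
  also have "(LINT x:U|lborel. \<phi> x *\<^sub>R V x) \<bullet> i = (LINT x:U|lborel. \<phi> x *\<^sub>R g x)"
    by (rule comp[OF li(2) K(3) K(4) g, symmetric])
  finally show "(LINT x:U|lborel. frechet_derivative \<phi> (at x) e *\<^sub>R f x) = - (LINT x:U|lborel. \<phi> x *\<^sub>R g x)" .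
qed

text \<open>Translates the norm, defined by a Bochner integral, into a nonnegative integral;
  membership in \<open>Lp\<close> excludes the default value 0 of a divergent Bochner
  integral.\<close>

lemma nn_integral_eq_Lp_norm:
  fixes f :: "'a::euclidean_space \<Rightarrow> 'b::euclidean_space"
  assumes "f \<in> Lp p U" "p > 0"
  shows "(nn_integral_on U (\<lambda>x. norm (f x) powr p)) = ennreal (Lp_norm p U f powr p)"
proof -
  have int: "integrable lborel (\<lambda>x. indicator U x *\<^sub>R (norm (f x) powr p))"
    using assms by (simp add: Lp_def set_integrable_def)
  have "(nn_integral_on U (\<lambda>x. norm (f x) powr p)) = (\<integral>\<^sup>+x. ennreal (indicator U x *\<^sub>R (norm (f x) powr p)) \<partial>lborel)"
    by (rule nn_integral_cong) (auto simp: indicator_def)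
  also have "\<dots> = ennreal (LINT x:U|lborel. norm (f x) powr p)"
    unfolding set_lebesgue_integral_def by (rule nn_integral_eq_integral[OF int]) (auto simp: indicator_def)
  also have "(LINT x:U|lborel. norm (f x) powr p) = Lp_norm p U f powr p"
  proof -
    have "(LINT x:U|lborel. norm (f x) powr p) \<ge> 0"
      unfolding set_lebesgue_integral_def by (rule integral_nonneg_AE) (auto simp: indicator_def)
    then show ?thesis
      using assms(2) by (simp add: Lp_norm_def powr_powr)
  qed
  finally show ?thesis .
qed

lemma Lp_norm_nonneg: "Lp_norm p U f \<ge> 0"
  by (simp add: Lp_norm_def)

text \<open>\<open>weak_gradient\<close> is an arbitrary choice. As weak derivatives agree almost
  everywhere, its norm can be computed from whichever gradient is at hand.\<close>

lemma Lp_norm_gradient_size_cong: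
  fixes v :: "'a::euclidean_space \<Rightarrow> 'b::euclidean_space"
  assumes "open U" and V: "is_weak_gradient U v V" and V': "is_weak_gradient U v V'"
  shows "Lp_norm p U (gradient_size V) = Lp_norm p U (gradient_size V')"
proof -
  have [measurable]: "U \<in> sets borel"
    using \<open>open U\<close> by simp
  have meas: "(\<lambda>x. indicator U x *\<^sub>R (norm (gradient_size Y x) powr p)) \<in> borel_measurable lborel"
    if "is_weak_gradient U v Y" for Y
  proof -
    have Y: "(\<lambda>x. indicator U x *\<^sub>R Y i x) \<in> borel_measurable lborel" if "i \<in> Basis" for i
      using \<open>is_weak_gradient U v Y\<close> that
      by (simp add: is_weak_gradient_def weak_deriv_def locally_integrable_def set_borel_measurable_def)
    have [measurable]: "gradient_size (\<lambda>i x. indicator U x *\<^sub>R Y i x) \<in> borel_measurable borel"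
      using Y by (intro borel_measurable_gradient_size) simp
    \<comment> \<open>Only the products with the indicator are known to be measurable, and they give
      the same integrand.\<close>
    have eq: "(\<lambda>x. indicator U x *\<^sub>R (norm (gradient_size Y x) powr p))
        = (\<lambda>x. indicator U x *\<^sub>R (norm (gradient_size (\<lambda>i x. indicator U x *\<^sub>R Y i x) x) powr p))"
      by (rule ext) (simp add: indicator_def gradient_size_def)
    show ?thesis
      unfolding eq by measurable
  qed
  have "AE x in lborel. \<forall>i\<in>Basis. x \<in> U \<longrightarrow> V i x = V' i x"
    using V V' weak_deriv_unique[OF \<open>open U\<close>] unfolding is_weak_gradient_def
    by (intro AE_finite_allI[OF finite_Basis]) blast
  then have "AE x in lborel. indicator U x *\<^sub>R (norm (gradient_size V x) powr p) = indicator U x *\<^sub>R (norm (gradient_size V' x) powr p)"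
    by eventually_elim (auto simp: indicator_def gradient_size_def)
  then have "(LINT x:U|lborel. norm (gradient_size V x) powr p) = (LINT x:U|lborel. norm (gradient_size V' x) powr p)"
    unfolding set_lebesgue_integral_def by (rule integral_cong_AE[OF meas[OF V] meas[OF V']])
  then show ?thesis
    by (simp add: Lp_norm_def)
qed

text \<open>A component of \<open>V j\<close> is at most its norm, so on \<open>U\<close> the
  gradient of the component is pointwise no larger than that of \<open>v\<close>.\<close>

lemma hom_sobolev_component:
  fixes v :: "'a::euclidean_space \<Rightarrow> 'a" and i :: 'a
  assumes v: "v \<in> hom_sobolev p U" and "open U" and "p > 0" and i: "i \<in> Basis"
    and f: "\<And>x. x \<in> U \<Longrightarrow> f x = v x \<bullet> i"
  shows "\<exists>V. is_weak_gradient U f V \<and> (\<forall>j\<in>Basis. V j \<in> borel_measurable borel) \<and>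
      (nn_integral_on U (\<lambda>x. gradient_size V x powr p)) \<le> ennreal (hom_sobolev_norm p U v powr p)"
proof -
  have [measurable]: "U \<in> sets borel"
    using \<open>open U\<close> by simp
  obtain V where V: "is_weak_gradient U v V" "gradient_size V \<in> Lp p U"
    using v by (auto simp: hom_sobolev_def)
  \<comment> \<open>The cut-off outside \<open>U\<close>, where nothing is known about
    \<open>V\<close>, makes every \<open>Y j\<close> with \<open>j\<close> in the basis a Borel
    function on the whole space.\<close>
  define Y where "Y j x = indicator U x *\<^sub>R V j x \<bullet> i" for j x
  have "is_weak_gradient U v (weak_gradient U v)"
    unfolding weak_gradient_def by (rule someI[of "is_weak_gradient U v", OF V(1)])
  from Lp_norm_gradient_size_cong[OF \<open>open U\<close> V(1) this, of p]
  have le: "Lp_norm p U (gradient_size V) \<le> hom_sobolev_norm p U v"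
    using Lp_norm_nonneg[of "sobolev_exponent TYPE('a) p" U v] by (simp add: hom_sobolev_norm_def)
  have "is_weak_gradient U f Y"
    unfolding is_weak_gradient_def
  proof
    fix j :: 'a assume "j \<in> Basis"
    then have "weak_deriv U j v (V j)"
      using V(1) by (simp add: is_weak_gradient_def)
    then show "weak_deriv U j f (Y j)"
      by (rule weak_deriv_component) (auto simp: f Y_def)
  qed
  moreover have "\<forall>j\<in>Basis. Y j \<in> borel_measurable borel"
  proof
    fix j :: 'a assume "j \<in> Basis"
    then have "(\<lambda>x. indicator U x *\<^sub>R V j x) \<in> borel_measurable lborel"
      using V(1) by (simp add: is_weak_gradient_def weak_deriv_def locally_integrable_def set_borel_measurable_def)
    then have "(\<lambda>x. (indicator U x *\<^sub>R V j x) \<bullet> i) \<in> borel_measurable lborel"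
      by (intro borel_measurable_inner borel_measurable_const)
    then show "Y j \<in> borel_measurable borel"
      unfolding Y_def[abs_def] by simp
  qed
  moreover have "(nn_integral_on U (\<lambda>x. gradient_size Y x powr p)) \<le> ennreal (hom_sobolev_norm p U v powr p)"
  proof -
    have gs: "gradient_size Y x \<le> gradient_size V x" if "x \<in> U" for x
      unfolding gradient_size_def using that Basis_le_norm[OF i]
      by (intro real_sqrt_le_mono sum_mono power_mono) (auto simp: Y_def)
    have "(nn_integral_on U (\<lambda>x. gradient_size Y x powr p))
      \<le> (nn_integral_on U (\<lambda>x. norm (gradient_size V x) powr p))"
    proof (rule nn_integral_mono)
      fix x
      show "indicator U x * ennreal (gradient_size Y x powr p) \<le> indicator U x * ennreal (norm (gradient_size V x) powr p)"
        using gs[of x] gradient_size_nonneg[of Y x] gradient_size_nonneg[of V x] \<open>p > 0\<close>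
        by (cases "x \<in> U") (auto intro!: ennreal_leI powr_mono2)
    qed
    also have "\<dots> = ennreal (Lp_norm p U (gradient_size V) powr p)"
      by (rule nn_integral_eq_Lp_norm[OF V(2) \<open>p > 0\<close>])
    also have "\<dots> \<le> ennreal (hom_sobolev_norm p U v powr p)"
      using le Lp_norm_nonneg \<open>p > 0\<close> by (intro ennreal_leI powr_mono2) auto
    finally show ?thesis .
  qed
  ultimately show ?thesis
    by blast
qed

lemma hom_sobolev_component_Lq:
  fixes v :: "'a::euclidean_space \<Rightarrow> 'a" and i :: 'a
  assumes v: "v \<in> hom_sobolev p U" and q: "q = sobolev_exponent TYPE('a) p" "q > 0" and i: "i \<in> Basis"
    and f: "\<And>x. x \<in> U \<Longrightarrow> f x = v x \<bullet> i"
  shows "(nn_integral_on U (\<lambda>x. \<bar>f x\<bar> powr q)) \<le> ennreal (hom_sobolev_norm p U v powr q)"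
proof -
  have "(nn_integral_on U (\<lambda>x. \<bar>f x\<bar> powr q)) \<le> (nn_integral_on U (\<lambda>x. norm (v x) powr q))"
  proof (rule nn_integral_mono)
    fix x
    show "indicator U x * ennreal (\<bar>f x\<bar> powr q) \<le> indicator U x * ennreal (norm (v x) powr q)"
      using f[of x] Basis_le_norm[OF i, of "v x"] q(2) by (cases "x \<in> U") (auto intro!: ennreal_leI powr_mono2)
  qed
  also have "\<dots> = ennreal (Lp_norm q U v powr q)"
    using v q by (intro nn_integral_eq_Lp_norm) (auto simp: hom_sobolev_def)
  also have "\<dots> \<le> ennreal (hom_sobolev_norm p U v powr q)"
    using Lp_norm_nonneg[of q U v] Lp_norm_nonneg[of p U "gradient_size (weak_gradient U v)"] q
    by (intro ennreal_leI powr_mono2) (auto simp: hom_sobolev_norm_def)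
  finally show ?thesis .
qed

text \<open>The norm of a slice is measurable in time only for the completed measure. Its square
  agrees almost everywhere with a Borel function; cutting that off at 0 and taking the root makes
  the representative nonnegative at every time.\<close>

lemma L2_time_representative:
  fixes v :: "'a::euclidean_space \<times> real \<Rightarrow> 'b::euclidean_space"
  assumes v: "v \<in> L2_time T U X nrm" and nrm: "\<And>g. nrm g \<ge> 0"
  shows "\<exists>m\<in>borel_measurable borel. (\<forall>t. m t \<ge> 0) \<and> (AE t in lborel. t \<in> {0<..<T} \<longrightarrow> m t = nrm (\<lambda>x. v (x, t))) \<and>
    (nn_integral_on {0<..<T} (\<lambda>t. (m t)\<^sup>2)) = ennreal ((L2_time_norm T nrm v)\<^sup>2)"
proof -
  let ?g = "\<lambda>t. indicator {0<..<T} t *\<^sub>R (nrm (\<lambda>x. v (x, t)))\<^sup>2"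
  have int: "integrable lebesgue ?g"
    using v by (simp add: L2_time_def set_integrable_def)
  from completion_ex_borel_measurable_real[OF borel_measurable_integrable[OF this]]
  obtain g' where [measurable]: "g' \<in> borel_measurable borel" and g': "AE t in lborel. ?g t = g' t"
    by auto
  define m where "m t = sqrt (max 0 (g' t))" for t
  have m: "AE t in lborel. t \<in> {0<..<T} \<longrightarrow> m t = nrm (\<lambda>x. v (x, t))"
    using g'
  proof eventually_elim
    case (elim t)
    show ?case
    proof
      assume "t \<in> {0<..<T}"
      then have "g' t = (nrm (\<lambda>x. v (x, t)))\<^sup>2"
        using elim by simp
      then show "m t = nrm (\<lambda>x. v (x, t))"
        using nrm by (simp add: m_def)
    qed
  qed
  have "(nn_integral_on {0<..<T} (\<lambda>t. (m t)\<^sup>2)) = (\<integral>\<^sup>+t. ennreal (?g t) \<partial>lborel)"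
  proof (rule nn_integral_cong_AE)
    show "AE t in lborel. indicator {0<..<T} t * ennreal ((m t)\<^sup>2) = ennreal (?g t)"
      using m by eventually_elim (auto simp: indicator_def)
  qed
  also have "\<dots> = (\<integral>\<^sup>+t. ennreal (?g t) \<partial>lebesgue)"
    by (simp only: nn_integral_completion)
  also have "\<dots> = ennreal (LINT t:{0<..<T}|lebesgue. (nrm (\<lambda>x. v (x, t)))\<^sup>2)"
    unfolding set_lebesgue_integral_def by (rule nn_integral_eq_integral[OF int]) (auto simp: indicator_def)
  also have "(LINT t:{0<..<T}|lebesgue. (nrm (\<lambda>x. v (x, t)))\<^sup>2) = (L2_time_norm T nrm v)\<^sup>2"
  proof -
    have "(LINT t:{0<..<T}|lebesgue. (nrm (\<lambda>x. v (x, t)))\<^sup>2) \<ge> 0"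
      unfolding set_lebesgue_integral_def by (rule integral_nonneg_AE) (auto simp: indicator_def)
    then show ?thesis
      by (simp add: L2_time_norm_def)
  qed
  finally have "(nn_integral_on {0<..<T} (\<lambda>t. (m t)\<^sup>2)) = ennreal ((L2_time_norm T nrm v)\<^sup>2)" .
  moreover have "m \<in> borel_measurable borel" "\<forall>t. m t \<ge> 0"
    unfolding m_def by auto
  ultimately show ?thesis
    using m by blast
qed

section \<open>Products of test functions in space and time\<close>

lemma tensor_test_function:
  fixes \<psi> :: "'a::euclidean_space \<Rightarrow> real" and \<zeta> :: "real \<Rightarrow> real"
  assumes \<psi>: "\<psi> \<in> test_functions U" and \<zeta>: "\<zeta> \<in> test_functions I"
  shows "(\<lambda>z. \<psi> (fst z) * \<zeta> (snd z)) \<in> test_functions (U \<times> I)"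
    and "frechet_derivative (\<lambda>z. \<psi> (fst z) * \<zeta> (snd z)) (at z) e
      = \<psi> (fst z) * frechet_derivative \<zeta> (at (snd z)) (snd e) + frechet_derivative \<psi> (at (fst z)) (fst e) * \<zeta> (snd z)"
proof -
  \<comment> \<open>Adding 0 brings both factors into the shape of
    \<open>C_k_affine\<close>.\<close>
  have smooth: "C_k k (\<lambda>z::'a \<times> real. \<psi> (fst z + 0) * \<zeta> (snd z + 0))" for k
    by (rule C_k_mult[OF C_k_affine[OF bounded_linear_fst test_function_smooth[OF \<psi>]]
        C_k_affine[OF bounded_linear_snd test_function_smooth[OF \<zeta>]]])
  obtain K where K: "compact K" "K \<subseteq> U" "\<And>x. x \<notin> K \<Longrightarrow> \<psi> x = 0"
      and d\<psi>: "\<And>x. (\<psi> has_derivative frechet_derivative \<psi> (at x)) (at x)"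
    using test_functionE[OF \<psi>] by metis
  obtain L where L: "compact L" "L \<subseteq> I" "\<And>x. x \<notin> L \<Longrightarrow> \<zeta> x = 0"
      and d\<zeta>: "\<And>x. (\<zeta> has_derivative frechet_derivative \<zeta> (at x)) (at x)"
    using test_functionE[OF \<zeta>] by metis
  have zero: "\<psi> (fst z) * \<zeta> (snd z) = 0" if "z \<notin> K \<times> L" for z
    using that K(3)[of "fst z"] L(3)[of "snd z"] by (cases z) auto
  have KL: "compact (K \<times> L)" "K \<times> L \<subseteq> U \<times> I"
    using K(1,2) L(1,2) by (auto intro: compact_Times)
  show "(\<lambda>z. \<psi> (fst z) * \<zeta> (snd z)) \<in> test_functions (U \<times> I)"
    unfolding test_functions_def mem_Collect_eq
  proof (intro conjI allI exI[of _ "K \<times> L"] impI KL)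
    show "C_k k (\<lambda>z. \<psi> (fst z) * \<zeta> (snd z))" for k
      using smooth[of k] by (simp only: add_0_right)
  qed (rule zero)
  have "((\<lambda>z. \<psi> (fst z) * \<zeta> (snd z)) has_derivative
      (\<lambda>e. \<psi> (fst z) * frechet_derivative \<zeta> (at (snd z)) (snd e) + frechet_derivative \<psi> (at (fst z)) (fst e) * \<zeta> (snd z))) (at z)"
    by (rule has_derivative_mult[OF has_derivative_compose[OF bounded_linear_imp_has_derivative[OF bounded_linear_fst] d\<psi>]
        has_derivative_compose[OF bounded_linear_imp_has_derivative[OF bounded_linear_snd] d\<zeta>]])
  then show "frechet_derivative (\<lambda>z. \<psi> (fst z) * \<zeta> (snd z)) (at z) e
      = \<psi> (fst z) * frechet_derivative \<zeta> (at (snd z)) (snd e) + frechet_derivative \<psi> (at (fst z)) (fst e) * \<zeta> (snd z)"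
    by (subst frechet_derivative_at[symmetric]) auto
qed

lemma derivative_test_function:
  assumes \<phi>: "\<phi> \<in> test_functions U" and e: "e \<in> Basis"
  shows "(\<lambda>x. frechet_derivative \<phi> (at x) e) \<in> test_functions U"
proof -
  obtain K where "compact K" "K \<subseteq> U" "\<And>x. x \<notin> K \<Longrightarrow> frechet_derivative \<phi> (at x) e = 0"
    using test_functionE[OF \<phi>] by metis
  moreover have "C_k k (\<lambda>x. frechet_derivative \<phi> (at x) e)" for k
    using C_k_SucD(2)[OF test_function_smooth[OF \<phi>] e] .
  ultimately show ?thesis
    unfolding test_functions_def by blast
qed

text \<open>Both sides of the relation equal \<open>\<integral> \<partial>\<^sub>i\<psi> \<zeta>' u\<close> up to sign.\<close>

lemma weak_time_relation_gradient:
  fixes u :: "'a::euclidean_space \<times> real \<Rightarrow> real"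
  assumes G: "is_spatial_gradient (W \<times> I) u G" and D: "is_time_derivative (W \<times> I) u D" and i: "i \<in> Basis"
    and f: "\<And>z. z \<in> W \<times> I \<Longrightarrow> f z = G z \<bullet> i" and D': "\<And>z. z \<in> W \<times> I \<Longrightarrow> D' z = D z"
  shows "weak_time_relation W I i f D'"
  unfolding weak_time_relation_def
proof (intro ballI)
  fix \<psi> :: "'a \<Rightarrow> real" and \<zeta> :: "real \<Rightarrow> real"
  assume \<psi>: "\<psi> \<in> test_functions W" and \<zeta>: "\<zeta> \<in> test_functions I"
  let ?d\<psi> = "\<lambda>x. frechet_derivative \<psi> (at x) i" and ?d\<zeta> = "\<lambda>t. frechet_derivative \<zeta> (at t) 1"
  have d\<psi>: "?d\<psi> \<in> test_functions W" and d\<zeta>: "?d\<zeta> \<in> test_functions I"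
    using derivative_test_function[OF \<psi> i] derivative_test_function[OF \<zeta>] by auto
  \<comment> \<open>The directions \<open>(i, 0)\<close> and \<open>(0, 1)\<close> each annihilate
    one of the two terms of the product rule.\<close>
  have zero: "frechet_derivative \<theta> (at x) 0 = 0" if "\<theta> \<in> test_functions S" for \<theta> and x :: "'c::euclidean_space" and S
    using linear_0[OF has_derivative_linear[OF C_k_SucD(1)[OF test_function_smooth[OF that]]]] .
  have wdG: "weak_deriv (W \<times> I) (i, 0) u (\<lambda>z. G z \<bullet> i)" and wdD: "weak_deriv (W \<times> I) (0, 1) u D"
    using G D i by (auto simp: is_spatial_gradient_def is_time_derivative_def)
  note T1 = tensor_test_function[OF \<psi> d\<zeta>] and T2 = tensor_test_function[OF d\<psi> \<zeta>]
  have off: "\<theta> z = 0" if "\<theta> \<in> test_functions (W \<times> I)" "z \<notin> W \<times> I" for \<theta> z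
    using that unfolding test_functions_def by blast
  have "(LINT z|lborel. \<psi> (fst z) * ?d\<zeta> (snd z) * f z) = (LINT z|lborel. \<psi> (fst z) * ?d\<zeta> (snd z) * (G z \<bullet> i))"
  proof (rule Bochner_Integration.integral_cong[OF refl])
    show "\<psi> (fst z) * ?d\<zeta> (snd z) * f z = \<psi> (fst z) * ?d\<zeta> (snd z) * (G z \<bullet> i)" for z
    proof (cases "z \<in> W \<times> I")
      case False
      then show ?thesis
        by (simp only: off[OF T1(1) False] mult_zero_left)
    qed (simp only: f)
  qed
  also have "\<dots> = - (LINT z|lborel. ?d\<psi> (fst z) * ?d\<zeta> (snd z) * u z)"
    using weak_deriv_test[OF wdG T1(1)] unfolding T1(2) by (simp add: zero[OF d\<zeta>])
  also have "\<dots> = (LINT z|lborel. ?d\<psi> (fst z) * \<zeta> (snd z) * D z)"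
    using weak_deriv_test[OF wdD T2(1)] unfolding T2(2) by (simp add: zero[OF d\<psi>])
  also have "\<dots> = (LINT z|lborel. ?d\<psi> (fst z) * \<zeta> (snd z) * D' z)"
  proof (rule Bochner_Integration.integral_cong[OF refl])
    show "?d\<psi> (fst z) * \<zeta> (snd z) * D z = ?d\<psi> (fst z) * \<zeta> (snd z) * D' z" for z
    proof (cases "z \<in> W \<times> I")
      case False
      then show ?thesis
        by (simp only: off[OF T2(1) False] mult_zero_left)
    qed (simp only: D')
  qed
  finally show "(LINT z|lborel. \<psi> (fst z) * ?d\<zeta> (snd z) * f z) = (LINT z|lborel. ?d\<psi> (fst z) * \<zeta> (snd z) * D' z)" .
qed

lemma hom_sobolev_norm_nonneg: "hom_sobolev_norm p U v \<ge> 0"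
  unfolding hom_sobolev_norm_def by (intro add_nonneg_nonneg Lp_norm_nonneg)

lemma L2_time_norm_nonneg: "L2_time_norm T nrm v \<ge> 0"
  unfolding L2_time_norm_def set_lebesgue_integral_def
  by (intro real_sqrt_ge_zero integral_nonneg_AE) (auto simp: indicator_def)

text \<open>Both functions are multiplied by the indicator of the cylinder, since measurability is
  given there only while \<open>parabolic_pair\<close> asks for Borel functions on the whole space.
  Slices at times in {0<..<T} and pairings with test functions on the cylinder are
  unaffected.\<close>

lemma parabolic_pair_component:
  fixes \<Omega> :: "'a::euclidean_space set" and i :: 'a and m n :: "real \<Rightarrow> real"
  assumes "open \<Omega>" "DIM('a) \<ge> 2" "p > 1" "p < 2" and q: "q = real DIM('a) * p / (real DIM('a) - p)" "q \<ge> 2"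
    and i: "i \<in> Basis"
    and G: "is_spatial_gradient (\<Omega> \<times> {0<..<T}) u G" "G \<in> L2_time T \<Omega> (hom_sobolev p \<Omega>) (hom_sobolev_norm p \<Omega>)"
    and D: "is_time_derivative (\<Omega> \<times> {0<..<T}) u D" "D \<in> L2_time T \<Omega> (Lp p \<Omega>) (Lp_norm p \<Omega>)"
    and m: "m \<in> borel_measurable borel" "\<And>t. m t \<ge> 0"
      "AE t in lborel. t \<in> {0<..<T} \<longrightarrow> m t = hom_sobolev_norm p \<Omega> (\<lambda>x. G (x, t))"
    and n: "n \<in> borel_measurable borel" "\<And>t. n t \<ge> 0"
      "AE t in lborel. t \<in> {0<..<T} \<longrightarrow> n t = Lp_norm p \<Omega> (\<lambda>x. D (x, t))"
  shows "parabolic_pair \<Omega> T p q i (\<lambda>z. indicator (\<Omega> \<times> {0<..<T}) z * (G z \<bullet> i)) (\<lambda>z. indicator (\<Omega> \<times> {0<..<T}) z * D z) m n"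
proof
  let ?Q = "\<Omega> \<times> {0<..<T}"
  have Gm: "(\<lambda>z. indicator ?Q z *\<^sub>R G z) \<in> borel_measurable borel"
    and Gs: "AE t in lborel. t \<in> {0<..<T} \<longrightarrow> (\<lambda>x. G (x, t)) \<in> hom_sobolev p \<Omega>"
    using G(2) by (auto simp: L2_time_def set_borel_measurable_def)
  have Dm: "(\<lambda>z. indicator ?Q z * D z) \<in> borel_measurable borel"
    and Ds: "AE t in lborel. t \<in> {0<..<T} \<longrightarrow> (\<lambda>x. D (x, t)) \<in> Lp p \<Omega>"
    using D(2) by (auto simp: L2_time_def set_borel_measurable_def)
  show "(\<lambda>z. indicator ?Q z * (G z \<bullet> i)) \<in> borel_measurable borel"
    using borel_measurable_inner[OF Gm borel_measurable_const[of i]] by simp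
  show "(\<lambda>z. indicator ?Q z * D z) \<in> borel_measurable borel"
    by (rule Dm)
  have GL: "locally_integrable ?Q (\<lambda>z. G z \<bullet> i)"
    using G(1) i by (simp add: is_spatial_gradient_def weak_deriv_def)
  show "locally_integrable ?Q (\<lambda>z. indicator ?Q z * (G z \<bullet> i))"
    \<comment> \<open>On the reals the inner product with 1 is the identity, so the cut-off function
      counts as a component of the original one.\<close>
    by (rule locally_integrable_component[OF GL, where i = 1]) simp
  have DL: "locally_integrable ?Q D"
    using D(1) by (simp add: is_time_derivative_def weak_deriv_def)
  show "locally_integrable ?Q (\<lambda>z. indicator ?Q z * D z)"
    by (rule locally_integrable_component[OF DL, where i = 1]) simp
  show "weak_time_relation \<Omega> {0<..<T} i (\<lambda>z. indicator ?Q z * (G z \<bullet> i)) (\<lambda>z. indicator ?Q z * D z)"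
    by (rule weak_time_relation_gradient[OF G(1) D(1) i]) simp_all
  show "AE t in lborel. t \<in> {0<..<T} \<longrightarrow> (\<exists>V. is_weak_gradient \<Omega> (\<lambda>x. indicator ?Q (x, t) * (G (x, t) \<bullet> i)) V \<and>
      (\<forall>j\<in>Basis. V j \<in> borel_measurable borel) \<and>
      (nn_integral_on \<Omega> (\<lambda>x. gradient_size V x powr p)) \<le> ennreal (m t powr p))"
    using Gs m(3)
  proof eventually_elim
    case (elim t)
    show ?case
    proof
      assume t: "t \<in> {0<..<T}"
      then have mt: "m t = hom_sobolev_norm p \<Omega> (\<lambda>x. G (x, t))" and v: "(\<lambda>x. G (x, t)) \<in> hom_sobolev p \<Omega>"
        using elim by blast+
      show "\<exists>V. is_weak_gradient \<Omega> (\<lambda>x. indicator ?Q (x, t) * (G (x, t) \<bullet> i)) V \<and>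
        (\<forall>j\<in>Basis. V j \<in> borel_measurable borel) \<and>
        (nn_integral_on \<Omega> (\<lambda>x. gradient_size V x powr p)) \<le> ennreal (m t powr p)"
        unfolding mt by (rule hom_sobolev_component[OF v \<open>open \<Omega>\<close> _ i]) (use t \<open>p > 1\<close> in auto)
    qed
  qed
  show "AE t in lborel. t \<in> {0<..<T} \<longrightarrow>
      (nn_integral_on \<Omega> (\<lambda>x. \<bar>indicator ?Q (x, t) * (G (x, t) \<bullet> i)\<bar> powr q)) \<le> ennreal (m t powr q)"
    using Gs m(3)
  proof eventually_elim
    case (elim t)
    show ?case
    proof
      assume t: "t \<in> {0<..<T}"
      then have mt: "m t = hom_sobolev_norm p \<Omega> (\<lambda>x. G (x, t))" and v: "(\<lambda>x. G (x, t)) \<in> hom_sobolev p \<Omega>"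
        using elim by blast+
      show "(nn_integral_on \<Omega> (\<lambda>x. \<bar>indicator ?Q (x, t) * (G (x, t) \<bullet> i)\<bar> powr q)) \<le> ennreal (m t powr q)"
        unfolding mt by (rule hom_sobolev_component_Lq[OF v _ _ i]) (use t q in \<open>auto simp: sobolev_exponent_def\<close>)
    qed
  qed
  show "AE t in lborel. t \<in> {0<..<T} \<longrightarrow>
      (nn_integral_on \<Omega> (\<lambda>x. \<bar>indicator ?Q (x, t) * D (x, t)\<bar> powr p)) \<le> ennreal (n t powr p)"
    using Ds n(3)
  proof eventually_elim
    case (elim t)
    show ?case
    proof
      assume t: "t \<in> {0<..<T}"
      then have nt: "n t = Lp_norm p \<Omega> (\<lambda>x. D (x, t))" and v: "(\<lambda>x. D (x, t)) \<in> Lp p \<Omega>"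
        using elim by blast+
      have "(nn_integral_on \<Omega> (\<lambda>x. \<bar>indicator ?Q (x, t) * D (x, t)\<bar> powr p))
        = (nn_integral_on \<Omega> (\<lambda>x. norm (D (x, t)) powr p))"
        using t by (intro nn_integral_cong) (auto simp: indicator_def)
      then show "(nn_integral_on \<Omega> (\<lambda>x. \<bar>indicator ?Q (x, t) * D (x, t)\<bar> powr p)) \<le> ennreal (n t powr p)"
        using nn_integral_eq_Lp_norm[OF v] \<open>p > 1\<close> nt by simp
    qed
  qed
qed (use assms in auto)

section \<open>The estimate for the whole gradient\<close>

lemma nn_integral_time_slab:
  fixes f :: "'a::euclidean_space \<times> real \<Rightarrow> real"
  assumes [measurable]: "f \<in> borel_measurable borel" "W \<in> sets borel"
  shows "(\<integral>\<^sup>+z. indicator (W \<times> {s<..<s + l}) z * ennreal ((f z)\<^sup>2) \<partial>lborel)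
    = interval_integral (\<lambda>t. nn_integral_on W (\<lambda>x. (f (x, t))\<^sup>2)) s l"
proof -
  have "(\<integral>\<^sup>+z. indicator (W \<times> {s<..<s + l}) z * ennreal ((f z)\<^sup>2) \<partial>(lborel \<Otimes>\<^sub>M lborel))
    = (\<integral>\<^sup>+t. \<integral>\<^sup>+x. indicator (W \<times> {s<..<s + l}) (x, t) * ennreal ((f (x, t))\<^sup>2) \<partial>lborel \<partial>lborel)"
  proof (rule lborel_pair.nn_integral_snd[symmetric])
    have "(\<lambda>z. indicator W (fst z) * indicator {s<..<s + l} (snd z) * ennreal ((f (fst z, snd z))\<^sup>2))
        \<in> borel_measurable (lborel \<Otimes>\<^sub>M lborel)"
      by measurable
    then show "(\<lambda>z. indicator (W \<times> {s<..<s + l}) z * ennreal ((f z)\<^sup>2)) \<in> borel_measurable (lborel \<Otimes>\<^sub>M lborel)"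
      by (simp add: indicator_times)
  qed
  also have "\<dots> = (\<integral>\<^sup>+t. indicator {s<..<s + l} t * (nn_integral_on W (\<lambda>x. (f (x, t))\<^sup>2)) \<partial>lborel)"
    by (simp add: indicator_times mult.assoc mult.left_commute[of _ "indicator {s<..<s + l} _"] nn_integral_cmult)
  finally show ?thesis
    by (simp add: lborel_prod interval_integral_def)
qed

text \<open>The constant is chosen before the domain, T and the functions, but after the lower bound
  \<open>T0\<close> for T. For \<open>u\<close> a coordinate function and \<delta>^2 = T the left
  side is of order T^(1/2) and the right side of order T^(1/2 + \<alpha>/2), so for \<alpha> > 0 no
  constant serves all small T. Membership of \<open>G\<close> in \<open>Lp 2\<close> is part of the
  conclusion because the norm of a function that is not square integrable would be 0 by convention,
  and the inequality alone would then be empty.\<close>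

theorem corollary3p2:
  fixes p r0 M T0 :: real and N :: nat
  assumes "DIM('a::euclidean_space) \<ge> 2"
    and "2 * real DIM('a) / (real DIM('a) + 2) \<le> p" and "p < 2" and "p > 1"
    and "T0 > 0"
  shows "\<exists>C>0. \<forall>(\<Omega> :: 'a set) T u G D.
    bounded_lipschitz_domain r0 M N \<Omega> \<longrightarrow> T \<ge> T0 \<longrightarrow>
    is_spatial_gradient (\<Omega> \<times> {0<..<T}) u G \<longrightarrow>
    is_time_derivative (\<Omega> \<times> {0<..<T}) u D \<longrightarrow>
    G \<in> L2_time T \<Omega> (hom_sobolev p \<Omega>) (hom_sobolev_norm p \<Omega>) \<longrightarrow>
    D \<in> L2_time T \<Omega> (Lp p \<Omega>) (Lp_norm p \<Omega>) \<longrightarrow>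
    (\<forall>\<delta> s. \<delta> > 0 \<longrightarrow> \<delta>\<^sup>2 \<le> T \<longrightarrow> s \<in> {0..T - \<delta>\<^sup>2} \<longrightarrow>
       G \<in> Lp 2 (\<Omega> \<times> {s<..<s + \<delta>\<^sup>2}) \<and>
       Lp_norm 2 (\<Omega> \<times> {s<..<s + \<delta>\<^sup>2}) G
         \<le> C * \<delta> powr (1 + real DIM('a) / 2 - real DIM('a) / p) *
           (L2_time_norm T (hom_sobolev_norm p \<Omega>) G + L2_time_norm T (Lp_norm p \<Omega>) D))"
proof (cases "r0 > 0")
  \<comment> \<open>No domain has a character with \<open>r0 \<le> 0\<close>, so any constant will
    do.\<close>
  case False
  then show ?thesis
    by (intro exI[of _ 1]) (simp add: bounded_lipschitz_domain_def)
next
  case True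
  let ?d = "real DIM('a)" and ?\<alpha> = "1 + real DIM('a) / 2 - real DIM('a) / p"
  define q where "q = ?d * p / (?d - p)"
  have dp: "?d - p > 0" "2 * ?d \<le> p * (?d + 2)"
    using assms by (auto simp: field_simps)
  \<comment> \<open>This and \<alpha> \<ge> 0 below are both the lower bound on \<open>p\<close> in
    another form.\<close>
  have q: "q \<ge> 2"
    using dp by (simp add: q_def field_simps)
  have "?d / p \<le> (?d + 2) / 2"
    using dp(2) \<open>p > 1\<close> by (simp add: field_simps)
  then have \<alpha>0: "0 \<le> ?\<alpha>"
    by (simp add: add_divide_distrib)
  have "?d / 2 < ?d / p"
    using \<open>p < 2\<close> \<open>p > 1\<close> \<open>DIM('a) \<ge> 2\<close> by (intro divide_strict_left_mono) auto
  then have \<alpha>1: "?\<alpha> < 1"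
    by simp
  \<comment> \<open>The kernel, the cone parameters and the decay constant are all fixed here,
    before any domain, time or function, which makes the final constant uniform.\<close>
  obtain b w :: "'a \<Rightarrow> real" and B where mol: "mollifier b w B"
    using mollifier_exists by blast
  define R where "R = \<bar>M\<bar> + 1"
  define \<tau>0 where "\<tau>0 = r0 / (4 * (\<bar>M\<bar> + 2))"
  have R: "R \<ge> 0" and \<tau>0: "\<tau>0 > 0"
    using True by (auto simp: R_def \<tau>0_def)
  obtain K where K: "K > 0" "is_decay_constant ?\<alpha> (\<tau>0\<^sup>2) T0 K"
    using interval_integral_decay[OF \<alpha>0 \<alpha>1 _ \<open>T0 > 0\<close>, of "\<tau>0\<^sup>2"] \<tau>0 by auto
  \<comment> \<open>The volume bound, raised to at least 1 as the \<open>L\<^sup>2\<close> bound on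
    the slices demands.\<close>
  define \<mu> where "\<mu> = max 1 ((4 * real N * r0) ^ DIM('a))"
  define H where "H = K * (4 * (4 * real (Suc N) * (12 * B * (R + 1)) powr p + 2 * 2 powr q) + 2 * \<mu>)"
  have "0 < 4 * (4 * real (Suc N) * (12 * B * (R + 1)) powr p + 2 * 2 powr q) + 2 * \<mu>"
    by (intro add_nonneg_pos mult_nonneg_nonneg add_nonneg_nonneg) (auto simp: \<mu>_def)
  then have H: "H > 0"
    using K by (simp add: H_def)
  show ?thesis
  \<comment> \<open>The squared norm of the gradient is a sum over \<open>?d\<close> components,
    each bounded with the constant \<open>H\<close>; the root returns from squares to norms.\<close>
  proof (intro exI[of _ "sqrt (?d * H)"] conjI allI impI)
    show "0 < sqrt (?d * H)"
      using H by simp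
    fix \<Omega> :: "'a set" and T u G D and \<delta> s :: real
    assume dom: "bounded_lipschitz_domain r0 M N \<Omega>" and T: "T \<ge> T0"
      and G: "is_spatial_gradient (\<Omega> \<times> {0<..<T}) u G" "G \<in> L2_time T \<Omega> (hom_sobolev p \<Omega>) (hom_sobolev_norm p \<Omega>)"
      and D: "is_time_derivative (\<Omega> \<times> {0<..<T}) u D" "D \<in> L2_time T \<Omega> (Lp p \<Omega>) (Lp_norm p \<Omega>)"
      and \<delta>: "\<delta> > 0" "s \<in> {0..T - \<delta>\<^sup>2}"
    let ?Q = "\<Omega> \<times> {0<..<T}" and ?Q' = "\<Omega> \<times> {s<..<s + \<delta>\<^sup>2}"
    let ?A = "L2_time_norm T (hom_sobolev_norm p \<Omega>) G" and ?B = "L2_time_norm T (Lp_norm p \<Omega>) D"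
    have "open \<Omega>"
      using dom by (simp add: bounded_lipschitz_domain_def)
    then have [measurable]: "\<Omega> \<in> sets borel" and Q'_sets: "?Q' \<in> sets borel"
      using open_Times[OF \<open>open \<Omega>\<close> open_greaterThanLessThan] by (auto intro: borel_open)
    have Q'Q: "?Q' \<subseteq> ?Q"
      using \<delta>(2) by auto
    obtain m where m: "m \<in> borel_measurable borel" "\<And>t. m t \<ge> 0"
        "AE t in lborel. t \<in> {0<..<T} \<longrightarrow> m t = hom_sobolev_norm p \<Omega> (\<lambda>x. G (x, t))"
        "(nn_integral_on {0<..<T} (\<lambda>t. (m t)\<^sup>2)) = ennreal (?A\<^sup>2)"
      using L2_time_representative[OF G(2) hom_sobolev_norm_nonneg] by blast
    obtain n where n: "n \<in> borel_measurable borel" "\<And>t. n t \<ge> 0"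
        "AE t in lborel. t \<in> {0<..<T} \<longrightarrow> n t = Lp_norm p \<Omega> (\<lambda>x. D (x, t))"
        "(nn_integral_on {0<..<T} (\<lambda>t. (n t)\<^sup>2)) = ennreal (?B\<^sup>2)"
      using L2_time_representative[OF D(2) Lp_norm_nonneg] by blast
    have mn: "(\<integral>\<^sup>+t. indicator {0<..<T} t * (ennreal ((m t)\<^sup>2) + ennreal ((n t)\<^sup>2)) \<partial>lborel) = ennreal (?A\<^sup>2 + ?B\<^sup>2)"
      using m(1,4) n(1,4) by (simp add: distrib_left nn_integral_add)
    define f where "f i z = indicator ?Q z * (G z \<bullet> i)" for i z
    have fm: "f i \<in> borel_measurable borel" if "i \<in> Basis" for i
    proof -
      have "(\<lambda>z. indicator ?Q z *\<^sub>R G z) \<in> borel_measurable borel"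
        using G(2) by (simp add: L2_time_def set_borel_measurable_def)
      from borel_measurable_inner[OF this borel_measurable_const[of i]] show ?thesis
        by (simp add: f_def[abs_def])
    qed
    have slab: "(\<integral>\<^sup>+z. indicator ?Q' z * ennreal ((f i z)\<^sup>2) \<partial>lborel) \<le> ennreal (H * \<delta> powr (2 * ?\<alpha>) * (?A\<^sup>2 + ?B\<^sup>2))"
      if i: "i \<in> Basis" for i
    proof -
      interpret parabolic_pair \<Omega> T p q i "f i" "\<lambda>z. indicator ?Q z * D z" m n
        unfolding f_def[abs_def]
        by (rule parabolic_pair_component[OF \<open>open \<Omega>\<close> assms(1,4,3) q_def q i G D m(1-3) n(1-3)])
      have vol: "emeasure lborel \<Omega> \<le> ennreal \<mu>"
        using lipschitz_domain_volume_le[OF dom assms(1)] by (rule order_trans) (auto simp: \<mu>_def intro!: ennreal_leI)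
      have "(\<integral>\<^sup>+z. indicator ?Q' z * ennreal ((f i z)\<^sup>2) \<partial>lborel)
        = interval_integral (\<lambda>t. nn_integral_on \<Omega> (\<lambda>x. (f i (x, t))\<^sup>2)) s (\<delta>\<^sup>2)"
        by (rule nn_integral_time_slab[OF fm[OF i]]) measurable
      also have "\<dots> \<le> ennreal (H * (\<delta>\<^sup>2) powr ?\<alpha>) * ennreal (?A\<^sup>2 + ?B\<^sup>2)"
        unfolding H_def mn[symmetric]
        by (rule short_time_L2[OF mol lipschitz_domain_cone_cover[OF dom, folded R_def \<tau>0_def] R \<tau>0 vol _ K(2,1) T])
          (use \<delta> in \<open>auto simp: \<mu>_def\<close>)
      also have "\<dots> = ennreal (H * (\<delta>\<^sup>2) powr ?\<alpha> * (?A\<^sup>2 + ?B\<^sup>2))"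
        using H by (intro ennreal_mult[symmetric]) auto
      also have "(\<delta>\<^sup>2) powr ?\<alpha> = \<delta> powr (2 * ?\<alpha>)"
      proof -
        have "(\<delta>\<^sup>2) powr ?\<alpha> = (\<delta> powr 2) powr ?\<alpha>"
          using \<delta>(1) by simp
        then show ?thesis
          by (simp only: powr_powr)
      qed
      finally show ?thesis .
    qed
    define V where "V = ?d * (H * \<delta> powr (2 * ?\<alpha>) * (?A\<^sup>2 + ?B\<^sup>2))"
    have V: "V \<ge> 0"
      using H by (simp add: V_def)
    have normG: "indicator ?Q' z * ennreal (norm (G z) powr 2) = (\<Sum>i\<in>Basis. indicator ?Q' z * ennreal ((f i z)\<^sup>2))" for z
    proof (cases "z \<in> ?Q'")
      case True
      then have "f i z = G z \<bullet> i" for i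
        using Q'Q by (auto simp: f_def)
      moreover have "norm (G z) powr 2 = (\<Sum>i\<in>Basis. (G z \<bullet> i)\<^sup>2)"
      proof -
        have "(norm (G z))\<^sup>2 = (\<Sum>i\<in>Basis. (G z \<bullet> i)\<^sup>2)"
          unfolding power2_norm_eq_inner by (subst euclidean_inner) (simp add: power2_eq_square)
        then show ?thesis
          by simp
      qed
      ultimately show ?thesis
        using True by (simp add: sum_ennreal)
    qed simp
    have nn: "(\<integral>\<^sup>+z. indicator ?Q' z * ennreal (norm (G z) powr 2) \<partial>lborel) \<le> ennreal V"
    proof -
      have "(\<integral>\<^sup>+z. indicator ?Q' z * ennreal (norm (G z) powr 2) \<partial>lborel) = (\<Sum>i\<in>Basis. \<integral>\<^sup>+z. indicator ?Q' z * ennreal ((f i z)\<^sup>2) \<partial>lborel)"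
        unfolding normG
      proof (rule nn_integral_sum)
        fix i :: 'a assume "i \<in> Basis"
        note [measurable] = fm[OF this] Q'_sets
        show "(\<lambda>z. indicator ?Q' z * ennreal ((f i z)\<^sup>2)) \<in> borel_measurable lborel"
          by measurable
      qed
      also have "\<dots> \<le> (\<Sum>i\<in>(Basis :: 'a set). ennreal (H * \<delta> powr (2 * ?\<alpha>) * (?A\<^sup>2 + ?B\<^sup>2)))"
        by (rule sum_mono) (rule slab)
      also have "\<dots> = ennreal V"
        using H by (simp add: V_def ennreal_mult ennreal_of_nat_eq_real_of_nat)
      finally show ?thesis .
    qed
    have Gm: "(\<lambda>z. indicator ?Q' z *\<^sub>R G z) \<in> borel_measurable lborel"
    proof -
      have "(\<lambda>z. indicator ?Q z *\<^sub>R G z) \<in> borel_measurable borel"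
        using G(2) by (simp add: L2_time_def set_borel_measurable_def)
      from borel_measurable_scaleR[OF borel_measurable_indicator[OF Q'_sets] this]
      have "(\<lambda>z. indicat_real ?Q' z *\<^sub>R (indicator ?Q z *\<^sub>R G z)) \<in> borel_measurable borel" .
      moreover have "indicat_real ?Q' z *\<^sub>R (indicator ?Q z *\<^sub>R G z) = indicator ?Q' z *\<^sub>R G z" for z
      proof (cases "z \<in> ?Q'")
        case True
        then show ?thesis
          by (simp only: indicator_simps subsetD[OF Q'Q True] scaleR_one)
      qed simp
      ultimately show ?thesis
        by (simp only: measurable_lborel2)
    qed
    have eq: "indicator ?Q' z *\<^sub>R (norm (G z) powr 2) = norm (indicator ?Q' z *\<^sub>R G z) powr 2" for z
      by (simp add: indicator_def)
    have nn': "(\<integral>\<^sup>+z. ennreal (indicator ?Q' z *\<^sub>R (norm (G z) powr 2)) \<partial>lborel) \<le> ennreal V"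
    proof -
      have "ennreal (indicator ?Q' z *\<^sub>R (norm (G z) powr 2)) = indicator ?Q' z * ennreal (norm (G z) powr 2)" for z
        by (simp add: indicator_def)
      then show ?thesis
        using nn by simp
    qed
    have int: "integrable lborel (\<lambda>z. indicator ?Q' z *\<^sub>R (norm (G z) powr 2))"
    proof (rule integrableI_nonneg)
      show "(\<lambda>z. indicator ?Q' z *\<^sub>R (norm (G z) powr 2)) \<in> borel_measurable lborel"
        unfolding eq
        by (intro powr_real_measurable measurable_compose[OF Gm borel_measurable_norm] borel_measurable_const)
      show "(\<integral>\<^sup>+z. ennreal (indicator ?Q' z *\<^sub>R (norm (G z) powr 2)) \<partial>lborel) < \<infinity>"
        using nn' by (rule le_less_trans) simp
    qed simp
    then show "G \<in> Lp 2 ?Q'"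
      using Gm by (simp add: Lp_def set_borel_measurable_def set_integrable_def)
    have "ennreal (LINT z:?Q'|lborel. norm (G z) powr 2) \<le> ennreal V"
      using nn' nn_integral_eq_integral[OF int] by (simp add: set_lebesgue_integral_def)
    then have "(LINT z:?Q'|lborel. norm (G z) powr 2) \<le> V"
      using V by simp
    moreover have "(LINT z:?Q'|lborel. norm (G z) powr 2) \<ge> 0"
      unfolding set_lebesgue_integral_def by (rule integral_nonneg_AE) simp
    ultimately have "Lp_norm 2 ?Q' G \<le> sqrt V"
      unfolding Lp_norm_def powr_half_sqrt[OF V, symmetric] by (intro powr_mono2) auto
    also have "V \<le> (sqrt (?d * H) * \<delta> powr ?\<alpha> * (?A + ?B))\<^sup>2"
    proof -
      have "\<delta> powr (2 * ?\<alpha>) = (\<delta> powr ?\<alpha>)\<^sup>2"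
        by (simp only: power2_eq_square powr_add[symmetric] mult_2)
      moreover have "(sqrt (?d * H))\<^sup>2 = ?d * H"
        using H by simp
      moreover have "?A\<^sup>2 + ?B\<^sup>2 \<le> (?A + ?B)\<^sup>2"
        using L2_time_norm_nonneg[of T "hom_sobolev_norm p \<Omega>" G] L2_time_norm_nonneg[of T "Lp_norm p \<Omega>" D]
        by (simp add: power2_sum)
      ultimately show ?thesis
        using H unfolding V_def power_mult_distrib by (simp add: mult_left_mono)
    qed
    also have "sqrt ((sqrt (?d * H) * \<delta> powr ?\<alpha> * (?A + ?B))\<^sup>2) = sqrt (?d * H) * \<delta> powr ?\<alpha> * (?A + ?B)"
      using H L2_time_norm_nonneg[of T "hom_sobolev_norm p \<Omega>" G] L2_time_norm_nonneg[of T "Lp_norm p \<Omega>" D]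
      by (intro real_sqrt_unique) auto
    finally show "Lp_norm 2 ?Q' G \<le> sqrt (?d * H) * \<delta> powr ?\<alpha> * (?A + ?B)"
      by simp
  qed
qed

end
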